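(* Let $1<p<+\infty$, and let $\mathcal{A}$ be a vector space of real-valued Borel functions on $M$ such that $\mathcal{A}\subset\mathcal{D}(\mathcal{L}^{(p)})$ and $\mathcal{L}^{(p)}|_{\mathcal{A}}$ is $L^p$-unique. For a closed set $\Sigma\subset M$ write $\mathring{M}:=M\setminus\Sigma$. (i) Suppose in addition that for any compact $K\subset M$ the set $\omega_K^{\mathcal{A}}$ is nonempty. If $\Sigma\subset M$ is closed, $\mu(\Sigma)=0$ and $\mathcal{L}^{(p)}|_{\mathcal{A}(\mathring{M})}$ is $L^p$-unique, then $\mathrm{cap}_{2,p}^{\mathcal{A}}(\Sigma)=0$. (ii) Suppose in addition that (a) $\mathcal{A}$ is a subalgebra of $\mathcal{B}_b(M)\cap L^1(M)$, contained in $\mathcal{D}(\mathcal{L}^{(1)})$, and such that $\Gamma(f)\in L^\infty(M)$ and $\mathcal{L}f\in L^\infty(M)$ for all $f\in\mathcal{A}$; and (b) there is a constant $c(p)>0$ such that $\|\Gamma(f)^{1/2}\|_{L^p(M)}\le c(p)\,\|f\|_{\mathcal{D}(\mathcal{L}^{(p)})}$ for all $f\in\mathcal{A}$. If $\Sigma\subset M$ is compact and $\mathrm{cap}_{2,p}^{\mathcal{A}}(\Sigma)=0$, then $\mu(\Sigma)=0$ and $\mathcal{L}^{(p)}|_{\mathcal{A}(\mathring{M})}$ is $L^p$-unique with closure $(\mathcal{L}^{(p)},\mathcal{D}(\mathcal{L}^{(p)}))$. If $\mathcal{A}_c$ is dense in $\mathcal{A}$ with respect to $\|\cdot\|_{\mathcal{D}(\mathcal{L}^{(p)})}$,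 then the conclusion remains true for general closed $\Sigma\subset M$; in this case also $\mathcal{L}^{(p)}|_{\mathcal{A}_c(\mathring{M})}$ is $L^p$-unique with closure $(\mathcal{L}^{(p)},\mathcal{D}(\mathcal{L}^{(p)}))$.
   Context: Setup: $(M,\varrho)$ is a locally compact separable metric space and $\mu$ is a nonnegative Radon measure on $M$ with full support; $L^p(M):=L^p(M,\mu)$. $(\mathcal{L},\mathcal{D}(\mathcal{L}))$ is a non-positive definite densely defined self-adjoint operator on $L^2(M)$, and $(\mathcal{E},\mathcal{D}(\mathcal{E}))$ is its closed quadratic form, $\mathcal{E}(f,g)=-\langle\mathcal{L}f,g\rangle_{L^2(M)}$ for $f\in\mathcal{D}(\mathcal{L})$, $g\in\mathcal{D}(\mathcal{E})$. It is assumed that $(\mathcal{E},\mathcal{D}(\mathcal{E}))$ is a regular, strongly local Dirichlet form admitting a carré du champ: a bilinear nonnegative definite map $\Gamma$ from $(\mathcal{D}(\mathcal{E})\cap L^\infty(M))\times(\mathcal{D}(\mathcal{E})\cap L^\infty(M))$ into $L^1(M)$ with $\frac12\{\mathcal{E}(fh,g)+\mathcal{E}(f,gh)-\mathcal{E}(fg,h)\}=\int_M h\,\Gamma(f,g)\,d\mu$, extended by approximation to $\mathcal{D}(\mathcal{E})\times\mathcal{D}(\mathcal{E})$; $\Gamma(f):=\Gamma(f,f)$. $(P_t)_{t>0}$ is the symmetric Markov semigroup generated by $\mathcal{L}$; its restriction to $L^1(M)\cap L^\infty(M)$ extends to a strongly continuous contraction semigroup on each $L^p(M)$, $1\le p<+\infty$,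 with generator $(\mathcal{L}^{(p)},\mathcal{D}(\mathcal{L}^{(p)}))$; $\mathcal{L}^{(2)}=\mathcal{L}$. The operators $\mathcal{L}^{(p)}$ agree on intersections of their domains, and $\mathcal{L}f$ denotes the common value. A number $\lambda>0$ is fixed and $\|f\|_{\mathcal{D}(\mathcal{L}^{(p)})}:=\|(\lambda-\mathcal{L}^{(p)})f\|_{L^p(M)}$. $\mathcal{B}_b(M)$ is the space of bounded Borel functions on $M$. For $U\subset M$ open, $\mathcal{A}(U)$ is the subspace of functions in $\mathcal{A}$ with support contained in $U$; $\mathcal{A}_c$ and $\mathcal{A}_c(U)$ are the subspaces of compactly supported functions in $\mathcal{A}$ and $\mathcal{A}(U)$. $L^p$-uniqueness: a linear operator $(\mathcal{L}_0,\mathcal{A}_0)$ on $L^p(M)$ is called $L^p$-unique if $\mathcal{A}_0$ is dense in $L^p(M)$ and there is at most one strongly continuous semigroup on $L^p(M)$ whose generator extends $(\mathcal{L}_0,\mathcal{A}_0)$. Capacity: for $K\subset M$ compact, $\omega_K^{\mathcal{A}}$ is the set of $u\in\mathcal{A}$ with $u=1$ on an open neighborhood of $K$, and $\mathrm{cap}_{2,p}^{\mathcal{A}}(K):=\inf\{\|u\|_{\mathcal{D}(\mathcal{L}^{(p)})}^p: u\in\omega_K^{\mathcal{A}}\}$ (equal to $+\infty$ if $\omega_K^{\mathcal{A}}=\emptyset$). For general $E\subset M$, $\mathrm{cap}_{2,p}^{\mathcal{A}}(E):=\sup\{\mathrm{cap}_{2,p}^{\mathcal{A}}(K):K\subset E,\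 K\text{ compact}\}$. *)

theory Defs
  imports "HOL-Analysis.Analysis"
begin

text \<open>
  Elements of \<open>L\<^sup>p\<close> are represented by Borel functions, and two functions stand for the same
  element when they are equal almost everywhere. Operators on \<open>L\<^sup>p\<close> are represented by their
  graphs, so that the domain of an operator is the \<^const>\<open>Domain\<close> of a relation.
\<close>

type_synonym 'a operator_graph = "(('a \<Rightarrow> real) \<times> ('a \<Rightarrow> real)) set"

definition Lp_space :: "'a measure \<Rightarrow> real \<Rightarrow> ('a \<Rightarrow> real) set" where
  "Lp_space \<mu> p = {f \<in> borel_measurable \<mu>. integrable \<mu> (\<lambda>x. \<bar>f x\<bar> powr p)}"

definition Lp_norm :: "'a measure \<Rightarrow> real \<Rightarrow> ('a \<Rightarrow> real) \<Rightarrow> real" where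
  "Lp_norm \<mu> p f = (\<integral>x. \<bar>f x\<bar> powr p \<partial>\<mu>) powr (1 / p)"

definition Linf_space :: "'a measure \<Rightarrow> ('a \<Rightarrow> real) set" where
  "Linf_space \<mu> = {f \<in> borel_measurable \<mu>. \<exists>C. AE x in \<mu>. \<bar>f x\<bar> \<le> C}"

definition L2_inner :: "'a measure \<Rightarrow> ('a \<Rightarrow> real) \<Rightarrow> ('a \<Rightarrow> real) \<Rightarrow> real" where
  "L2_inner \<mu> f g = (\<integral>x. f x * g x \<partial>\<mu>)"

definition Lp_dense :: "'a measure \<Rightarrow> real \<Rightarrow> ('a \<Rightarrow> real) set \<Rightarrow> bool" where
  "Lp_dense \<mu> p D \<longleftrightarrow> D \<subseteq> Lp_space \<mu> p \<and>
     (\<forall>f\<in>Lp_space \<mu> p. \<forall>\<epsilon>>0. \<exists>g\<in>D. Lp_norm \<mu> p (\<lambda>x. f x - g x) < \<epsilon>)"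

definition fun_subspace :: "('a \<Rightarrow> real) set \<Rightarrow> bool" where
  "fun_subspace V \<longleftrightarrow> (\<lambda>x. 0) \<in> V \<and> (\<forall>f\<in>V. \<forall>g\<in>V. (\<lambda>x. f x + g x) \<in> V) \<and>
     (\<forall>c. \<forall>f\<in>V. (\<lambda>x. c * f x) \<in> V)"

definition radon_measure :: "'a::topological_space measure \<Rightarrow> bool" where
  "radon_measure \<mu> \<longleftrightarrow> sets \<mu> = sets borel \<and>
     (\<forall>K. compact K \<longrightarrow> emeasure \<mu> K < \<infinity>) \<and>
     (\<forall>B\<in>sets borel. emeasure \<mu> B = (SUP K\<in>{K. compact K \<and> K \<subseteq> B}. emeasure \<mu> K))"

definition full_support :: "'a::topological_space measure \<Rightarrow> bool" where
  "full_support \<mu> \<longleftrightarrow> (\<forall>U. open U \<and> U \<noteq> {} \<longrightarrow> emeasure \<mu> U > 0)"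


section \<open>Operators and semigroups on \<open>L\<^sup>p\<close>\<close>

definition op_restrict :: "'a operator_graph \<Rightarrow> ('a \<Rightarrow> real) set \<Rightarrow> 'a operator_graph" where
  "op_restrict G V = {(f, g) \<in> G. f \<in> V}"

text \<open>The value of the operator at \<open>f \<in> Domain G\<close>, unique up to null sets.\<close>

definition op_app :: "'a operator_graph \<Rightarrow> ('a \<Rightarrow> real) \<Rightarrow> 'a \<Rightarrow> real" where
  "op_app G f = (SOME g. (f, g) \<in> G)"

definition op_closure :: "'a measure \<Rightarrow> real \<Rightarrow> 'a operator_graph \<Rightarrow> 'a operator_graph" where
  "op_closure \<mu> p G = {(f, g). f \<in> Lp_space \<mu> p \<and> g \<in> Lp_space \<mu> p \<and>
     (\<forall>\<epsilon>>0. \<exists>(f', g')\<in>G. Lp_norm \<mu> p (\<lambda>x. f x - f' x) < \<epsilon> \<and> Lp_norm \<mu> p (\<lambda>x. g x - g' x) < \<epsilon>)}"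

definition L2_adjoint :: "'a measure \<Rightarrow> 'a operator_graph \<Rightarrow> 'a operator_graph" where
  "L2_adjoint \<mu> G = {(f, g). f \<in> Lp_space \<mu> 2 \<and> g \<in> Lp_space \<mu> 2 \<and>
     (\<forall>(u, v)\<in>G. L2_inner \<mu> v f = L2_inner \<mu> u g)}"

text \<open>
  Equality with the adjoint makes the graph a linear subspace that is closed under changes on
  null sets, and density of the domain makes it single-valued up to null sets.
\<close>

definition L2_self_adjoint :: "'a measure \<Rightarrow> 'a operator_graph \<Rightarrow> bool" where
  "L2_self_adjoint \<mu> G \<longleftrightarrow> G \<subseteq> Lp_space \<mu> 2 \<times> Lp_space \<mu> 2 \<and>
     Lp_dense \<mu> 2 (Domain G) \<and> L2_adjoint \<mu> G = G"

definition L2_nonpositive :: "'a measure \<Rightarrow> 'a operator_graph \<Rightarrow> bool" where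
  "L2_nonpositive \<mu> G \<longleftrightarrow> (\<forall>(f, g)\<in>G. L2_inner \<mu> g f \<le> 0)"

text \<open>
  The times range over \<open>t \<ge> 0\<close>. Linearity and boundedness of \<open>T t\<close> force it to respect equality
  almost everywhere.
\<close>

definition c0_semigroup ::
  "'a measure \<Rightarrow> real \<Rightarrow> (real \<Rightarrow> ('a \<Rightarrow> real) \<Rightarrow> 'a \<Rightarrow> real) \<Rightarrow> bool" where
  "c0_semigroup \<mu> p T \<longleftrightarrow>
     (\<forall>t\<ge>0. \<forall>f\<in>Lp_space \<mu> p. T t f \<in> Lp_space \<mu> p) \<and>
     (\<forall>t\<ge>0. \<forall>f\<in>Lp_space \<mu> p. \<forall>g\<in>Lp_space \<mu> p. \<forall>a b.
        AE x in \<mu>. T t (\<lambda>x. a * f x + b * g x) x = a * T t f x + b * T t g x) \<and>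
     (\<forall>t\<ge>0. \<exists>C. \<forall>f\<in>Lp_space \<mu> p. Lp_norm \<mu> p (T t f) \<le> C * Lp_norm \<mu> p f) \<and>
     (\<forall>f\<in>Lp_space \<mu> p. AE x in \<mu>. T 0 f x = f x) \<and>
     (\<forall>s\<ge>0. \<forall>t\<ge>0. \<forall>f\<in>Lp_space \<mu> p. AE x in \<mu>. T (s + t) f x = T s (T t f) x) \<and>
     (\<forall>f\<in>Lp_space \<mu> p. ((\<lambda>t. Lp_norm \<mu> p (\<lambda>x. T t f x - f x)) \<longlongrightarrow> 0) (at_right 0))"

definition contractive ::
  "'a measure \<Rightarrow> real \<Rightarrow> (real \<Rightarrow> ('a \<Rightarrow> real) \<Rightarrow> 'a \<Rightarrow> real) \<Rightarrow> bool" where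
  "contractive \<mu> p T \<longleftrightarrow> (\<forall>t\<ge>0. \<forall>f\<in>Lp_space \<mu> p. Lp_norm \<mu> p (T t f) \<le> Lp_norm \<mu> p f)"

definition sg_generator ::
  "'a measure \<Rightarrow> real \<Rightarrow> (real \<Rightarrow> ('a \<Rightarrow> real) \<Rightarrow> 'a \<Rightarrow> real) \<Rightarrow> 'a operator_graph" where
  "sg_generator \<mu> p T = {(f, g). f \<in> Lp_space \<mu> p \<and> g \<in> Lp_space \<mu> p \<and>
     ((\<lambda>t. Lp_norm \<mu> p (\<lambda>x. (T t f x - f x) / t - g x)) \<longlongrightarrow> 0) (at_right 0)}"

definition Lp_unique :: "'a measure \<Rightarrow> real \<Rightarrow> 'a operator_graph \<Rightarrow> bool" where
  "Lp_unique \<mu> p G \<longleftrightarrow> Lp_dense \<mu> p (Domain G) \<and>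
     (\<forall>S T. c0_semigroup \<mu> p S \<and> c0_semigroup \<mu> p T \<and>
        G \<subseteq> sg_generator \<mu> p S \<and> G \<subseteq> sg_generator \<mu> p T \<longrightarrow>
        (\<forall>t\<ge>0. \<forall>f\<in>Lp_space \<mu> p. AE x in \<mu>. S t f x = T t f x))"

definition symmetric_markov ::
  "'a measure \<Rightarrow> (real \<Rightarrow> ('a \<Rightarrow> real) \<Rightarrow> 'a \<Rightarrow> real) \<Rightarrow> bool" where
  "symmetric_markov \<mu> T \<longleftrightarrow>
     (\<forall>t\<ge>0. \<forall>f\<in>Lp_space \<mu> 2. \<forall>g\<in>Lp_space \<mu> 2. L2_inner \<mu> (T t f) g = L2_inner \<mu> f (T t g)) \<and>
     (\<forall>t\<ge>0. \<forall>f\<in>Lp_space \<mu> 2. (AE x in \<mu>. 0 \<le> f x \<and> f x \<le> 1) \<longrightarrow>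
        (AE x in \<mu>. 0 \<le> T t f x \<and> T t f x \<le> 1))"


section \<open>Dirichlet forms\<close>

definition energy_norm_sq ::
  "'a measure \<Rightarrow> (('a \<Rightarrow> real) \<Rightarrow> ('a \<Rightarrow> real) \<Rightarrow> real) \<Rightarrow> ('a \<Rightarrow> real) \<Rightarrow> real" where
  "energy_norm_sq \<mu> E f = E f f + (Lp_norm \<mu> 2 f)\<^sup>2"

definition closed_form ::
  "'a measure \<Rightarrow> ('a \<Rightarrow> real) set \<Rightarrow> (('a \<Rightarrow> real) \<Rightarrow> ('a \<Rightarrow> real) \<Rightarrow> real) \<Rightarrow> bool" where
  "closed_form \<mu> DE E \<longleftrightarrow>
     fun_subspace DE \<and> Lp_dense \<mu> 2 DE \<and>
     (\<forall>f\<in>DE. \<forall>f'\<in>borel_measurable \<mu>. (AE x in \<mu>. f x = f' x) \<longrightarrow>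
        f' \<in> DE \<and> (\<forall>g\<in>DE. E f g = E f' g)) \<and>
     (\<forall>f\<in>DE. \<forall>g\<in>DE. \<forall>h\<in>DE. \<forall>a b. E (\<lambda>x. a * f x + b * g x) h = a * E f h + b * E g h) \<and>
     (\<forall>f\<in>DE. \<forall>g\<in>DE. E f g = E g f) \<and>
     (\<forall>f\<in>DE. 0 \<le> E f f) \<and>
     (\<forall>u. (\<forall>n::nat. u n \<in> DE) \<and>
        (\<forall>\<epsilon>>0. \<exists>N. \<forall>m\<ge>N. \<forall>n\<ge>N. energy_norm_sq \<mu> E (\<lambda>x. u m x - u n x) < \<epsilon>) \<longrightarrow>
        (\<exists>f\<in>DE. (\<lambda>n. energy_norm_sq \<mu> E (\<lambda>x. u n x - f x)) \<longlonglongrightarrow> 0))"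

definition unit_contraction :: "('a \<Rightarrow> real) \<Rightarrow> 'a \<Rightarrow> real" where
  "unit_contraction f = (\<lambda>x. min (max (f x) 0) 1)"

definition dirichlet_form ::
  "'a measure \<Rightarrow> ('a \<Rightarrow> real) set \<Rightarrow> (('a \<Rightarrow> real) \<Rightarrow> ('a \<Rightarrow> real) \<Rightarrow> real) \<Rightarrow> bool" where
  "dirichlet_form \<mu> DE E \<longleftrightarrow> closed_form \<mu> DE E \<and>
     (\<forall>f\<in>DE. unit_contraction f \<in> DE \<and> E (unit_contraction f) (unit_contraction f) \<le> E f f)"

definition fun_support :: "('a::topological_space \<Rightarrow> real) \<Rightarrow> 'a set" where
  "fun_support f = closure {x. f x \<noteq> 0}"

definition cont_compact_support :: "('a::topological_space \<Rightarrow> real) set" where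
  "cont_compact_support = {f. continuous_on UNIV f \<and> compact (fun_support f)}"

definition regular_form ::
  "'a::topological_space measure \<Rightarrow> ('a \<Rightarrow> real) set \<Rightarrow>
     (('a \<Rightarrow> real) \<Rightarrow> ('a \<Rightarrow> real) \<Rightarrow> real) \<Rightarrow> bool" where
  "regular_form \<mu> DE E \<longleftrightarrow>
     (\<forall>f\<in>DE. \<forall>\<epsilon>>0. \<exists>g\<in>DE \<inter> cont_compact_support. energy_norm_sq \<mu> E (\<lambda>x. f x - g x) < \<epsilon>) \<and>
     (\<forall>f\<in>cont_compact_support. \<forall>\<epsilon>>0. \<exists>g\<in>DE \<inter> cont_compact_support. \<forall>x. \<bar>f x - g x\<bar> < \<epsilon>)"

text \<open>
  The support of a class modulo null sets, that is, the support of the measure with density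
  \<open>\<bar>f\<bar>\<close>; it does not depend on the representative, in contrast to \<^const>\<open>fun_support\<close>.
\<close>

definition ess_support :: "'a::topological_space measure \<Rightarrow> ('a \<Rightarrow> real) \<Rightarrow> 'a set" where
  "ess_support \<mu> f = {x. \<forall>U. open U \<and> x \<in> U \<longrightarrow> \<not> (AE y in \<mu>. y \<in> U \<longrightarrow> f y = 0)}"

definition strongly_local ::
  "'a::topological_space measure \<Rightarrow> ('a \<Rightarrow> real) set \<Rightarrow>
     (('a \<Rightarrow> real) \<Rightarrow> ('a \<Rightarrow> real) \<Rightarrow> real) \<Rightarrow> bool" where
  "strongly_local \<mu> DE E \<longleftrightarrow>
     (\<forall>f\<in>DE. \<forall>g\<in>DE. compact (ess_support \<mu> f) \<and> compact (ess_support \<mu> g) \<and>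
        (\<exists>U c. open U \<and> ess_support \<mu> f \<subseteq> U \<and> (AE x in \<mu>. x \<in> U \<longrightarrow> g x = c)) \<longrightarrow>
        E f g = 0)"

text \<open>
  Bilinearity, positivity and the defining identity concern the bounded functions \<open>B\<close> of the form
  domain; the last conjunct determines \<open>\<Gamma>\<close> on the whole form domain by approximation in the energy
  norm.
\<close>

definition carre_du_champ ::
  "'a measure \<Rightarrow> ('a \<Rightarrow> real) set \<Rightarrow> (('a \<Rightarrow> real) \<Rightarrow> ('a \<Rightarrow> real) \<Rightarrow> real) \<Rightarrow>
     (('a \<Rightarrow> real) \<Rightarrow> ('a \<Rightarrow> real) \<Rightarrow> 'a \<Rightarrow> real) \<Rightarrow> bool" where
  "carre_du_champ \<mu> DE E \<Gamma> \<longleftrightarrow>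
     (let B = DE \<inter> Linf_space \<mu> in
       (\<forall>f\<in>DE. \<forall>g\<in>DE. \<Gamma> f g \<in> Lp_space \<mu> 1) \<and>
       (\<forall>f\<in>B. \<forall>g\<in>B. \<forall>h\<in>B. \<forall>a b.
          (AE x in \<mu>. \<Gamma> (\<lambda>x. a * f x + b * g x) h x = a * \<Gamma> f h x + b * \<Gamma> g h x) \<and>
          (AE x in \<mu>. \<Gamma> h (\<lambda>x. a * f x + b * g x) x = a * \<Gamma> h f x + b * \<Gamma> h g x)) \<and>
       (\<forall>f\<in>B. AE x in \<mu>. 0 \<le> \<Gamma> f f x) \<and>
       (\<forall>f\<in>B. \<forall>g\<in>B. \<forall>h\<in>B.
          1 / 2 * (E (\<lambda>x. f x * h x) g + E f (\<lambda>x. g x * h x) - E (\<lambda>x. f x * g x) h) =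
          (\<integral>x. h x * \<Gamma> f g x \<partial>\<mu>)) \<and>
       (\<forall>f\<in>DE. \<forall>g\<in>DE. \<forall>u v.
          (\<forall>n::nat. u n \<in> B \<and> v n \<in> B) \<and>
          (\<lambda>n. energy_norm_sq \<mu> E (\<lambda>x. u n x - f x)) \<longlonglongrightarrow> 0 \<and>
          (\<lambda>n. energy_norm_sq \<mu> E (\<lambda>x. v n x - g x)) \<longlonglongrightarrow> 0 \<longrightarrow>
          (\<lambda>n. Lp_norm \<mu> 1 (\<lambda>x. \<Gamma> (u n) (v n) x - \<Gamma> f g x)) \<longlonglongrightarrow> 0))"

text \<open>
  \<open>L\<close> is the self-adjoint operator, \<open>E\<close> with domain \<open>DE\<close> its quadratic form, \<open>P\<close> the semigroup on
  \<open>L\<^sup>2\<close> and \<open>Q q\<close> its extension to \<open>L\<^sup>q\<close>. A closed form satisfying \<open>form_of_operator\<close> is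
  uniquely determined by \<open>L\<close>, and the semigroups are determined up to null sets. The generator of
  \<open>Q q\<close> is \<open>sg_generator \<mu> q (Q q)\<close>.
\<close>

locale local_dirichlet_setting =
  fixes \<mu> :: "'a::metric_space measure"
    and L :: "'a operator_graph"
    and DE :: "('a \<Rightarrow> real) set"
    and E :: "('a \<Rightarrow> real) \<Rightarrow> ('a \<Rightarrow> real) \<Rightarrow> real"
    and \<Gamma> :: "('a \<Rightarrow> real) \<Rightarrow> ('a \<Rightarrow> real) \<Rightarrow> 'a \<Rightarrow> real"
    and P :: "real \<Rightarrow> ('a \<Rightarrow> real) \<Rightarrow> 'a \<Rightarrow> real"
    and Q :: "real \<Rightarrow> real \<Rightarrow> ('a \<Rightarrow> real) \<Rightarrow> 'a \<Rightarrow> real"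
  assumes locally_compact: "locally_compact_space (euclidean :: 'a topology)"
    and separable: "separable_space (euclidean :: 'a topology)"
    and radon: "radon_measure \<mu>"
    and full_support: "full_support \<mu>"
    and self_adjoint: "L2_self_adjoint \<mu> L"
    and nonpositive: "L2_nonpositive \<mu> L"
    and form_of_operator:
      "Domain L \<subseteq> DE" "(f, g) \<in> L \<Longrightarrow> h \<in> DE \<Longrightarrow> E f h = - L2_inner \<mu> g h"
    and dirichlet: "dirichlet_form \<mu> DE E"
    and regular: "regular_form \<mu> DE E"
    and strongly_local: "strongly_local \<mu> DE E"
    and carre_du_champ: "carre_du_champ \<mu> DE E \<Gamma>"
    and semigroup: "c0_semigroup \<mu> 2 P" "sg_generator \<mu> 2 P = L" "symmetric_markov \<mu> P"
    and semigroup_Lp: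
      "1 \<le> q \<Longrightarrow> c0_semigroup \<mu> q (Q q)"
      "1 \<le> q \<Longrightarrow> contractive \<mu> q (Q q)"
      "1 \<le> q \<Longrightarrow> 0 \<le> t \<Longrightarrow> f \<in> Lp_space \<mu> 1 \<Longrightarrow> f \<in> Linf_space \<mu> \<Longrightarrow>
         AE x in \<mu>. Q q t f x = P t f x"


section \<open>Function spaces and capacities\<close>

text \<open>The norm \<open>\<parallel>(\<lambda> - G) f\<parallel>\<close> on the domain of an operator \<open>G\<close> on \<open>L\<^sup>p\<close>.\<close>

definition domain_norm ::
  "'a measure \<Rightarrow> real \<Rightarrow> 'a operator_graph \<Rightarrow> real \<Rightarrow> ('a \<Rightarrow> real) \<Rightarrow> real" where
  "domain_norm \<mu> p G lam f = Lp_norm \<mu> p (\<lambda>x. lam * f x - op_app G f x)"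

definition bounded_borel :: "('a::topological_space \<Rightarrow> real) set" where
  "bounded_borel = {f \<in> borel_measurable borel. bounded (range f)}"

definition supported_in ::
  "('a::topological_space \<Rightarrow> real) set \<Rightarrow> 'a set \<Rightarrow> ('a \<Rightarrow> real) set" where
  "supported_in A U = {f \<in> A. fun_support f \<subseteq> U}"

definition compactly_supported ::
  "('a::topological_space \<Rightarrow> real) set \<Rightarrow> ('a \<Rightarrow> real) set" where
  "compactly_supported A = {f \<in> A. compact (fun_support f)}"

definition cap_admissible ::
  "('a::topological_space \<Rightarrow> real) set \<Rightarrow> 'a set \<Rightarrow> ('a \<Rightarrow> real) set" where
  "cap_admissible A K = {u \<in> A. \<exists>U. open U \<and> K \<subseteq> U \<and> (\<forall>x\<in>U. u x = 1)}"

definition cap_compact ::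
  "'a::topological_space measure \<Rightarrow> real \<Rightarrow> 'a operator_graph \<Rightarrow> real \<Rightarrow> ('a \<Rightarrow> real) set \<Rightarrow>
     'a set \<Rightarrow> ennreal" where
  "cap_compact \<mu> p G lam A K =
     (INF u\<in>cap_admissible A K. ennreal (domain_norm \<mu> p G lam u powr p))"

definition cap ::
  "'a::topological_space measure \<Rightarrow> real \<Rightarrow> 'a operator_graph \<Rightarrow> real \<Rightarrow> ('a \<Rightarrow> real) set \<Rightarrow>
     'a set \<Rightarrow> ennreal" where
  "cap \<mu> p G lam A S = (SUP K\<in>{K. compact K \<and> K \<subseteq> S}. cap_compact \<mu> p G lam A K)"

end

theory Submission
  imports Defs "HOL-Probability.Discrete_Topology"
begin

text \<open>
  Everything rests on one equivalence: \<open>L\<^sup>p\<close>-uniqueness of the restriction of the generator \<open>A\<close> of a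
  contraction semigroup to a space \<open>V\<close> means that \<open>V\<close> is a core, that is, dense in the domain of \<open>A\<close> for
  the graph norm, the norm of \<open>(lam - A) f\<close>. One direction
  (\<open>core_imp_Lp_unique\<close>) holds because a closed operator that extends the restriction to a core extends the
  whole generator, and semigroups coincide once the generator of one extends that of the other. The other direction (\<open>Lp_unique_imp_core\<close>) is Arendt's theorem: if \<open>(lam - A) V\<close> is
  not dense, it is annihilated by a bounded functional \<open>\<psi> \<noteq> 0\<close>, and for suitable \<open>u\<close> in the domain
  the operator \<open>A + u \<otimes> \<psi> (lam - A)\<close> agrees with \<open>A\<close> on \<open>V\<close>, differs from \<open>A\<close>, and generates a semigroup. For
  the last point, this operator is similar to the bounded rank-one perturbation
  \<open>A + ((lam - A) u) \<otimes> \<psi>\<close>, whose semigroup is found from a scalar Volterra equation. These arguments take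
  place in a Banach space, into which \<open>L\<^sup>p\<close> is embedded isometrically by its duality with \<open>L\<^sup>q\<close>.

  If functions supported off \<open>S\<close> form a core, then a function equal to \<open>1\<close> near a
  compact subset of \<open>S\<close> is approximated in the graph norm by such functions. The differences are admissible for the capacity and have arbitrarily
  small norm.

  If conversely the capacity of \<open>S\<close> vanishes, admissible functions with small norm show that \<open>S\<close> is a
  null set, since the graph norm controls the \<open>L\<^sup>p\<close> norm. They also serve as cut-off functions:
  \<open>f - f u\<close> vanishes near the part of \<open>S\<close> that meets the support of \<open>f\<close>, if this part is compact, and
  \<open>f u\<close> is small in the graph norm because multiplication by \<open>f\<close> is bounded in it (\<open>gnorm_mult_le\<close>). This
  follows from the product rule \<open>L (f u) = f L u + u L f + 2 \<Gamma> f u\<close>, the Cauchy-Schwarz inequality for \<open>\<Gamma>\<close>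
  and the gradient bound. The product rule is available on the algebra because its elements belong to
  the domain of the self-adjoint operator as well (\<open>generator_consistent\<close>), where the form can be
  computed. So functions supported off \<open>S\<close> are dense in the algebra, which is a core, and hence they form
  a core themselves.
\<close>

section \<open>Separation by a bounded functional\<close>

text \<open>
  Partial functionals are represented by their graphs, which are subspaces of the product with the
  reals. The one-sided bound \<open>d * a \<le> norm x\<close> on the pairs \<open>(x, a)\<close> of a graph already makes the graph
  single-valued: a pair \<open>(0, a)\<close> and its negative force \<open>a = 0\<close>. So only this bound has to be carried
  through Zorn's lemma. It holds for the functional \<open>w + t *\<^sub>R x0 \<mapsto> t\<close> when \<open>d\<close> is at most the distance
  of \<open>x0\<close> from \<open>W\<close>, and a maximal graph is total because the value at a new point only has to separate
  two families of numbers that the triangle inequality keeps apart.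
\<close>

lemma hahn_banach_separation:
  fixes W :: "'b::real_normed_vector set"
  assumes W: "subspace W" and x0: "x0 \<notin> closure W"
  obtains \<psi> :: "'b \<Rightarrow> real" where "bounded_linear \<psi>" "\<And>w. w \<in> W \<Longrightarrow> \<psi> w = 0" "\<psi> x0 = 1"
proof -
  obtain d where d: "d > 0" "\<And>w. w \<in> W \<Longrightarrow> d \<le> norm (x0 - w)"
    using x0 unfolding closure_approachable dist_norm
    by (metis linorder_not_le norm_minus_commute)
  define G0 where "G0 = {(w, 0::real) |w. w \<in> W}"
  define G1 where "G1 = {u + v |u v. u \<in> G0 \<and> v \<in> range (\<lambda>t. t *\<^sub>R (x0, 1::real))}"
  define \<G> where "\<G> = {G. subspace G \<and> G1 \<subseteq> G \<and> (\<forall>x a. (x, a) \<in> G \<longrightarrow> d * a \<le> norm x)}"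
  have sub_line: "subspace (range (\<lambda>t. t *\<^sub>R z))" for z :: "'b \<times> real"
    by (intro linear_subspace_image) (auto simp: linear_iff algebra_simps)
  have "subspace G0"
    using W unfolding G0_def subspace_def by (auto simp: zero_prod_def)
  then have subG1: "subspace G1"
    unfolding G1_def by (intro subspace_sums sub_line)
  have dom1: "d * a \<le> norm x" if "(x, a) \<in> G1" for x a
  proof -
    obtain w where w: "w \<in> W" "x = w + a *\<^sub>R x0"
      using \<open>(x, a) \<in> G1\<close> by (auto simp: G1_def G0_def)
    show ?thesis
    proof (cases "a \<le> 0")
      case True
      then show ?thesis using d(1) by (smt (verit) mult_nonneg_nonpos norm_ge_zero)
    next
      case False
      have "- (1/a) *\<^sub>R w \<in> W" using w W subspace_scale by blast
      from d(2)[OF this] have "d \<le> norm (x0 + (1/a) *\<^sub>R w)" by simp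
      then have "a * d \<le> a * norm (x0 + (1/a) *\<^sub>R w)" using False by simp
      also have "\<dots> = norm (a *\<^sub>R (x0 + (1/a) *\<^sub>R w))" using False by simp
      also have "a *\<^sub>R (x0 + (1/a) *\<^sub>R w) = x" using False w by (simp add: algebra_simps)
      finally show ?thesis by (simp add: mult.commute)
    qed
  qed
  have "\<exists>M\<in>\<G>. \<forall>Y\<in>\<G>. M \<subseteq> Y \<longrightarrow> Y = M"
  proof (rule subset_Zorn_nonempty)
    show "\<G> \<noteq> {}" using subG1 dom1 by (auto simp: \<G>_def)
    fix C assume C: "C \<noteq> {}" "subset.chain \<G> C"
    have "subspace (\<Union>C)"
      unfolding subspace_def
    proof (intro conjI ballI allI)
      obtain c where "c \<in> C" using C(1) by blast
      moreover from this have "subspace c" using C(2) by (auto simp: subset.chain_def \<G>_def)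
      ultimately show "0 \<in> \<Union>C" using subspace_0 by blast
    next
      fix x y assume "x \<in> \<Union>C" "y \<in> \<Union>C"
      then obtain Y Z where "Y \<in> C" "x \<in> Y" "Z \<in> C" "y \<in> Z" by auto
      moreover from this have "Y \<subseteq> Z \<or> Z \<subseteq> Y" using C(2) unfolding subset_chain_def by blast
      moreover have "subspace Y" "subspace Z" using calculation C(2) by (auto simp: subset_chain_def \<G>_def)
      ultimately show "x + y \<in> \<Union>C" by (meson Union_iff subsetD subspace_add)
    next
      fix c x assume "x \<in> \<Union>C"
      then obtain Y where Y: "Y \<in> C" "x \<in> Y" by auto
      then have "subspace Y" using C(2) by (auto simp: subset_chain_def \<G>_def)
      then show "c *\<^sub>R x \<in> \<Union>C" using Y subspace_scale by blast
    qed
    then show "\<Union>C \<in> \<G>" using C by (auto simp: \<G>_def subset.chain_def subset_eq)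
  qed
  then obtain M where M: "M \<in> \<G>" and max: "\<And>Y. Y \<in> \<G> \<Longrightarrow> M \<subseteq> Y \<Longrightarrow> Y = M" by blast
  have subM: "subspace M" and GM: "G1 \<subseteq> M" and dom: "\<And>x a. (x, a) \<in> M \<Longrightarrow> d * a \<le> norm x"
    using M by (auto simp: \<G>_def)
  have tot: "\<exists>c. (x, c) \<in> M" for x
  proof -
    \<comment> \<open>The admissible values at \<open>x\<close> lie above all numbers in \<open>L\<close> and below the bounds in \<open>up\<close>.\<close>
    define L where "L = (\<lambda>(y, a). a - norm (y - x) / d) ` M"
    have up: "l \<le> norm (z + x) / d - b" if "l \<in> L" "(z, b) \<in> M" for l z b
    proof -
      obtain y a where ya: "(y, a) \<in> M" "l = a - norm (y - x) / d" using \<open>l \<in> L\<close> by (auto simp: L_def)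
      have "(y + z, a + b) \<in> M" using subspace_add[OF subM ya(1) that(2)] by simp
      from dom[OF this] have "d * (a + b) \<le> norm (y + z)" .
      also have "\<dots> \<le> norm (y - x) + norm (z + x)"
        using norm_triangle_ineq[of "y - x" "z + x"] by simp
      finally show ?thesis using d(1) ya(2) by (simp add: field_simps)
    qed
    have z0: "(0, 0) \<in> M" using subspace_0[OF subM] by (simp add: zero_prod_def)
    have bdd: "bdd_above L" using up[OF _ z0] by (auto simp: bdd_above_def)
    have ne: "L \<noteq> {}" using z0 by (auto simp: L_def)
    define c where "c = Sup L"
    have c1: "a - norm (y - x) / d \<le> c" if "(y, a) \<in> M" for y a
      unfolding c_def by (rule cSup_upper[OF _ bdd]) (use that in \<open>force simp: L_def\<close>)
    have c2: "c \<le> norm (z + x) / d - b" if "(z, b) \<in> M" for z b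
      unfolding c_def by (rule cSup_least[OF ne]) (use up that in auto)
    define M' where "M' = {u + v |u v. u \<in> M \<and> v \<in> range (\<lambda>t. t *\<^sub>R (x, c))}"
    have "M' \<in> \<G>"
      unfolding \<G>_def
    proof (intro CollectI conjI allI impI)
      show "subspace M'" unfolding M'_def by (intro subspace_sums sub_line subM)
      show "G1 \<subseteq> M'"
      proof
        fix u assume "u \<in> G1"
        then have "u \<in> M" using GM by auto
        then have "u + 0 *\<^sub>R (x, c) \<in> M'" unfolding M'_def by blast
        then show "u \<in> M'" by (simp add: zero_prod_def[symmetric])
      qed
    next
      fix z b assume "(z, b) \<in> M'"
      then obtain y a t where yat: "(y, a) \<in> M" "z = y + t *\<^sub>R x" "b = a + t * c"
        by (auto simp: M'_def)
      consider "t = 0" | "t > 0" | "t < 0" by linarith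
      then show "d * b \<le> norm z"
      proof cases
        case 1 then show ?thesis using dom yat by simp
      next
        case 2
        have "((1/t) *\<^sub>R y, (1/t) * a) \<in> M" using subspace_scale[OF subM yat(1), of "1/t"] by simp
        from c2[OF this] have "c \<le> norm ((1/t) *\<^sub>R y + x) / d - a / t" by simp
        then have "t * c \<le> t * (norm ((1/t) *\<^sub>R y + x) / d - a / t)" using 2 by simp
        also have "\<dots> = (t * norm ((1/t) *\<^sub>R y + x)) / d - a" using 2 by (simp add: field_simps)
        also have "t * norm ((1/t) *\<^sub>R y + x) = norm (t *\<^sub>R ((1/t) *\<^sub>R y + x))" using 2 by simp
        also have "t *\<^sub>R ((1/t) *\<^sub>R y + x) = z" using 2 yat by (simp add: algebra_simps)
        finally show ?thesis using d(1) yat(3) by (simp add: field_simps)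
      next
        case 3
        define s where "s = - t"
        have s: "s > 0" "t = - s" using 3 by (auto simp: s_def)
        have "((1/s) *\<^sub>R y, (1/s) * a) \<in> M" using subspace_scale[OF subM yat(1), of "1/s"] by simp
        from c1[OF this] have "a / s - norm ((1/s) *\<^sub>R y - x) / d \<le> c" by simp
        then have "s * (a / s - norm ((1/s) *\<^sub>R y - x) / d) \<le> s * c" using s by simp
        moreover have "s * (a / s - norm ((1/s) *\<^sub>R y - x) / d) = a - (s * norm ((1/s) *\<^sub>R y - x)) / d"
          using s by (simp add: right_diff_distrib)
        ultimately have "a - (s * norm ((1/s) *\<^sub>R y - x)) / d \<le> s * c" by simp
        also have "s * norm ((1/s) *\<^sub>R y - x) = norm (s *\<^sub>R ((1/s) *\<^sub>R y - x))" using s by simp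
        also have "s *\<^sub>R ((1/s) *\<^sub>R y - x) = z" using s yat by (simp add: algebra_simps)
        finally have "b \<le> norm z / d" using yat(3) s by (simp add: algebra_simps)
        then show ?thesis using d(1) by (simp add: pos_le_divide_eq mult.commute)
      qed
    qed
    moreover have "M \<subseteq> M'"
    proof
      fix u assume "u \<in> M"
      then have "u + 0 *\<^sub>R (x, c) \<in> M'" unfolding M'_def by blast
      then show "u \<in> M'" by (simp add: zero_prod_def[symmetric])
    qed
    ultimately have "M' = M" using max by blast
    moreover have "(0, 0) + 1 *\<^sub>R (x, c) \<in> M'" unfolding M'_def using z0 by blast
    ultimately show ?thesis by auto
  qed
  have uniq: "a = b" if "(x, a) \<in> M" "(x, b) \<in> M" for x a b
  proof -
    have "(0, a - b) \<in> M" "(0, b - a) \<in> M"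
      using subspace_diff[OF subM that] subspace_diff[OF subM that(2,1)] by simp_all
    from dom[OF this(1)] dom[OF this(2)] show ?thesis using d(1) by (simp add: mult_le_0_iff)
  qed
  define \<psi> where "\<psi> x = (THE a. (x, a) \<in> M)" for x
  have \<psi>: "(x, \<psi> x) \<in> M" for x
    unfolding \<psi>_def by (rule theI') (use tot uniq in blast)
  have \<psi>_eq: "\<psi> x = a" if "(x, a) \<in> M" for x a using uniq[OF \<psi> that] .
  show thesis
  proof
    show "bounded_linear \<psi>"
    proof (rule bounded_linear_intro[where K = "1/d"])
      show "\<psi> (x + y) = \<psi> x + \<psi> y" for x y
        using subspace_add[OF subM \<psi>[of x] \<psi>[of y]] by (intro \<psi>_eq) simp
      show "\<psi> (r *\<^sub>R x) = r *\<^sub>R \<psi> x" for r x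
        using subspace_scale[OF subM \<psi>[of x], of r] by (intro \<psi>_eq) simp
      show "norm (\<psi> x) \<le> norm x * (1/d)" for x
        using dom[OF \<psi>[of x]] dom[of "- x" "- \<psi> x"] subspace_neg[OF subM \<psi>[of x]] d(1)
        by (simp add: field_simps abs_le_iff)
    qed
    show "\<psi> w = 0" if "w \<in> W" for w
    proof (rule \<psi>_eq)
      have "(w, 0) + 0 *\<^sub>R (x0, 1) \<in> G1" unfolding G1_def G0_def using that by blast
      then show "(w, 0) \<in> M" using GM by auto
    qed
    show "\<psi> x0 = 1"
    proof (rule \<psi>_eq)
      have "(0, 0) + 1 *\<^sub>R (x0, 1) \<in> G1" unfolding G1_def G0_def using subspace_0[OF W] by blast
      then show "(x0, 1) \<in> M" using GM by auto
    qed
  qed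
qed

section \<open>Strongly continuous semigroups on a closed subspace\<close>

text \<open>
  Generators only provide right derivatives of orbits. For every slope \<open>e > B\<close> the points up to which
  \<open>y\<close> has grown at most at rate \<open>e\<close> form a closed set, and the right derivative allows going a little
  beyond each of them; so the supremum of this set is \<open>b\<close>.
\<close>

lemma right_derivative_bound:
  fixes y :: "real \<Rightarrow> 'b::real_normed_vector"
  assumes ab: "a \<le> b" and cont: "continuous_on {a..b} y"
    and der: "\<And>s. a \<le> s \<Longrightarrow> s < b \<Longrightarrow> ((\<lambda>h. (y (s + h) - y s) /\<^sub>R h) \<longlongrightarrow> y' s) (at_right 0)"
    and bound: "\<And>s. a \<le> s \<Longrightarrow> s < b \<Longrightarrow> norm (y' s) \<le> B"
  shows "norm (y b - y a) \<le> B * (b - a)"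
proof -
  have est: "norm (y b - y a) \<le> e * (b - a)" if e: "e > B" for e
  proof -
    define S where "S = {s \<in> {a..b}. norm (y s - y a) \<le> e * (s - a)}"
    have "closed S" unfolding S_def
      by (intro continuous_on_closed_Collect_le continuous_intros cont closed_real_atLeastAtMost)
    moreover have S: "S \<noteq> {}" "bdd_above S" using ab by (auto simp: S_def bdd_above_def)
    ultimately have c: "Sup S \<in> S" by (intro closed_contains_Sup)
    define c where "c = Sup S"
    have "c = b"
    proof (rule ccontr)
      assume "c \<noteq> b"
      then have cb: "a \<le> c" "c < b" using c by (auto simp: S_def c_def)
      have "norm (y' c) < e" using bound[OF cb] e by simp
      from order_tendstoD(2)[OF tendsto_norm[OF der[OF cb]] this]
      have "\<forall>\<^sub>F h in at_right 0. norm ((y (c + h) - y c) /\<^sub>R h) < e" .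
      moreover have "\<forall>\<^sub>F h in at_right 0. h < b - c"
        using cb(2) unfolding eventually_at_right_field by (intro exI[of _ "b - c"]) auto
      moreover have "\<forall>\<^sub>F h in at_right 0. (0::real) < h" by (rule eventually_at_right_less)
      ultimately have "\<forall>\<^sub>F h in at_right 0. norm ((y (c + h) - y c) /\<^sub>R h) < e \<and> h < b - c \<and> 0 < h"
        by eventually_elim simp
      then obtain h where h: "norm ((y (c + h) - y c) /\<^sub>R h) < e" "h < b - c" "0 < h"
        using eventually_happens' trivial_limit_at_right_real by blast
      have "norm (y (c + h) - y c) / h < e" using h(1,3) by (simp only: norm_scaleR) (simp add: field_simps)
      then have "norm (y (c + h) - y c) \<le> e * h" using h(3) by (simp add: field_simps)
      moreover have "norm (y c - y a) \<le> e * (c - a)" using c by (simp add: S_def c_def)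
      ultimately have "norm (y (c + h) - y a) \<le> e * (c + h - a)"
        using norm_triangle_ineq[of "y (c + h) - y c" "y c - y a"] by (simp add: algebra_simps)
      then have "c + h \<in> S" using h cb by (simp add: S_def)
      then have "c + h \<le> c" unfolding c_def using S(2) by (rule cSup_upper)
      then show False using h by simp
    qed
    then show ?thesis using c by (simp add: S_def c_def)
  qed
  show ?thesis
  proof (rule field_le_epsilon)
    fix e :: real assume "e > 0"
    then have "norm (y b - y a) \<le> (B + e / (b - a + 1)) * (b - a)" using ab by (intro est) simp
    also have "\<dots> = B * (b - a) + e * ((b - a) / (b - a + 1))" by (simp add: algebra_simps)
    also have "e * ((b - a) / (b - a + 1)) \<le> e * 1" using ab \<open>e > 0\<close> by (intro mult_left_mono) auto
    finally show "norm (y b - y a) \<le> B * (b - a) + e" by simp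
  qed
qed

lemma right_derivative_zero_imp_eq:
  fixes y :: "real \<Rightarrow> 'b::real_normed_vector"
  assumes "a \<le> b" "continuous_on {a..b} y"
    and "\<And>s. a \<le> s \<Longrightarrow> s < b \<Longrightarrow> ((\<lambda>h. (y (s + h) - y s) /\<^sub>R h) \<longlongrightarrow> 0) (at_right 0)"
  shows "y b = y a"
  using right_derivative_bound[OF assms, of 0] by simp

text \<open>
  The semigroup acts on a closed subspace \<open>X\<close> of a Banach space. An \<open>L\<^sup>p\<close> space depends on a measure and an exponent and is therefore not a type, but it
  can be embedded as such a subspace into a space that is one.
\<close>

locale semigroup_on =
  fixes X :: "'b::banach set" and T :: "real \<Rightarrow> 'b \<Rightarrow> 'b"
  assumes closed_X: "closed X" and subspace_X: "subspace X"
    and maps: "0 \<le> t \<Longrightarrow> x \<in> X \<Longrightarrow> T t x \<in> X"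
    and lin: "0 \<le> t \<Longrightarrow> x \<in> X \<Longrightarrow> y \<in> X \<Longrightarrow> T t (a *\<^sub>R x + b *\<^sub>R y) = a *\<^sub>R T t x + b *\<^sub>R T t y"
    and bnd: "0 \<le> t \<Longrightarrow> \<exists>C. \<forall>x\<in>X. norm (T t x) \<le> C * norm x"
    and T_zero: "x \<in> X \<Longrightarrow> T 0 x = x"
    and T_add: "0 \<le> s \<Longrightarrow> 0 \<le> t \<Longrightarrow> x \<in> X \<Longrightarrow> T (s + t) x = T s (T t x)"
    and cont0: "x \<in> X \<Longrightarrow> ((\<lambda>t. T t x) \<longlongrightarrow> x) (at_right 0)"
begin

definition gen :: "('b \<times> 'b) set" where
  "gen = {(x, y). x \<in> X \<and> y \<in> X \<and> ((\<lambda>t. (T t x - x) /\<^sub>R t) \<longlongrightarrow> y) (at_right 0)}"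

lemma T_diff: "0 \<le> t \<Longrightarrow> x \<in> X \<Longrightarrow> y \<in> X \<Longrightarrow> T t (x - y) = T t x - T t y"
  using lin[of t x y 1 "-1"] by simp

lemma T_scale: "0 \<le> t \<Longrightarrow> x \<in> X \<Longrightarrow> T t (a *\<^sub>R x) = a *\<^sub>R T t x"
  using lin[of t x x a 0] by simp

lemma X_diff: "x \<in> X \<Longrightarrow> y \<in> X \<Longrightarrow> x - y \<in> X"
  and X_add: "x \<in> X \<Longrightarrow> y \<in> X \<Longrightarrow> x + y \<in> X"
  and X_scale: "x \<in> X \<Longrightarrow> a *\<^sub>R x \<in> X"
  and X_zero: "0 \<in> X"
  using subspace_X by (auto simp: subspace_diff subspace_add subspace_scale subspace_0)

lemma continuous_on_T: assumes "0 \<le> t" shows "continuous_on X (T t)"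
proof -
  obtain C where C: "\<And>x. x \<in> X \<Longrightarrow> norm (T t x) \<le> C * norm x" using bnd[OF assms] by blast
  have "(max C 0)-lipschitz_on X (T t)"
  proof (rule lipschitz_onI)
    fix x y assume xy: "x \<in> X" "y \<in> X"
    have "dist (T t x) (T t y) = norm (T t (x - y))" using xy assms by (simp add: T_diff dist_norm)
    also have "\<dots> \<le> C * norm (x - y)" using xy by (intro C X_diff)
    also have "\<dots> \<le> max C 0 * norm (x - y)" by (intro mult_right_mono) auto
    finally show "dist (T t x) (T t y) \<le> max C 0 * dist x y" by (simp add: dist_norm)
  qed simp
  then show ?thesis by (rule lipschitz_on_continuous_on)
qed

text \<open>
  The uniform boundedness principle at time zero. Strong continuity bounds every single orbit for
  small times, so the closed sets \<open>A n\<close> cover \<open>X\<close>, and by the Baire category theorem one of them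
  contains a ball of \<open>X\<close>. Joint continuity statements for semigroups without a contraction
  property rest on this.
\<close>

lemma bounded_near_zero:
  obtains M \<delta> where "0 < \<delta>" "0 \<le> M" "\<And>t x. 0 \<le> t \<Longrightarrow> t \<le> \<delta> \<Longrightarrow> x \<in> X \<Longrightarrow> norm (T t x) \<le> M * norm x"
proof -
  define A where "A n = {x \<in> X. \<forall>t\<in>{0..1 / real (Suc n)}. norm (T t x) \<le> real n}" for n
  have clA: "closedin (top_of_set X) (A n)" for n
  proof -
    have cl: "closedin (top_of_set X) {x \<in> X. norm (T t x) \<le> real n}" if "t \<in> {0..1 / real (Suc n)}" for t
    proof -
      have *: "{x \<in> X. norm (T t x) \<le> real n} = X \<inter> (\<lambda>x. norm (T t x)) -` {..real n}" by auto
      show ?thesis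
        unfolding * using continuous_on_T[of t] that by (intro continuous_closedin_preimage continuous_on_norm) auto
    qed
    have "A n = (\<Inter>t\<in>{0..1 / real (Suc n)}. {x \<in> X. norm (T t x) \<le> real n})"
    proof -
      have "(0::real) \<in> {0..1 / real (Suc n)}" by simp
      then show ?thesis unfolding A_def by blast
    qed
    also have "closedin (top_of_set X) \<dots>"
      by (intro closedin_Inter) (use cl in auto)
    finally show ?thesis .
  qed
  have "\<exists>n. (top_of_set X) interior_of (A n) \<noteq> {}"
  proof (rule ccontr)
    assume "\<not> ?thesis"
    then have emp: "(top_of_set X) interior_of (A n) = {}" for n by simp
    have "completely_metrizable_space (top_of_set X)"
      using closed_X by (simp add: completely_metrizable_space_closedin completely_metrizable_space_euclidean)
    then have "(top_of_set X) interior_of \<Union>(range A) = {}"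
      by (intro Baire_category_alt) (use clA emp in auto)
    moreover have "\<Union>(range A) = X"
    proof (intro equalityI subsetI)
      fix x assume x: "x \<in> X"
      from tendstoD[OF cont0[OF x], of 1] have "\<forall>\<^sub>F t in at_right 0. dist (T t x) x < 1" by simp
      then obtain b where b: "b > 0" "\<And>t. 0 < t \<Longrightarrow> t < b \<Longrightarrow> dist (T t x) x < 1"
        by (auto simp: eventually_at_right_field)
      obtain n1 where n1: "1 / real (Suc n1) < b" using b(1) by (metis nat_approx_posE)
      obtain n2 where n2: "norm x + 1 \<le> real n2" using real_arch_simple by blast
      define n where "n = max n1 n2"
      have "x \<in> A n"
        unfolding A_def
      proof (intro CollectI conjI ballI x)
        fix t assume t: "t \<in> {0..1 / real (Suc n)}"
        have "1 / real (Suc n) \<le> 1 / real (Suc n1)" by (intro divide_left_mono) (auto simp: n_def)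
        then have "t < b" using t n1 by simp
        then have "dist (T t x) x < 1" using b(2)[of t] t T_zero[OF x] by (cases "t = 0") auto
        then have "norm (T t x) \<le> norm x + 1"
          using norm_triangle_ineq2[of "T t x" x] by (simp add: dist_norm)
        also have "\<dots> \<le> real n" using n2 by (simp add: n_def)
        finally show "norm (T t x) \<le> real n" .
      qed
      then show "x \<in> \<Union>(range A)" by auto
    qed (auto simp: A_def)
    ultimately show False using X_zero interior_of_topspace[of "top_of_set X"] by auto
  qed
  then obtain n where "(top_of_set X) interior_of (A n) \<noteq> {}" by blast
  then obtain x0 U where x0: "x0 \<in> U" "openin (top_of_set X) U" "U \<subseteq> A n" by (auto simp: interior_of_def)
  then obtain r where r: "r > 0" "ball x0 r \<inter> X \<subseteq> A n"
    by (meson openin_contains_ball order_trans)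
  have x0X: "x0 \<in> X" using x0 by (auto simp: A_def)
  show thesis
  proof
    show "0 < 1 / real (Suc n)" "0 \<le> 4 * real n / r" using r by simp_all
    fix t x assume t: "0 \<le> t" "t \<le> 1 / real (Suc n)" and x: "x \<in> X"
    show "norm (T t x) \<le> 4 * real n / r * norm x"
    proof (cases "x = 0")
      case True
      then show ?thesis using T_scale[OF t(1) x, of 0] by simp
    next
      case False
      define c where "c = r / (2 * norm x)"
      have c: "c > 0" using False r by (simp add: c_def)
      have "x0 + c *\<^sub>R x \<in> ball x0 r" using False r by (simp add: c_def dist_norm)
      moreover have X: "x0 + c *\<^sub>R x \<in> X" using x x0X by (intro X_add X_scale)
      ultimately have "x0 + c *\<^sub>R x \<in> A n" "x0 \<in> A n" using r x0X by auto
      then have le: "norm (T t (x0 + c *\<^sub>R x)) \<le> n" "norm (T t x0) \<le> n" using t by (auto simp: A_def)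
      have "c * norm (T t x) = norm (T t ((x0 + c *\<^sub>R x) - x0))" using t x c by (simp add: T_scale)
      also have "\<dots> = norm (T t (x0 + c *\<^sub>R x) - T t x0)" using t X x0X by (subst T_diff) auto
      also have "\<dots> \<le> 2 * n" using norm_triangle_ineq4[of "T t (x0 + c *\<^sub>R x)" "T t x0"] le by simp
      finally have "norm (T t x) \<le> 2 * n / c" using c by (simp add: field_simps)
      then show ?thesis using False r by (simp add: c_def field_simps)
    qed
  qed
qed

lemma locally_bounded:
  obtains M where "0 \<le> M" "\<And>t x. 0 \<le> t \<Longrightarrow> t \<le> a \<Longrightarrow> x \<in> X \<Longrightarrow> norm (T t x) \<le> M * norm x"
proof -
  obtain M \<delta> where \<delta>: "0 < \<delta>" "0 \<le> M"
    and M: "\<And>t x. 0 \<le> t \<Longrightarrow> t \<le> \<delta> \<Longrightarrow> x \<in> X \<Longrightarrow> norm (T t x) \<le> M * norm x"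
    by (rule bounded_near_zero) blast
  have iter: "\<exists>C\<ge>0. \<forall>t x. 0 \<le> t \<longrightarrow> t \<le> real (Suc n) * \<delta> \<longrightarrow> x \<in> X \<longrightarrow> norm (T t x) \<le> C * norm x" for n
  proof (induction n)
    case 0
    then show ?case using M \<delta> by auto
  next
    case (Suc n)
    then obtain C where C: "C \<ge> 0" "\<And>t x. 0 \<le> t \<Longrightarrow> t \<le> real (Suc n) * \<delta> \<Longrightarrow> x \<in> X \<Longrightarrow> norm (T t x) \<le> C * norm x"
      by blast
    have "norm (T t x) \<le> max M (C * M) * norm x" if t: "0 \<le> t" "t \<le> real (Suc (Suc n)) * \<delta>" "x \<in> X" for t x
    proof (cases "t \<le> \<delta>")
      case True
      have "norm (T t x) \<le> M * norm x" using True t M by simp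
      also have "\<dots> \<le> max M (C * M) * norm x" by (intro mult_right_mono) auto
      finally show ?thesis .
    next
      case False
      have "T t x = T (t - \<delta>) (T \<delta> x)" using T_add[of "t - \<delta>" \<delta> x] False \<delta> t by simp
      also have "norm \<dots> \<le> C * norm (T \<delta> x)"
        using False \<delta> t by (intro C maps) (auto simp: algebra_simps)
      also have "\<dots> \<le> C * (M * norm x)" using \<delta> t C by (intro mult_left_mono M) auto
      also have "\<dots> \<le> max M (C * M) * norm x" by (simp add: mult.assoc[symmetric] mult_right_mono)
      finally show ?thesis .
    qed
    moreover have "0 \<le> max M (C * M)" using \<delta> by simp
    ultimately show ?case by blast
  qed
  obtain n where "a / \<delta> \<le> real n" using real_arch_simple by blast
  then have n: "a \<le> real (Suc n) * \<delta>" using \<delta> by (simp add: field_simps)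
  from iter[of n] show thesis
    using n that by (meson order_trans)
qed

lemma continuous_on_orbit: assumes x: "x \<in> X" shows "continuous_on {0..} (\<lambda>t. T t x)"
  unfolding continuous_on_iff
proof (intro ballI allI impI)
  fix t e :: real assume t: "t \<in> {0..}" and e: "e > 0"
  obtain M where M: "0 \<le> M" "\<And>s x. 0 \<le> s \<Longrightarrow> s \<le> t + 1 \<Longrightarrow> x \<in> X \<Longrightarrow> norm (T s x) \<le> M * norm x"
    using locally_bounded[of "t + 1"] by blast
  have "e / (M + 1) > 0" using e M by simp
  from tendstoD[OF cont0[OF x] this]
  obtain b where b: "b > 0" "\<And>h. 0 < h \<Longrightarrow> h < b \<Longrightarrow> dist (T h x) x < e / (M + 1)"
    by (auto simp: eventually_at_right_field)
  have key: "dist (T (s + h) x) (T s x) < e" if "0 \<le> s" "s \<le> t + 1" "0 \<le> h" "h < b" for s h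
  proof -
    have h: "dist (T h x) x < e / (M + 1)"
      using b that T_zero[OF x] \<open>e / (M + 1) > 0\<close> by (cases "h = 0") auto
    have "dist (T (s + h) x) (T s x) = norm (T s (T h x - x))"
      using that x by (simp add: T_add T_diff maps dist_norm)
    also have "\<dots> \<le> M * norm (T h x - x)" using that x by (intro M X_diff maps)
    also have "\<dots> \<le> (M + 1) * norm (T h x - x)" by (intro mult_right_mono) auto
    also have "\<dots> < e" using h M by (simp add: dist_norm field_simps)
    finally show ?thesis .
  qed
  show "\<exists>d>0. \<forall>s\<in>{0..}. dist s t < d \<longrightarrow> dist (T s x) (T t x) < e"
  proof (intro exI[of _ "min b 1"] conjI ballI impI)
    show "min b 1 > 0" using b by simp
    fix s assume s: "s \<in> {0..}" "dist s t < min b 1"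
    show "dist (T s x) (T t x) < e"
    proof (cases "t \<le> s")
      case True
      then show ?thesis using key[of t "s - t"] s t by (simp add: dist_real_def)
    next
      case False
      then show ?thesis using key[of s "t - s"] s t by (simp add: dist_real_def dist_commute)
    qed
  qed
qed

lemma gen_orbit:
  assumes "(x, y) \<in> gen" "0 \<le> s"
  shows "(T s x, T s y) \<in> gen"
proof -
  have xy: "x \<in> X" "y \<in> X" "((\<lambda>t. (T t x - x) /\<^sub>R t) \<longlongrightarrow> y) (at_right 0)"
    using assms by (auto simp: gen_def)
  have inX: "\<forall>\<^sub>F t in at_right 0. (T t x - x) /\<^sub>R t \<in> X"
    using eventually_at_right_less[of "0::real"]
    by eventually_elim (use xy in \<open>auto intro!: X_scale X_diff maps\<close>)
  have "((\<lambda>t. T s ((T t x - x) /\<^sub>R t)) \<longlongrightarrow> T s y) (at_right 0)"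
    by (rule continuous_on_tendsto_compose[OF continuous_on_T[OF assms(2)] xy(3) xy(2) inX])
  moreover have "\<forall>\<^sub>F t in at_right 0. T s ((T t x - x) /\<^sub>R t) = (T t (T s x) - T s x) /\<^sub>R t"
    using eventually_at_right_less[of "0::real"]
  proof eventually_elim
    case (elim t)
    then show ?case using xy assms(2) T_add[of s t x] T_add[of t s x]
      by (simp add: T_scale T_diff X_diff maps add.commute)
  qed
  ultimately have "((\<lambda>t. (T t (T s x) - T s x) /\<^sub>R t) \<longlongrightarrow> T s y) (at_right 0)"
    by (rule Lim_transform_eventually)
  then show ?thesis using xy assms by (simp add: gen_def maps)
qed

lemma gen_unique: "(x, y) \<in> gen \<Longrightarrow> (x, z) \<in> gen \<Longrightarrow> y = z"
  unfolding gen_def by (auto intro: tendsto_unique[OF trivial_limit_at_right_real])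

lemma gen_comb:
  assumes "(x, x') \<in> gen" "(y, y') \<in> gen"
  shows "(a *\<^sub>R x + b *\<^sub>R y, a *\<^sub>R x' + b *\<^sub>R y') \<in> gen"
proof -
  have *: "x \<in> X" "x' \<in> X" "y \<in> X" "y' \<in> X"
    and lim: "((\<lambda>t. (T t x - x) /\<^sub>R t) \<longlongrightarrow> x') (at_right 0)" "((\<lambda>t. (T t y - y) /\<^sub>R t) \<longlongrightarrow> y') (at_right 0)"
    using assms by (auto simp: gen_def)
  have "((\<lambda>t. a *\<^sub>R ((T t x - x) /\<^sub>R t) + b *\<^sub>R ((T t y - y) /\<^sub>R t)) \<longlongrightarrow> a *\<^sub>R x' + b *\<^sub>R y') (at_right 0)"
    by (intro tendsto_intros lim)
  moreover have "\<forall>\<^sub>F t in at_right 0. a *\<^sub>R ((T t x - x) /\<^sub>R t) + b *\<^sub>R ((T t y - y) /\<^sub>R t) =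
      (T t (a *\<^sub>R x + b *\<^sub>R y) - (a *\<^sub>R x + b *\<^sub>R y)) /\<^sub>R t"
    using eventually_at_right_less[of "0::real"]
    by eventually_elim (simp add: lin * algebra_simps)
  ultimately have "((\<lambda>t. (T t (a *\<^sub>R x + b *\<^sub>R y) - (a *\<^sub>R x + b *\<^sub>R y)) /\<^sub>R t) \<longlongrightarrow> a *\<^sub>R x' + b *\<^sub>R y') (at_right 0)"
    by (rule Lim_transform_eventually)
  then show ?thesis using * by (auto simp: gen_def intro!: X_add X_scale)
qed

text \<open>
  The increment \<open>T h x - x\<close> is the integral of \<open>T r y\<close> over \<open>0 \<le> r \<le> h\<close>, so it differs from \<open>h *\<^sub>R y\<close> by
  at most \<open>h\<close> times the oscillation of the orbit of \<open>y\<close>. Unlike the limit that defines the generator,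
  this estimate survives a limit in \<open>(x, y)\<close>, which is why it yields the closedness of the generator.
\<close>

lemma gen_increment_bound:
  assumes xy: "(x, y) \<in> gen" and h: "0 \<le> h"
    and e: "\<And>r. 0 \<le> r \<Longrightarrow> r \<le> h \<Longrightarrow> norm (T r y - y) \<le> e"
  shows "norm (T h x - x - h *\<^sub>R y) \<le> e * h"
proof -
  have x: "x \<in> X" using xy by (simp add: gen_def)
  have "norm ((T h x - h *\<^sub>R y) - (T 0 x - 0 *\<^sub>R y)) \<le> e * (h - 0)"
  proof (rule right_derivative_bound[OF h])
    have "continuous_on {0..h} (\<lambda>s. T s x)" by (rule continuous_on_subset[OF continuous_on_orbit[OF x]]) auto
    then show "continuous_on {0..h} (\<lambda>s. T s x - s *\<^sub>R y)" by (intro continuous_intros)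
    fix s assume s: "0 \<le> s" "s < h"
    show "norm (T s y - y) \<le> e" using e s by simp
    have "((\<lambda>r. (T r (T s x) - T s x) /\<^sub>R r) \<longlongrightarrow> T s y) (at_right 0)"
      using gen_orbit[OF xy s(1)] by (simp add: gen_def)
    then have "((\<lambda>r. (T r (T s x) - T s x) /\<^sub>R r - y) \<longlongrightarrow> T s y - y) (at_right 0)"
      by (intro tendsto_intros)
    moreover have "\<forall>\<^sub>F r in at_right 0. (T r (T s x) - T s x) /\<^sub>R r - y =
        (T (s + r) x - (s + r) *\<^sub>R y - (T s x - s *\<^sub>R y)) /\<^sub>R r"
      using eventually_at_right_less[of "0::real"]
    proof eventually_elim
      case (elim r)
      have "T (s + r) x = T r (T s x)" using T_add[of r s x] elim s x by (simp add: add.commute)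
      then show ?case using elim by (simp add: algebra_simps)
    qed
    ultimately show "((\<lambda>r. (T (s + r) x - (s + r) *\<^sub>R y - (T s x - s *\<^sub>R y)) /\<^sub>R r) \<longlongrightarrow> T s y - y) (at_right 0)"
      by (rule Lim_transform_eventually)
  qed
  then show ?thesis using x by (simp add: T_zero algebra_simps)
qed

lemma closed_gen: "closed gen"
  unfolding closed_sequential_limits
proof (intro allI impI)
  fix u l assume "(\<forall>n. u n \<in> gen) \<and> u \<longlonglongrightarrow> l"
  then have u: "\<And>n. u n \<in> gen" "u \<longlonglongrightarrow> l" by auto
  define x y where "x = (\<lambda>n. fst (u n))" and "y = (\<lambda>n. snd (u n))"
  define x0 y0 where "x0 = fst l" and "y0 = snd l"
  have xy: "(x n, y n) \<in> gen" "x n \<in> X" "y n \<in> X" for n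
    using u(1)[of n] by (auto simp: x_def y_def gen_def)
  have lim: "x \<longlonglongrightarrow> x0" "y \<longlonglongrightarrow> y0"
    unfolding x_def y_def x0_def y0_def by (intro tendsto_intros u)+
  have X: "x0 \<in> X" "y0 \<in> X"
    using closed_X lim xy closed_sequentially by blast+
  obtain M where M: "0 \<le> M" "\<And>t x. 0 \<le> t \<Longrightarrow> t \<le> 1 \<Longrightarrow> x \<in> X \<Longrightarrow> norm (T t x) \<le> M * norm x"
    using locally_bounded[of 1] by blast
  have "((\<lambda>t. (T t x0 - x0) /\<^sub>R t) \<longlongrightarrow> y0) (at_right 0)"
  proof (rule tendstoI)
    fix e :: real assume "e > 0"
    then have e: "e / 2 > 0" by simp
    from tendstoD[OF cont0[OF X(2)] this] obtain d where d: "d > 0" "\<And>r. 0 < r \<Longrightarrow> r < d \<Longrightarrow> dist (T r y0) y0 < e / 2"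
      by (auto simp: eventually_at_right_field)
    have "dist ((T h x0 - x0) /\<^sub>R h) y0 < e" if h: "0 < h" "h < min d 1" for h
    proof -
      have "norm (T h (x n) - x n - h *\<^sub>R y n) \<le> (e / 2 + (M + 1) * norm (y n - y0)) * h" for n
      proof (rule gen_increment_bound[OF xy(1)])
        fix r assume r: "0 \<le> r" "r \<le> h"
        have "T r (y n) - y n = T r (y n - y0) + (T r y0 - y0) - (y n - y0)"
          using r xy X by (simp add: T_diff)
        also have "norm \<dots> \<le> norm (T r (y n - y0)) + norm (T r y0 - y0) + norm (y n - y0)"
          by (meson norm_triangle_ineq norm_triangle_ineq4 add_right_mono order_trans)
        also have "norm (T r (y n - y0)) \<le> M * norm (y n - y0)"
          using r h xy X by (intro M X_diff) auto
        also have "norm (T r y0 - y0) \<le> e / 2"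
          using d(2)[of r] r h e T_zero[OF X(2)] by (cases "r = 0") (auto simp: dist_norm)
        finally show "norm (T r (y n) - y n) \<le> e / 2 + (M + 1) * norm (y n - y0)" by (simp add: algebra_simps)
      qed (use h in simp)
      moreover have "(\<lambda>n. T h (x n)) \<longlonglongrightarrow> T h x0"
        by (rule continuous_on_tendsto_compose[OF continuous_on_T lim(1) X(1)]) (use h xy in auto)
      then have "(\<lambda>n. norm (T h (x n) - x n - h *\<^sub>R y n)) \<longlonglongrightarrow> norm (T h x0 - x0 - h *\<^sub>R y0)"
        by (intro tendsto_intros lim)
      moreover have "(\<lambda>n. (e / 2 + (M + 1) * norm (y n - y0)) * h) \<longlonglongrightarrow> (e / 2 + (M + 1) * norm (y0 - y0)) * h"
        by (intro tendsto_intros lim)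
      ultimately have "norm (T h x0 - x0 - h *\<^sub>R y0) \<le> (e / 2 + (M + 1) * norm (y0 - y0)) * h"
        by (intro LIMSEQ_le) auto
      then have *: "norm (T h x0 - x0 - h *\<^sub>R y0) \<le> e / 2 * h" by simp
      have "(T h x0 - x0) /\<^sub>R h - y0 = (T h x0 - x0 - h *\<^sub>R y0) /\<^sub>R h"
        using h by (simp add: algebra_simps)
      then have "dist ((T h x0 - x0) /\<^sub>R h) y0 = norm (T h x0 - x0 - h *\<^sub>R y0) / h"
        unfolding dist_norm using h by (simp only: norm_scaleR) (simp add: field_simps)
      also have "\<dots> \<le> e / 2" using * h by (simp add: field_simps)
      also have "\<dots> < e" using e by simp
      finally show ?thesis .
    qed
    then show "\<forall>\<^sub>F h in at_right 0. dist ((T h x0 - x0) /\<^sub>R h) y0 < e"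
      unfolding eventually_at_right_field using d(1) by (intro exI[of _ "min d 1"]) auto
  qed
  then show "l \<in> gen" using X unfolding gen_def x0_def y0_def by (auto simp: case_prod_unfold)
qed

end

text \<open>
  The curve \<open>s \<mapsto> S (t - s) (T s f)\<close> leads from \<open>S t f\<close> to \<open>T t f\<close>. Its right derivative vanishes, since
  \<open>T s f\<close> stays in the domain of the smaller generator, where both generators agree.
\<close>

lemma semigroup_unique:
  fixes X :: "'b::banach set"
  assumes S: "semigroup_on X S" and T: "semigroup_on X T"
    and sub: "semigroup_on.gen X T \<subseteq> semigroup_on.gen X S"
    and dense: "X \<subseteq> closure (Domain (semigroup_on.gen X T))"
    and t: "0 \<le> t" and x: "x \<in> X"
  shows "S t x = T t x"
proof -
  interpret S: semigroup_on X S by fact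
  interpret T: semigroup_on X T by fact
  have on_dom: "S t f = T t f" if fg: "(f, g) \<in> T.gen" for f g
  proof -
    have f: "f \<in> X" using fg by (auto simp: T.gen_def)
    obtain M where M: "0 \<le> M" "\<And>s x. 0 \<le> s \<Longrightarrow> s \<le> t \<Longrightarrow> x \<in> X \<Longrightarrow> norm (S s x) \<le> M * norm x"
      using S.locally_bounded[of t] by blast
    define y where "y s = S (t - s) (T s f)" for s
    have "y t = y 0"
    proof (rule right_derivative_zero_imp_eq[OF t])
      show "continuous_on {0..t} y"
        unfolding continuous_on_def
      proof (intro ballI)
        fix s assume s: "s \<in> {0..t}"
        have "((\<lambda>r. T r f) \<longlongrightarrow> T s f) (at s within {0..t})"
          using continuous_on_subset[OF T.continuous_on_orbit[OF f], of "{0..t}"] s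
          by (auto simp: continuous_on_def)
        then have "((\<lambda>r. M * norm (T r f - T s f)) \<longlongrightarrow> 0) (at s within {0..t})"
          by (intro tendsto_eq_intros | simp)+
        moreover have "continuous_on {0..t} (\<lambda>r. S (t - r) (T s f))"
          using s f by (intro continuous_on_compose2[OF S.continuous_on_orbit[of "T s f"]] continuous_intros T.maps) auto
        then have "((\<lambda>r. S (t - r) (T s f)) \<longlongrightarrow> S (t - s) (T s f)) (at s within {0..t})"
          using s by (auto simp: continuous_on_def)
        then have "((\<lambda>r. norm (S (t - r) (T s f) - S (t - s) (T s f))) \<longlongrightarrow> 0) (at s within {0..t})"
          using Lim_null tendsto_norm_zero by blast
        ultimately have *: "((\<lambda>r. M * norm (T r f - T s f) + norm (S (t - r) (T s f) - S (t - s) (T s f))) \<longlongrightarrow> 0) (at s within {0..t})"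
          by (rule tendsto_add_zero)
        have "((\<lambda>r. y r - y s) \<longlongrightarrow> 0) (at s within {0..t})"
        proof (rule Lim_null_comparison[OF _ *])
          show "\<forall>\<^sub>F r in at s within {0..t}. norm (y r - y s) \<le>
              M * norm (T r f - T s f) + norm (S (t - r) (T s f) - S (t - s) (T s f))"
            unfolding eventually_at_topological
          proof (intro exI[of _ UNIV] conjI ballI impI)
            fix r assume r: "r \<in> {0..t}"
            have "y r - y s = S (t - r) (T r f - T s f) + (S (t - r) (T s f) - S (t - s) (T s f))"
              using r s f by (simp add: y_def S.T_diff T.maps)
            then have "norm (y r - y s) \<le> norm (S (t - r) (T r f - T s f)) + norm (S (t - r) (T s f) - S (t - s) (T s f))"
              using norm_triangle_ineq by metis
            also have "norm (S (t - r) (T r f - T s f)) \<le> M * norm (T r f - T s f)"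
              using r s f by (intro M S.X_diff T.maps) auto
            finally show "norm (y r - y s) \<le>
              M * norm (T r f - T s f) + norm (S (t - r) (T s f) - S (t - s) (T s f))" by simp
          qed auto
        qed
        then show "(y \<longlongrightarrow> y s) (at s within {0..t})" using Lim_null by blast
      qed
    next
      fix s assume s: "0 \<le> s" "s < t"
      define z where "z = T s f"
      have z: "z \<in> X" "(z, T s g) \<in> T.gen" "(z, T s g) \<in> S.gen"
        using T.gen_orbit[OF fg s(1)] sub f s by (auto simp: z_def T.maps)
      have "((\<lambda>h. (T h z - z) /\<^sub>R h - (S h z - z) /\<^sub>R h) \<longlongrightarrow> T s g - T s g) (at_right 0)"
        using z(2,3) by (intro tendsto_diff) (auto simp: T.gen_def S.gen_def)
      then have *: "((\<lambda>h. M * norm ((T h z - z) /\<^sub>R h - (S h z - z) /\<^sub>R h)) \<longlongrightarrow> 0) (at_right 0)"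
        by (intro tendsto_mult_right_zero tendsto_norm_zero) simp
      show "((\<lambda>h. (y (s + h) - y s) /\<^sub>R h) \<longlongrightarrow> 0) (at_right 0)"
      proof (rule Lim_null_comparison[OF _ *])
        have "\<forall>\<^sub>F h in at_right 0. h < t - s"
          using s unfolding eventually_at_right_field by (intro exI[of _ "t - s"]) auto
        then show "\<forall>\<^sub>F h in at_right 0. norm ((y (s + h) - y s) /\<^sub>R h) \<le> M * norm ((T h z - z) /\<^sub>R h - (S h z - z) /\<^sub>R h)"
          using eventually_at_right_less[of "0::real"]
        proof eventually_elim
          case (elim h)
          have "T (s + h) f = T h z" using T.T_add[of h s f] elim s f by (simp add: z_def add.commute)
          moreover have "S (t - s) z = S (t - (s + h)) (S h z)"
            using S.T_add[of "t - (s + h)" h z] elim z by simp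
          ultimately have "y (s + h) - y s = S (t - (s + h)) (T h z - S h z)"
            using elim z s unfolding y_def z_def[symmetric] by (subst S.T_diff) (auto intro: T.maps S.maps)
          moreover have "norm (S (t - (s + h)) (T h z - S h z)) \<le> M * norm (T h z - S h z)"
            using elim z s by (intro M S.X_diff T.maps S.maps) auto
          ultimately have "norm (y (s + h) - y s) \<le> M * norm (T h z - S h z)" by simp
          moreover have "(T h z - z) /\<^sub>R h - (S h z - z) /\<^sub>R h = (T h z - S h z) /\<^sub>R h"
            by (simp add: algebra_simps)
          ultimately show ?case using elim
            by (simp only: norm_scaleR) (simp add: field_simps)
        qed
      qed
    qed
    then show ?thesis using f t by (simp add: y_def S.T_zero T.T_zero T.maps)
  qed
  have "continuous_on X (\<lambda>x. S t x - T t x)"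
    using t by (intro continuous_intros S.continuous_on_T T.continuous_on_T)
  moreover have "closed {0::'b}" by simp
  ultimately have cl: "closedin (top_of_set X) (X \<inter> (\<lambda>x. S t x - T t x) -` {0})"
    by (rule continuous_closedin_preimage)
  then have "closed (X \<inter> (\<lambda>x. S t x - T t x) -` {0})" using T.closed_X closedin_closed_trans by blast
  moreover have "Domain T.gen \<subseteq> X \<inter> (\<lambda>x. S t x - T t x) -` {0}"
    using on_dom by (auto simp: T.gen_def)
  ultimately have "closure (Domain T.gen) \<subseteq> X \<inter> (\<lambda>x. S t x - T t x) -` {0}"
    by (intro closure_minimal)
  then show ?thesis using dense x by auto
qed

section \<open>Integrals of subspace-valued curves and Volterra equations\<close>

lemma has_integral_mem_closed_subspace:
  fixes F :: "real \<Rightarrow> 'b::banach"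
  assumes X: "closed X" "subspace X" and F: "\<And>s. s \<in> {a..b} \<Longrightarrow> F s \<in> X"
    and I: "(F has_integral y) {a..b}"
  shows "y \<in> X"
proof -
  have "((\<lambda>p. \<Sum>(x,k)\<in>p. measure lborel k *\<^sub>R F x) \<longlongrightarrow> y) (division_filter (cbox a b))"
    using I[unfolded cbox_interval[symmetric] has_integral_cbox] .
  moreover have "\<forall>\<^sub>F p in division_filter (cbox a b). (\<Sum>(x,k)\<in>p. measure lborel k *\<^sub>R F x) \<in> X"
    using eventually_division_filter_tagged_division
  proof eventually_elim
    case (elim p)
    then have "\<And>x k. (x, k) \<in> p \<Longrightarrow> F x \<in> X" using F by (auto dest!: tag_in_interval)
    then show ?case by (intro subspace_sum X) (auto intro!: subspace_scale X)
  qed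
  ultimately show ?thesis
    using Lim_in_closed_set[OF X(1) _ division_filter_not_empty] by blast
qed

text \<open>
  The operator \<open>R\<close> is linear only on \<open>X\<close>, but the Riemann sums of \<open>F\<close> and their limit belong to \<open>X\<close>, so
  \<open>R\<close> can be applied to them one by one.
\<close>

lemma has_integral_bounded_on_subspace:
  fixes F :: "real \<Rightarrow> 'b::banach" and R :: "'b \<Rightarrow> 'b"
  assumes X: "closed X" "subspace X" and F: "\<And>s. s \<in> {a..b} \<Longrightarrow> F s \<in> X"
    and lin: "\<And>x y r s. x \<in> X \<Longrightarrow> y \<in> X \<Longrightarrow> R (r *\<^sub>R x + s *\<^sub>R y) = r *\<^sub>R R x + s *\<^sub>R R y"
    and bnd: "\<And>x. x \<in> X \<Longrightarrow> norm (R x) \<le> C * norm x"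
    and I: "(F has_integral y) {a..b}"
  shows "((\<lambda>s. R (F s)) has_integral R y) {a..b}"
proof -
  let ?S = "\<lambda>p F. \<Sum>(x,k)\<in>p. measure lborel k *\<^sub>R (F x :: 'b)"
  have y: "y \<in> X" by (rule has_integral_mem_closed_subspace[OF X F I])
  have 0: "0 \<in> X" using X subspace_0 by blast
  have R0: "R 0 = 0" using lin[OF 0 0, of 0 0] by simp
  have Rsum: "?S p F \<in> X \<and> R (?S p F) = ?S p (\<lambda>x. R (F x))" if p: "finite p" "\<And>x k. (x, k) \<in> p \<Longrightarrow> F x \<in> X" for p
    using p
  proof (induction p rule: finite_induct)
    case empty then show ?case using 0 R0 by simp
  next
    case (insert z p)
    obtain x k where z: "z = (x, k)" by force
    have IH: "?S p F \<in> X" "R (?S p F) = ?S p (\<lambda>x. R (F x))" using insert by auto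
    have "F x \<in> X" using insert z by auto
    then show ?case using IH insert(1,2) lin[of "F x" "?S p F" "measure lborel k" 1] z
      by (simp add: subspace_add[OF X(2)] subspace_scale[OF X(2)])
  qed
  have lim: "((\<lambda>p. ?S p F) \<longlongrightarrow> y) (division_filter (cbox a b))"
    using I[unfolded cbox_interval[symmetric] has_integral_cbox] .
  have ev: "\<forall>\<^sub>F p in division_filter (cbox a b). ?S p F \<in> X \<and> R (?S p F) = ?S p (\<lambda>x. R (F x))"
    using eventually_division_filter_tagged_division
  proof eventually_elim
    case (elim p)
    show ?case
    proof (rule Rsum)
      show "finite p" using elim by (rule tagged_division_of_finite)
      show "F x \<in> X" if "(x, k) \<in> p" for x k using tag_in_interval[OF elim that] F by simp
    qed
  qed
  have "((\<lambda>p. ?S p (\<lambda>x. R (F x)) - R y) \<longlongrightarrow> 0) (division_filter (cbox a b))"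
  proof (rule Lim_null_comparison)
    show "((\<lambda>p. C * norm (?S p F - y)) \<longlongrightarrow> 0) (division_filter (cbox a b))"
      by (intro tendsto_mult_right_zero tendsto_norm_zero) (use lim Lim_null in blast)
    show "\<forall>\<^sub>F p in division_filter (cbox a b). norm (?S p (\<lambda>x. R (F x)) - R y) \<le> C * norm (?S p F - y)"
      using ev
    proof eventually_elim
      case (elim p)
      then have "R (?S p F - y) = ?S p (\<lambda>x. R (F x)) - R y" using lin[of "?S p F" y 1 "-1"] y by simp
      then show ?case using bnd[of "?S p F - y"] elim y X by (simp add: subspace_diff)
    qed
  qed
  then show ?thesis
    unfolding cbox_interval[symmetric] has_integral_cbox using Lim_null by blast
qed

text \<open>
  The substitution \<open>s = t * x\<close> turns the integral over \<open>{0..t}\<close> into \<open>t\<close> times an integral over the fixed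
  interval \<open>{0..1}\<close>, which depends continuously on \<open>t\<close>.
\<close>

lemma
  fixes h :: "real \<Rightarrow> real \<Rightarrow> 'b::banach"
  assumes h: "continuous_on UNIV (\<lambda>(t, s). h t s)"
  shows continuous_on_integral_upper: "continuous_on {0..} (\<lambda>t. integral {0..t} (h t))"
    and integral_upper_derivative_zero: "((\<lambda>t. integral {0..t} (h t) /\<^sub>R t) \<longlongrightarrow> h 0 0) (at_right 0)"
    and integrable_upper: "h t integrable_on {a..b}"
proof -
  have ch: "continuous_on S (h t)" for S t
    using continuous_on_compose2[OF h, of S "\<lambda>s. (t, s)"]
    by (simp add: continuous_on_Pair continuous_on_const continuous_on_id)
  show "h t integrable_on {a..b}" by (rule integrable_continuous_interval[OF ch])
  define J where "J t = integral {0..1} (\<lambda>x. h t (t * x))" for t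
  have J: "integral {0..t} (h t) = t *\<^sub>R J t" if t: "0 \<le> t" for t
  proof (cases "t = 0")
    case False
    then have "t > 0" using t by simp
    have "(h t has_integral integral {0..t} (h t)) (cbox 0 t)"
      using integrable_integral[OF integrable_continuous_interval[OF ch]] by (simp add: cbox_interval)
    from has_integral_affinity'[OF this \<open>t > 0\<close>, of 0]
    have "((\<lambda>x. h t (t * x)) has_integral integral {0..t} (h t) /\<^sub>R t) {0..1}"
      using \<open>t > 0\<close> by (simp add: cbox_interval)
    then have "J t = integral {0..t} (h t) /\<^sub>R t" unfolding J_def by (rule integral_unique)
    then show ?thesis using \<open>t > 0\<close> by simp
  qed simp
  have cJ: "continuous_on UNIV J"
  proof -
    have "continuous_on (UNIV \<times> cbox 0 1) (\<lambda>(t, x). h t (t * x))"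
      using continuous_on_compose2[OF h, of "UNIV \<times> cbox 0 1" "\<lambda>z. (fst z, fst z * snd z)"]
      by (simp add: split_beta' continuous_on_Pair continuous_on_fst continuous_on_snd continuous_on_mult continuous_on_id)
    from integral_continuous_on_param[OF this] show ?thesis
      unfolding J_def by (simp add: cbox_interval)
  qed
  have "continuous_on {0..} (\<lambda>t. t *\<^sub>R J t)"
    by (intro continuous_intros continuous_on_subset[OF cJ]) auto
  then show "continuous_on {0..} (\<lambda>t. integral {0..t} (h t))"
    by (rule continuous_on_eq) (simp add: J)
  have "(J \<longlongrightarrow> J 0) (at_right 0)"
    using cJ by (auto simp: continuous_on_def intro: tendsto_within_subset)
  moreover have "J 0 = h 0 0" by (simp add: J_def)
  moreover have "\<forall>\<^sub>F t in at_right 0. J t = integral {0..t} (h t) /\<^sub>R t"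
    using eventually_at_right_less[of "0::real"] by eventually_elim (simp add: J)
  ultimately show "((\<lambda>t. integral {0..t} (h t) /\<^sub>R t) \<longlongrightarrow> h 0 0) (at_right 0)"
    using Lim_transform_eventually by fastforce
qed

text \<open>
  With the weight \<open>exp (- \<omega> * t)\<close>, convolution with a kernel bounded by \<open>K\<close> has norm at most \<open>K / \<omega>\<close>.
\<close>

lemma integral_exp_convolution_le:
  fixes \<omega> t K :: real and f :: "real \<Rightarrow> 'b::banach"
  assumes \<omega>: "\<omega> > 0" and t: "0 \<le> t" and K: "0 \<le> K" and f: "f integrable_on {0..t}"
    and le: "\<And>s. 0 \<le> s \<Longrightarrow> s \<le> t \<Longrightarrow> norm (f s) \<le> K * exp (- \<omega> * (t - s))"
  shows "norm (integral {0..t} f) \<le> K / \<omega>"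
proof -
  have I: "((\<lambda>s. K * exp (- \<omega> * (t - s))) has_integral
      K * exp (- \<omega> * (t - t)) / \<omega> - K * exp (- \<omega> * (t - 0)) / \<omega>) {0..t}"
    by (rule fundamental_theorem_of_calculus[OF t])
      (use \<omega> in \<open>auto intro!: derivative_eq_intros simp flip: has_real_derivative_iff_has_vector_derivative\<close>)
  have "norm (integral {0..t} f) \<le> integral {0..t} (\<lambda>s. K * exp (- \<omega> * (t - s)))"
    by (rule integral_norm_bound_integral[OF f has_integral_integrable[OF I]]) (use le in auto)
  also have "\<dots> \<le> K / \<omega>" unfolding integral_unique[OF I] using K \<omega> by simp
  finally show ?thesis .
qed

text \<open>
  The weighted unknown \<open>exp (- \<omega> * t) * g t\<close> is a fixed point in the space of bounded continuous
  functions. The rate \<open>\<omega> = 2 * K + 1\<close> makes the convolution operator a contraction with factor \<open>1/2\<close>,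
  and it also gives the growth bound. Negative times are clamped to \<open>0\<close>, so that all functions are defined
  on the whole line.
\<close>

lemma volterra_exists:
  fixes k b :: "real \<Rightarrow> real"
  assumes k: "continuous_on {0..} k" "\<And>s. 0 \<le> s \<Longrightarrow> \<bar>k s\<bar> \<le> K"
    and b: "continuous_on {0..} b" "\<And>s. 0 \<le> s \<Longrightarrow> \<bar>b s\<bar> \<le> B"
  shows "\<exists>g. continuous_on {0..} g \<and>
    (\<forall>t\<ge>0. g t = b t + integral {0..t} (\<lambda>s. k (t - s) * g s)) \<and>
    (\<forall>t\<ge>0. \<bar>g t\<bar> \<le> 2 * B * exp ((2 * K + 1) * t))"
proof -
  define \<omega> where "\<omega> = 2 * K + 1"
  have K: "0 \<le> K" using k(2)[of 0] by simp
  then have \<omega>: "\<omega> > 0" by (simp add: \<omega>_def)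
  have K\<omega>: "N * K / \<omega> \<le> N / 2" if "N \<ge> 0" for N
    using K \<omega> that by (simp add: \<omega>_def field_simps)
  define \<kappa> where "\<kappa> r = exp (- \<omega> * max r 0) * k (max r 0)" for r
  define \<beta> where "\<beta> r = exp (- \<omega> * max r 0) * b (max r 0)" for r
  have cmax: "continuous_on S (\<lambda>r. max r (0::real))" for S by (intro continuous_intros)
  have "continuous_on S (\<lambda>r. k (max r 0))" "continuous_on S (\<lambda>r. b (max r 0))" for S
    by (rule continuous_on_compose2[OF k(1) cmax] continuous_on_compose2[OF b(1) cmax]; simp add: subset_eq)+
  then have c\<kappa>: "continuous_on S \<kappa>" and c\<beta>: "continuous_on S \<beta>" for S
    unfolding \<kappa>_def \<beta>_def by (auto intro!: continuous_intros)
  define \<Phi> where "\<Phi> G t = \<beta> t + integral {0..max t 0} (\<lambda>s. \<kappa> (max t 0 - s) * G s)" for G and t :: real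
  have ch: "continuous_on UNIV (\<lambda>(t, s). \<kappa> (t - s) * apply_bcontfun G s)" for G :: "real \<Rightarrow>\<^sub>C real"
  proof -
    have "continuous_on UNIV (\<lambda>z::real \<times> real. fst z - snd z)" by (intro continuous_intros)
    from continuous_on_compose2[OF c\<kappa>[of UNIV] this]
    have "continuous_on UNIV (\<lambda>z::real \<times> real. \<kappa> (fst z - snd z))" by simp
    moreover have "continuous_on UNIV (\<lambda>z::real \<times> real. apply_bcontfun G (snd z))"
      by (rule continuous_on_compose2[of UNIV "apply_bcontfun G"]) (auto intro: continuous_intros)
    ultimately show ?thesis unfolding split_beta' by (rule continuous_on_mult)
  qed
  have int: "(\<lambda>s. \<kappa> (t - s) * apply_bcontfun G s) integrable_on {0..t}" for G :: "real \<Rightarrow>\<^sub>C real" and t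
    using integrable_upper[OF ch[of G], of t 0 t] .
  have le: "\<bar>integral {0..t} (\<lambda>s. \<kappa> (t - s) * G s)\<bar> \<le> N / 2"
    if "0 \<le> t" "\<And>s. \<bar>G s\<bar> \<le> N" "(\<lambda>s. \<kappa> (t - s) * G s) integrable_on {0..t}" for G t N
  proof -
    have N: "N \<ge> 0" using that(2)[of 0] by simp
    have "norm (integral {0..t} (\<lambda>s. \<kappa> (t - s) * G s)) \<le> (N * K) / \<omega>"
    proof (rule integral_exp_convolution_le)
      fix s assume s: "0 \<le> s" "s \<le> t"
      have "norm (\<kappa> (t - s) * G s) = exp (- \<omega> * (t - s)) * (\<bar>k (t - s)\<bar> * \<bar>G s\<bar>)"
        using s by (simp add: \<kappa>_def abs_mult)
      also have "\<dots> \<le> exp (- \<omega> * (t - s)) * (K * N)"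
        using s that k K by (intro mult_left_mono mult_mono) auto
      finally show "norm (\<kappa> (t - s) * G s) \<le> N * K * exp (- \<omega> * (t - s))" by (simp add: mult_ac)
    qed (use that \<omega> K N in auto)
    then show ?thesis using order_trans[OF _ K\<omega>[OF N]] by (simp only: real_norm_def)
  qed
  have B: "0 \<le> B" using b(2)[of 0] by simp
  have \<beta>le: "\<bar>\<beta> t\<bar> \<le> B" for t
  proof -
    have "exp (- \<omega> * max t 0) \<le> 1" using \<omega> by simp
    then have "exp (- \<omega> * max t 0) * \<bar>b (max t 0)\<bar> \<le> 1 * B" using b(2)[of "max t 0"] by (intro mult_mono) auto
    then show ?thesis unfolding \<beta>_def abs_mult by simp
  qed
  have \<Phi>le: "\<bar>\<Phi> (apply_bcontfun G) t\<bar> \<le> B + norm G / 2" for G t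
  proof -
    have "\<bar>integral {0..max t 0} (\<lambda>s. \<kappa> (max t 0 - s) * apply_bcontfun G s)\<bar> \<le> norm G / 2"
      by (rule le) (use norm_bounded[of G] int in auto)
    then show ?thesis unfolding \<Phi>_def using \<beta>le[of t] by linarith
  qed
  have \<Phi>cont: "continuous_on UNIV (\<Phi> (apply_bcontfun G))" for G
    unfolding \<Phi>_def
    by (intro continuous_intros c\<beta> continuous_on_compose2[OF continuous_on_integral_upper[OF ch]]) auto
  have mem: "\<Phi> (apply_bcontfun G) \<in> bcontfun" for G
    using \<Phi>le \<Phi>cont by (intro bcontfun_normI) auto
  define F where "F G = Bcontfun (\<Phi> (apply_bcontfun G))" for G
  have F: "apply_bcontfun (F G) = \<Phi> (apply_bcontfun G)" for G
    unfolding F_def using mem by (rule Bcontfun_inverse)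
  have "\<exists>!G. F G = G"
  proof (rule banach_fix_type[where c = "1/2"]; (intro allI)?)
    fix G H :: "real \<Rightarrow>\<^sub>C real"
    show "dist (F G) (F H) \<le> 1/2 * dist G H"
    proof (rule dist_bound)
      fix t
      have "\<Phi> (apply_bcontfun G) t - \<Phi> (apply_bcontfun H) t =
          integral {0..max t 0} (\<lambda>s. \<kappa> (max t 0 - s) * apply_bcontfun (G - H) s)"
        unfolding \<Phi>_def
        using integral_diff[OF int[of "max t 0" G] int[of "max t 0" H]] by (simp add: algebra_simps)
      also have "\<bar>\<dots>\<bar> \<le> norm (G - H) / 2"
        by (rule le) (use norm_bounded[of "G - H"] int[of "max t 0" "G - H"] in auto)
      finally show "dist (apply_bcontfun (F G) t) (apply_bcontfun (F H) t) \<le> 1/2 * dist G H"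
        by (simp add: F dist_norm)
    qed
  qed auto
  then obtain G where G: "F G = G" by blast
  define g where "g t = exp (\<omega> * t) * apply_bcontfun G t" for t
  have Gle: "\<bar>apply_bcontfun G t\<bar> \<le> 2 * B" for t
  proof -
    have "norm G \<le> B + norm G / 2"
      using \<Phi>le[of G] F[of G] G by (intro norm_bound) auto
    then have "norm G \<le> 2 * B" by simp
    then show ?thesis using norm_bounded[of G t] by simp
  qed
  have "g t = b t + integral {0..t} (\<lambda>s. k (t - s) * g s)" if t: "0 \<le> t" for t
  proof -
    have "apply_bcontfun G t = exp (- \<omega> * t) * b t + integral {0..t} (\<lambda>s. \<kappa> (t - s) * apply_bcontfun G s)"
      using fun_cong[OF F[of G], of t] G t by (simp add: \<Phi>_def \<beta>_def)
    then have "g t = b t + exp (\<omega> * t) * integral {0..t} (\<lambda>s. \<kappa> (t - s) * apply_bcontfun G s)"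
      unfolding g_def by (simp add: algebra_simps flip: mult.assoc exp_add)
    also have "exp (\<omega> * t) * integral {0..t} (\<lambda>s. \<kappa> (t - s) * apply_bcontfun G s) =
        integral {0..t} (\<lambda>s. exp (\<omega> * t) * (\<kappa> (t - s) * apply_bcontfun G s))" by simp
    also have "\<dots> = integral {0..t} (\<lambda>s. k (t - s) * g s)"
    proof (rule integral_cong)
      fix s assume "s \<in> {0..t}"
      then have "exp (\<omega> * t) * (\<kappa> (t - s) * apply_bcontfun G s) =
          (exp (\<omega> * t) * exp (- \<omega> * (t - s))) * (k (t - s) * apply_bcontfun G s)"
        by (simp add: \<kappa>_def mult_ac)
      also have "exp (\<omega> * t) * exp (- \<omega> * (t - s)) = exp (\<omega> * s)"
        by (simp add: algebra_simps flip: exp_add)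
      finally show "exp (\<omega> * t) * (\<kappa> (t - s) * apply_bcontfun G s) = k (t - s) * g s"
        by (simp add: g_def mult_ac)
    qed
    finally show ?thesis .
  qed
  moreover have "continuous_on {0..} g" unfolding g_def by (intro continuous_intros) auto
  moreover have "\<bar>g t\<bar> \<le> 2 * B * exp (\<omega> * t)" for t
    unfolding g_def abs_mult using mult_left_mono[OF Gle, of "exp (\<omega> * t)" t] by (simp add: mult_ac)
  ultimately show ?thesis unfolding \<omega>_def by blast
qed

text \<open>
  At a point of \<open>{0..t}\<close> where the weighted difference of two solutions is maximal, the equation bounds
  it by half of itself.
\<close>

lemma volterra_unique:
  fixes k b :: "real \<Rightarrow> real"
  assumes k: "continuous_on {0..} k" "\<And>s. 0 \<le> s \<Longrightarrow> \<bar>k s\<bar> \<le> K"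
    and g: "continuous_on {0..} g" "\<And>t. 0 \<le> t \<Longrightarrow> g t = b t + integral {0..t} (\<lambda>s. k (t - s) * g s)"
    and h: "continuous_on {0..} h" "\<And>t. 0 \<le> t \<Longrightarrow> h t = b t + integral {0..t} (\<lambda>s. k (t - s) * h s)"
    and t: "0 \<le> t"
  shows "g t = h t"
proof -
  define \<omega> where "\<omega> = 2 * K + 1"
  have K: "0 \<le> K" using k(2)[of 0] by simp
  then have \<omega>: "\<omega> > 0" by (simp add: \<omega>_def)
  define d where "d s = \<bar>g s - h s\<bar> * exp (- \<omega> * s)" for s
  have "continuous_on {0..t} d"
    unfolding d_def by (intro continuous_intros continuous_on_subset[OF g(1)] continuous_on_subset[OF h(1)]) auto
  then obtain r where r: "r \<in> {0..t}" "\<And>s. s \<in> {0..t} \<Longrightarrow> d s \<le> d r"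
    using continuous_attains_sup[of "{0..t}" d] t by auto
  have ck: "continuous_on {0..r} (\<lambda>s. k (r - s))"
    by (intro continuous_on_compose2[OF k(1)] continuous_intros) auto
  have int: "(\<lambda>s. k (r - s) * g s) integrable_on {0..r}" "(\<lambda>s. k (r - s) * h s) integrable_on {0..r}"
    using r by (auto intro!: integrable_continuous_interval continuous_intros ck continuous_on_subset[OF g(1)] continuous_on_subset[OF h(1)])
  have "g r - h r = integral {0..r} (\<lambda>s. k (r - s) * g s - k (r - s) * h s)"
    using r g(2)[of r] h(2)[of r] int by (simp add: integral_diff)
  also have "\<dots> = integral {0..r} (\<lambda>s. k (r - s) * (g s - h s))" by (simp add: algebra_simps)
  finally have eq: "g r - h r = integral {0..r} (\<lambda>s. k (r - s) * (g s - h s))" .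
  have "d r \<ge> 0" by (simp add: d_def)
  have "norm (integral {0..r} (\<lambda>s. k (r - s) * (g s - h s))) \<le> (K * (d r * exp (\<omega> * r))) / \<omega>"
  proof (rule integral_exp_convolution_le)
    show "(\<lambda>s. k (r - s) * (g s - h s)) integrable_on {0..r}"
      using integrable_diff[OF int] by (simp add: algebra_simps)
    fix s assume s: "0 \<le> s" "s \<le> r"
    have "\<bar>g s - h s\<bar> = d s * exp (\<omega> * s)" by (simp add: d_def exp_minus)
    also have "\<dots> \<le> d r * exp (\<omega> * s)" using r s by (intro mult_right_mono) auto
    finally have "norm (k (r - s) * (g s - h s)) \<le> K * (d r * exp (\<omega> * s))"
      using s k K by (simp add: abs_mult mult_mono)
    also have "exp (\<omega> * s) = exp (\<omega> * r) * exp (- \<omega> * (r - s))"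
      by (simp add: algebra_simps flip: exp_add)
    finally show "norm (k (r - s) * (g s - h s)) \<le> K * (d r * exp (\<omega> * r)) * exp (- \<omega> * (r - s))"
      by (simp add: mult_ac)
  qed (use \<omega> r K \<open>d r \<ge> 0\<close> in auto)
  then have "\<bar>g r - h r\<bar> \<le> K * (d r * exp (\<omega> * r)) / \<omega>" by (simp add: eq)
  moreover have "\<bar>g r - h r\<bar> = d r * exp (\<omega> * r)" by (simp add: d_def exp_minus)
  ultimately have "d r * exp (\<omega> * r) \<le> (K / \<omega> * d r) * exp (\<omega> * r)" by simp
  then have "d r \<le> K / \<omega> * d r" by (rule mult_right_le_imp_le) simp
  moreover have "K / \<omega> \<le> 1/2" using K by (simp add: \<omega>_def field_simps)
  then have "K / \<omega> * d r \<le> 1/2 * d r" using \<open>d r \<ge> 0\<close> by (intro mult_right_mono)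
  ultimately have "d r \<le> 1/2 * d r" by (rule order_trans)
  then have "d r = 0" using \<open>d r \<ge> 0\<close> by simp
  then have "d t \<le> 0" using r(2)[of t] t by simp
  then show ?thesis unfolding d_def by (simp add: mult_le_0_iff)
qed

section \<open>Contraction semigroups, cores and rank-one perturbations\<close>

locale contraction_semigroup_on = semigroup_on +
  assumes contraction: "0 \<le> t \<Longrightarrow> x \<in> X \<Longrightarrow> norm (T t x) \<le> norm x"
begin

lemma gen_dissipative:
  assumes "(x, y) \<in> gen" "0 < lam"
  shows "lam * norm x \<le> norm (lam *\<^sub>R x - y)"
proof -
  have x: "x \<in> X" and lim: "((\<lambda>t. (T t x - x) /\<^sub>R t) \<longlongrightarrow> y) (at_right 0)"
    using assms by (auto simp: gen_def)
  have "((\<lambda>t. norm (lam *\<^sub>R x - (T t x - x) /\<^sub>R t)) \<longlongrightarrow> norm (lam *\<^sub>R x - y)) (at_right 0)"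
    by (intro tendsto_intros lim)
  moreover have "\<forall>\<^sub>F t in at_right 0. lam * norm x \<le> norm (lam *\<^sub>R x - (T t x - x) /\<^sub>R t)"
    using eventually_at_right_less[of "0::real"]
  proof eventually_elim
    case (elim t)
    have "lam *\<^sub>R x - (T t x - x) /\<^sub>R t = (lam + 1/t) *\<^sub>R x - (1/t) *\<^sub>R T t x"
      by (simp add: algebra_simps divide_inverse)
    then have "norm (lam *\<^sub>R x - (T t x - x) /\<^sub>R t) \<ge> norm ((lam + 1/t) *\<^sub>R x) - norm ((1/t) *\<^sub>R T t x)"
      using norm_triangle_ineq2 by metis
    moreover have "norm ((1/t) *\<^sub>R T t x) \<le> (1/t) * norm x"
      using contraction[of t x] x elim by (simp add: divide_right_mono)
    moreover have "lam + 1/t > 0" using elim assms(2) by (simp add: add_pos_pos)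
    then have "norm ((lam + 1/t) *\<^sub>R x) = lam * norm x + (1/t) * norm x"
      unfolding norm_scaleR by (simp add: distrib_right)
    ultimately show ?case by linarith
  qed
  ultimately show ?thesis by (intro tendsto_lowerbound) auto
qed

text \<open>
  By dissipativity \<open>lam - A\<close> has a bounded inverse on its range: if \<open>lam *\<^sub>R x - y\<close> converges along a
  sequence in the graph, then so does \<open>x\<close>, and hence \<open>y\<close>.
\<close>

lemma dense_range_imp_core:
  assumes lam: "0 < lam" and D: "D \<subseteq> gen"
    and dense: "\<And>x y. (x, y) \<in> gen \<Longrightarrow> lam *\<^sub>R x - y \<in> closure ((\<lambda>(x, y). lam *\<^sub>R x - y) ` D)"
  shows "gen \<subseteq> closure D"
proof
  fix z assume z: "z \<in> gen"
  obtain x y where xy: "z = (x, y)" by force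
  with dense z obtain w where w: "\<And>n. w n \<in> (\<lambda>(x, y). lam *\<^sub>R x - y) ` D" "w \<longlonglongrightarrow> lam *\<^sub>R x - y"
    unfolding closure_sequential by blast
  have "\<forall>n. \<exists>a b. (a, b) \<in> D \<and> w n = lam *\<^sub>R a - b" using w(1) by fast
  then obtain a b where ab: "\<And>n. (a n, b n) \<in> D" "\<And>n. w n = lam *\<^sub>R a n - b n" by metis
  have "(\<lambda>n. a n - x) \<longlonglongrightarrow> 0"
  proof (rule Lim_null_comparison)
    show "(\<lambda>n. norm (w n - (lam *\<^sub>R x - y)) / lam) \<longlonglongrightarrow> 0"
      using w(2) lam by (intro tendsto_divide_zero tendsto_norm_zero) (use Lim_null in blast)
    have "norm (a n - x) \<le> norm (w n - (lam *\<^sub>R x - y)) / lam" for n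
    proof -
      have "(a n - x, b n - y) \<in> gen"
        using gen_comb[of "a n" "b n" x y 1 "- 1"] ab D z xy by auto
      moreover have "lam *\<^sub>R (a n - x) - (b n - y) = w n - (lam *\<^sub>R x - y)"
        by (simp add: ab(2) scaleR_diff_right)
      ultimately have "lam * norm (a n - x) \<le> norm (w n - (lam *\<^sub>R x - y))"
        using gen_dissipative[OF _ lam] by metis
      then show ?thesis using lam by (simp add: field_simps)
    qed
    then show "\<forall>\<^sub>F n in sequentially. norm (a n - x) \<le> norm (w n - (lam *\<^sub>R x - y)) / lam" by simp
  qed
  then have lim: "a \<longlonglongrightarrow> x" using Lim_null by blast
  have "(\<lambda>n. lam *\<^sub>R a n - w n) \<longlonglongrightarrow> lam *\<^sub>R x - (lam *\<^sub>R x - y)"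
    by (intro tendsto_intros lim w)
  then have "b \<longlonglongrightarrow> y" by (simp add: ab)
  with lim have "(\<lambda>n. (a n, b n)) \<longlonglongrightarrow> (x, y)" by (intro tendsto_intros)
  then show "z \<in> closure D" unfolding xy closure_sequential using ab(1) by (intro exI[of _ "\<lambda>n. (a n, b n)"]) auto
qed

text \<open>
  If \<open>\<psi>\<close> annihilates the range of \<open>lam - A\<close>, then \<open>\<psi> (T t f)\<close> solves the equation \<open>\<phi>' = lam * \<phi>\<close> and equals
  \<open>exp (lam * t) * \<psi> f\<close>. This is bounded in \<open>t\<close> only if \<open>\<psi> f = 0\<close>.
\<close>

lemma functional_vanishing_on_range:
  assumes \<psi>: "bounded_linear \<psi>" and lam: "0 < lam"
    and dense: "X \<subseteq> closure (Domain gen)"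
    and van: "\<And>x y. (x, y) \<in> gen \<Longrightarrow> \<psi> (lam *\<^sub>R x - y) = (0::real)"
    and x: "x \<in> X"
  shows "\<psi> x = 0"
proof -
  interpret \<psi>: bounded_linear \<psi> by fact
  have dom: "\<psi> f = 0" if fg: "(f, g) \<in> gen" for f g
  proof -
    have f: "f \<in> X" using fg by (auto simp: gen_def)
    have eq: "\<psi> f = exp (- lam * t) * \<psi> (T t f)" if t: "0 \<le> t" for t
    proof -
      define y where "y s = exp (- lam * s) * \<psi> (T s f)" for s
      have "y t = y 0"
      proof (rule right_derivative_zero_imp_eq[OF t])
        have "continuous_on {0..t} (\<lambda>s. T s f)"
          by (rule continuous_on_subset[OF continuous_on_orbit[OF f]]) auto
        from \<psi>.continuous_on[OF this] have c: "continuous_on {0..t} (\<lambda>s. \<psi> (T s f))" .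
        have "continuous_on {0..t} (\<lambda>s. exp (- lam * s))" by (intro continuous_intros)
        from continuous_on_mult[OF this c] show "continuous_on {0..t} y" unfolding y_def .
        fix s assume s: "0 \<le> s" "s < t"
        define z where "z = T s f"
        have z: "z \<in> X" "(z, T s g) \<in> gen" using gen_orbit[OF fg s(1)] f s by (auto simp: z_def maps)
        have lim1: "((\<lambda>h. \<psi> ((T h z - z) /\<^sub>R h)) \<longlongrightarrow> \<psi> (T s g)) (at_right 0)"
          by (rule \<psi>.tendsto) (use z in \<open>simp add: gen_def\<close>)
        have "((\<lambda>h. exp (- lam * h)) has_real_derivative - lam) (at 0 within {0<..})"
          by (auto intro!: derivative_eq_intros)
        then have lim2: "((\<lambda>h. (exp (- lam * h) - 1) / h) \<longlongrightarrow> - lam) (at_right 0)"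
          by (simp add: has_field_derivative_iff)
        have "((\<lambda>h. exp (- lam * h)) \<longlongrightarrow> exp (- lam * 0)) (at_right 0)" by (intro tendsto_intros)
        then have lim3: "((\<lambda>h. exp (- lam * h)) \<longlongrightarrow> 1) (at_right 0)" by simp
        have "((\<lambda>h. exp (- lam * s) * (exp (- lam * h) * \<psi> ((T h z - z) /\<^sub>R h) + ((exp (- lam * h) - 1) / h) * \<psi> z)) \<longlongrightarrow>
            exp (- lam * s) * (1 * \<psi> (T s g) + (- lam) * \<psi> z)) (at_right 0)"
          by (intro tendsto_intros lim1 lim2 lim3)
        moreover have "exp (- lam * s) * (1 * \<psi> (T s g) + (- lam) * \<psi> z) = 0"
          using van[OF z(2)] by (simp add: \<psi>.diff \<psi>.scaleR)
        moreover have "\<forall>\<^sub>F h in at_right 0. exp (- lam * s) * (exp (- lam * h) * \<psi> ((T h z - z) /\<^sub>R h) + ((exp (- lam * h) - 1) / h) * \<psi> z)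
            = (y (s + h) - y s) /\<^sub>R h"
          using eventually_at_right_less[of "0::real"]
        proof eventually_elim
          case (elim h)
          have "T (s + h) f = T h z" using T_add[of h s f] elim s f by (simp add: z_def add.commute)
          moreover have "exp (- lam * (s + h)) = exp (- lam * s) * exp (- lam * h)"
            by (simp add: algebra_simps flip: exp_add)
          ultimately have "y (s + h) = exp (- lam * s) * (exp (- lam * h) * \<psi> (T h z))" by (simp add: y_def)
          moreover have "y s = exp (- lam * s) * \<psi> z" by (simp add: y_def z_def)
          ultimately show ?case using elim
            by (simp add: \<psi>.diff \<psi>.scaleR) (simp add: field_simps)
        qed
        ultimately show "((\<lambda>h. (y (s + h) - y s) /\<^sub>R h) \<longlongrightarrow> 0) (at_right 0)"
          by (simp only: Lim_transform_eventually)
      qed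
      then show ?thesis using f by (simp add: y_def T_zero)
    qed
    obtain K where K: "K \<ge> 0" "\<And>x. norm (\<psi> x) \<le> norm x * K" using \<psi>.nonneg_bounded by blast
    have "\<bar>\<psi> f\<bar> \<le> exp (- lam * t) * (norm f * K)" if "0 \<le> t" for t
    proof -
      have "\<bar>\<psi> (T t f)\<bar> \<le> norm f * K"
        using K(2)[of "T t f"] contraction[OF that f] K(1) by (smt (verit) mult_right_mono real_norm_def)
      then show ?thesis using eq[OF that] by (simp add: abs_mult)
    qed
    then have "\<forall>\<^sub>F t in at_top. \<bar>\<psi> f\<bar> \<le> exp (- lam * t) * (norm f * K)"
      unfolding eventually_at_top_linorder by blast
    moreover have "((\<lambda>t. exp (- lam * t) * (norm f * K)) \<longlongrightarrow> 0) at_top"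
    proof -
      have "filterlim (\<lambda>t. - lam * t) at_bot at_top"
        using lam by (intro filterlim_tendsto_neg_mult_at_bot[OF tendsto_const _ filterlim_ident]) auto
      from filterlim_compose[OF exp_at_bot this] show ?thesis by (intro tendsto_mult_left_zero) simp
    qed
    ultimately have "\<bar>\<psi> f\<bar> \<le> 0" by (intro tendsto_lowerbound) auto
    then show ?thesis by simp
  qed
  have "closed (\<psi> -` {0})"
    by (intro closed_vimage continuous_intros \<psi>.continuous_on)
  moreover have "Domain gen \<subseteq> \<psi> -` {0}" using dom by auto
  ultimately have "closure (Domain gen) \<subseteq> \<psi> -` {0}" by (rule closure_minimal[rotated])
  then show ?thesis using dense x by auto
qed

end

text \<open>
  The semigroup generated by \<open>A + v \<otimes> \<psi>\<close>, where \<open>A\<close> generates \<open>T\<close>. By Duhamel's formula it has the form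
  \<open>pert\<close> below, with \<open>sol x s\<close> in the role of \<open>\<psi> (pert s x)\<close>. Applying \<open>\<psi>\<close> to the formula gives a scalar
  Volterra equation, so that no fixed point problem for vector-valued functions arises.
\<close>

locale rank_one_perturbation = contraction_semigroup_on X T for X :: "'b::banach set" and T +
  fixes v :: 'b and \<psi> :: "'b \<Rightarrow> real"
  assumes v: "v \<in> X" and \<psi>: "bounded_linear \<psi>"
begin

sublocale \<psi>: bounded_linear \<psi> by (rule \<psi>)

definition kernel where "kernel r = \<psi> (T r v)"

definition solves where
  "solves x g \<longleftrightarrow> continuous_on {0..} g \<and>
     (\<forall>t\<ge>0. g t = \<psi> (T t x) + integral {0..t} (\<lambda>s. kernel (t - s) * g s))"

text \<open>
  The exponential bound is part of the choice because it yields the boundedness of \<open>pert t\<close>.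
\<close>

definition sol where
  "sol x = (SOME g. solves x g \<and> (\<forall>t\<ge>0. \<bar>g t\<bar> \<le> 2 * (norm x * onorm \<psi>) * exp ((2 * (norm v * onorm \<psi>) + 1) * t)))"

definition pert where
  "pert t x = T t x + integral {0..t} (\<lambda>s. sol x s *\<^sub>R T (t - s) v)"

lemma orbit_bound: "x \<in> X \<Longrightarrow> 0 \<le> t \<Longrightarrow> \<bar>\<psi> (T t x)\<bar> \<le> norm x * onorm \<psi>"
  using onorm[OF \<psi>, of "T t x"] contraction[of t x] onorm_pos_le[OF \<psi>]
    mult_right_mono[of "norm (T t x)" "norm x" "onorm \<psi>"] by (simp add: mult.commute)

lemma continuous_on_functional_orbit: "x \<in> X \<Longrightarrow> continuous_on {0..} (\<lambda>t. \<psi> (T t x))"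
  by (intro \<psi>.continuous_on continuous_on_orbit)

lemma sol: assumes x: "x \<in> X"
  shows "solves x (sol x)"
    and "0 \<le> t \<Longrightarrow> \<bar>sol x t\<bar> \<le> 2 * (norm x * onorm \<psi>) * exp ((2 * (norm v * onorm \<psi>) + 1) * t)"
proof -
  have "\<exists>g. solves x g \<and> (\<forall>t\<ge>0. \<bar>g t\<bar> \<le> 2 * (norm x * onorm \<psi>) * exp ((2 * (norm v * onorm \<psi>) + 1) * t))"
    using volterra_exists[of kernel "norm v * onorm \<psi>" "\<lambda>t. \<psi> (T t x)" "norm x * onorm \<psi>"]
      continuous_on_functional_orbit[OF x] continuous_on_functional_orbit[OF v] orbit_bound[OF x] orbit_bound[OF v]
    by (auto simp: kernel_def solves_def)
  from someI_ex[OF this] show "solves x (sol x)"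
    and "0 \<le> t \<Longrightarrow> \<bar>sol x t\<bar> \<le> 2 * (norm x * onorm \<psi>) * exp ((2 * (norm v * onorm \<psi>) + 1) * t)"
    by (auto simp: sol_def)
qed

lemma sol_unique:
  assumes "solves x g" "x \<in> X" "0 \<le> t"
  shows "g t = sol x t"
  by (rule volterra_unique[of kernel "norm v * onorm \<psi>" g "\<lambda>t. \<psi> (T t x)" "sol x"])
    (use assms sol(1)[OF assms(2)] continuous_on_functional_orbit[OF v] orbit_bound[OF v] in
      \<open>auto simp: solves_def kernel_def\<close>)

lemma continuous_on_sol: "x \<in> X \<Longrightarrow> continuous_on {0..} (sol x)"
  using sol(1) by (simp add: solves_def)

text \<open>
  Times are clamped to the half line on which \<open>g\<close> and the orbits are known to be continuous.
\<close>

lemma conv_jointly_continuous: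
  assumes g: "continuous_on {0..} g"
  shows "continuous_on UNIV (\<lambda>(t, s). g (max s 0) *\<^sub>R T (max (t - s) 0) v)"
proof -
  have "continuous_on UNIV (\<lambda>z::real \<times> real. max (snd z) 0)" "continuous_on UNIV (\<lambda>z::real \<times> real. max (fst z - snd z) 0)"
    by (intro continuous_intros)+
  from continuous_on_compose2[OF g this(1)] continuous_on_compose2[OF continuous_on_orbit[OF v] this(2)]
  show ?thesis unfolding split_beta' by (intro continuous_on_scaleR) (simp_all add: image_subset_iff)
qed

lemma conv_eq: "integral {0..t} (\<lambda>s. g s *\<^sub>R T (t - s) v) = integral {0..t} (\<lambda>s. g (max s 0) *\<^sub>R T (max (t - s) 0) v)"
  by (rule integral_cong) auto

lemma conv_integrable:
  assumes g: "continuous_on {0..} g" and ab: "0 \<le> a" "b \<le> t"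
  shows "(\<lambda>s. g s *\<^sub>R T (t - s) v) integrable_on {a..b}"
  by (rule integrable_eq[OF integrable_upper[OF conv_jointly_continuous[OF g], of t]]) (use ab in auto)

lemma conv_mem:
  assumes g: "continuous_on {0..} g" and ab: "0 \<le> a" "b \<le> t"
  shows "integral {a..b} (\<lambda>s. g s *\<^sub>R T (t - s) v) \<in> X"
  by (rule has_integral_mem_closed_subspace[OF closed_X subspace_X _ integrable_integral[OF conv_integrable[OF assms]]])
    (use ab v in \<open>auto intro!: X_scale maps\<close>)

lemma T_conv:
  assumes g: "continuous_on {0..} g" and t: "0 \<le> t" "0 \<le> s"
  shows "T t (integral {0..s} (\<lambda>r. g r *\<^sub>R T (s - r) v)) = integral {0..s} (\<lambda>r. g r *\<^sub>R T (s + t - r) v)"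
proof -
  have "((\<lambda>r. T t (g r *\<^sub>R T (s - r) v)) has_integral T t (integral {0..s} (\<lambda>r. g r *\<^sub>R T (s - r) v))) {0..s}"
    using t v contraction[OF t(1)]
    by (intro has_integral_bounded_on_subspace[OF closed_X subspace_X _ _ _ integrable_integral[OF conv_integrable[OF g]], where C = 1])
      (auto intro!: X_scale maps lin)
  then have "T t (integral {0..s} (\<lambda>r. g r *\<^sub>R T (s - r) v)) = integral {0..s} (\<lambda>r. T t (g r *\<^sub>R T (s - r) v))"
    by (simp add: integral_unique)
  also have "\<dots> = integral {0..s} (\<lambda>r. g r *\<^sub>R T (s + t - r) v)"
  proof (rule integral_cong)
    fix r assume r: "r \<in> {0..s}"
    have "T (s + t - r) v = T t (T (s - r) v)" using T_add[of t "s - r" v] r t v by (simp add: algebra_simps)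
    then show "T t (g r *\<^sub>R T (s - r) v) = g r *\<^sub>R T (s + t - r) v" using r t v by (simp add: T_scale maps)
  qed
  finally show ?thesis .
qed

lemma \<psi>_conv:
  assumes g: "continuous_on {0..} g" and ab: "0 \<le> a" "b \<le> t"
  shows "\<psi> (integral {a..b} (\<lambda>s. g s *\<^sub>R T (t - s) v)) = integral {a..b} (\<lambda>s. kernel (t - s) * g s)"
  using integral_linear[OF conv_integrable[OF assms] \<psi>]
  by (simp add: o_def kernel_def \<psi>.scaleR mult.commute)

lemma pert_mem: "x \<in> X \<Longrightarrow> 0 \<le> t \<Longrightarrow> pert t x \<in> X"
  unfolding pert_def by (intro X_add maps conv_mem continuous_on_sol) auto

lemma \<psi>_pert: "x \<in> X \<Longrightarrow> 0 \<le> t \<Longrightarrow> \<psi> (pert t x) = sol x t"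
  unfolding pert_def \<psi>.add using sol(1)[of x] by (simp add: \<psi>_conv continuous_on_sol solves_def)

lemma kernel_integrable:
  assumes "continuous_on {0..} g" "0 \<le> a" "b \<le> t"
  shows "(\<lambda>s. kernel (t - s) * g s) integrable_on {a..b}"
  using integrable_linear[OF conv_integrable[OF assms] \<psi>]
  by (simp add: o_def kernel_def \<psi>.scaleR mult.commute)

lemma sol_lin:
  assumes "x \<in> X" "y \<in> X" "0 \<le> t"
  shows "sol (a *\<^sub>R x + b *\<^sub>R y) t = a * sol x t + b * sol y t"
proof -
  have "solves (a *\<^sub>R x + b *\<^sub>R y) (\<lambda>t. a * sol x t + b * sol y t)"
    unfolding solves_def
  proof (intro conjI allI impI)
    show "continuous_on {0..} (\<lambda>t. a * sol x t + b * sol y t)"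
      using assms by (intro continuous_intros continuous_on_sol)
    fix t :: real assume t: "0 \<le> t"
    have "integral {0..t} (\<lambda>s. kernel (t - s) * (a * sol x s + b * sol y s)) =
        integral {0..t} (\<lambda>s. a * (kernel (t - s) * sol x s) + b * (kernel (t - s) * sol y s))"
      by (simp add: algebra_simps)
    also have "\<dots> = a * integral {0..t} (\<lambda>s. kernel (t - s) * sol x s) + b * integral {0..t} (\<lambda>s. kernel (t - s) * sol y s)"
    proof -
      have "(\<lambda>s. a * (kernel (t - s) * sol x s)) integrable_on {0..t}" "(\<lambda>s. b * (kernel (t - s) * sol y s)) integrable_on {0..t}"
        using integrable_cmul[OF kernel_integrable[OF continuous_on_sol[OF assms(1)], of 0 t t], of a]
          integrable_cmul[OF kernel_integrable[OF continuous_on_sol[OF assms(2)], of 0 t t], of b] by simp_all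
      from integral_add[OF this] show ?thesis by simp
    qed
    finally show "a * sol x t + b * sol y t = \<psi> (T t (a *\<^sub>R x + b *\<^sub>R y)) +
        integral {0..t} (\<lambda>s. kernel (t - s) * (a * sol x s + b * sol y s))"
      using sol(1)[OF assms(1)] sol(1)[OF assms(2)] t assms
      by (simp add: solves_def lin \<psi>.add \<psi>.scaleR algebra_simps)
  qed
  from sol_unique[OF this X_add[OF X_scale X_scale, OF assms(1,2)] assms(3)] show ?thesis by simp
qed

lemma pert_lin:
  assumes "x \<in> X" "y \<in> X" "0 \<le> t"
  shows "pert t (a *\<^sub>R x + b *\<^sub>R y) = a *\<^sub>R pert t x + b *\<^sub>R pert t y"
proof -
  have "integral {0..t} (\<lambda>s. sol (a *\<^sub>R x + b *\<^sub>R y) s *\<^sub>R T (t - s) v) =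
      integral {0..t} (\<lambda>s. a *\<^sub>R (sol x s *\<^sub>R T (t - s) v) + b *\<^sub>R (sol y s *\<^sub>R T (t - s) v))"
    by (rule integral_cong) (use assms in \<open>simp add: sol_lin algebra_simps\<close>)
  also have "\<dots> = a *\<^sub>R integral {0..t} (\<lambda>s. sol x s *\<^sub>R T (t - s) v) + b *\<^sub>R integral {0..t} (\<lambda>s. sol y s *\<^sub>R T (t - s) v)"
    unfolding integral_cmul[symmetric]
    by (intro integral_add integrable_cmul conv_integrable continuous_on_sol assms) auto
  finally show ?thesis using assms by (simp add: pert_def lin algebra_simps)
qed

text \<open>
  Splitting Duhamel's integral at time \<open>s\<close> shows that \<open>r \<mapsto> sol x (s + r)\<close> solves the Volterra equation that
  belongs to the initial value \<open>pert s x\<close>. The semigroup law is then uniqueness for that equation.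
\<close>

lemma pert_shift:
  assumes x: "x \<in> X" and st: "0 \<le> s" "0 \<le> t"
  shows "pert (s + t) x = T t (pert s x) + integral {0..t} (\<lambda>r. sol x (s + r) *\<^sub>R T (t - r) v)"
proof -
  let ?F = "\<lambda>r. sol x r *\<^sub>R T (s + t - r) v"
  note c = continuous_on_sol[OF x]
  have int: "?F integrable_on {a..b}" if "0 \<le> a" "b \<le> s + t" for a b
    by (rule conv_integrable[OF c that])
  have "integral {0..s + t} ?F = integral {0..s} ?F + integral {s..s + t} ?F"
    using Henstock_Kurzweil_Integration.integral_combine[of 0 s "s + t" ?F] int[of 0 "s + t"] st by simp
  moreover have "integral {s..s + t} ?F = integral {0..t} (\<lambda>r. sol x (s + r) *\<^sub>R T (t - r) v)"
  proof -
    have "(?F has_integral integral {s..s + t} ?F) (cbox s (s + t))"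
      using integrable_integral[OF int[of s "s + t"]] st by (simp add: cbox_interval)
    from has_integral_affinity'[OF this, of 1 s]
    have "((\<lambda>r. ?F (r + s)) has_integral integral {s..s + t} ?F) {0..t}" by (simp add: cbox_interval)
    then have "integral {0..t} (\<lambda>r. ?F (r + s)) = integral {s..s + t} ?F" by (rule integral_unique)
    then show ?thesis by (simp add: algebra_simps)
  qed
  moreover have "T (s + t) x = T t (T s x)" using T_add[of t s x] x st by (simp add: add.commute)
  moreover have "T t (pert s x) = T t (T s x) + T t (integral {0..s} (\<lambda>r. sol x r *\<^sub>R T (s - r) v))"
    unfolding pert_def using lin[OF st(2) maps[OF st(1) x] conv_mem[OF c], of 0 s s 1 1] by simp
  ultimately show ?thesis using T_conv[OF c st(2,1)] by (simp add: pert_def)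
qed

lemma pert_add:
  assumes x: "x \<in> X" and st: "0 \<le> s" "0 \<le> t"
  shows "pert (s + t) x = pert t (pert s x)"
proof -
  let ?g = "\<lambda>r. sol x (s + r)"
  have c: "continuous_on {0..} ?g"
    by (rule continuous_on_compose2[OF continuous_on_sol[OF x]]) (use st in \<open>auto intro!: continuous_intros\<close>)
  have "solves (pert s x) ?g"
    unfolding solves_def
  proof (intro conjI allI impI c)
    fix r :: real assume r: "0 \<le> r"
    have "?g r = \<psi> (pert (s + r) x)" using r st x by (simp add: \<psi>_pert)
    also have "\<dots> = \<psi> (T r (pert s x)) + integral {0..r} (\<lambda>s'. kernel (r - s') * ?g s')"
      unfolding pert_shift[OF x st(1) r] \<psi>.add by (subst \<psi>_conv[OF c]) auto
    finally show "?g r = \<psi> (T r (pert s x)) + integral {0..r} (\<lambda>s'. kernel (r - s') * ?g s')" .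
  qed
  from sol_unique[OF this pert_mem[OF x st(1)]] have *: "0 \<le> r \<Longrightarrow> ?g r = sol (pert s x) r" for r .
  show ?thesis
    unfolding pert_shift[OF assms] pert_def[of t]
    by (intro arg_cong2[where f = "(+)"] integral_cong refl) (use * in auto)
qed

lemma pert_bound:
  assumes t: "0 \<le> t"
  shows "\<exists>C. \<forall>x\<in>X. norm (pert t x) \<le> C * norm x"
proof -
  define e where "e = exp ((2 * (norm v * onorm \<psi>) + 1) * t)"
  define C where "C = 1 + 2 * onorm \<psi> * e * norm v * t"
  have op: "0 \<le> onorm \<psi>" by (rule onorm_pos_le[OF \<psi>])
  have "norm (pert t x) \<le> C * norm x" if x: "x \<in> X" for x
  proof -
    have "norm (integral {0..t} (\<lambda>s. sol x s *\<^sub>R T (t - s) v)) \<le>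
        integral {0..t} (\<lambda>s. 2 * (norm x * onorm \<psi>) * e * norm v)"
    proof (rule integral_norm_bound_integral)
      fix s assume s: "s \<in> {0..t}"
      have "exp ((2 * (norm v * onorm \<psi>) + 1) * s) \<le> e"
        unfolding e_def using s op by (simp add: mult_left_mono)
      then have "2 * (norm x * onorm \<psi>) * exp ((2 * (norm v * onorm \<psi>) + 1) * s) \<le> 2 * (norm x * onorm \<psi>) * e"
        using op by (intro mult_left_mono) auto
      then have "\<bar>sol x s\<bar> \<le> 2 * (norm x * onorm \<psi>) * e" using sol(2)[OF x, of s] s by simp
      then show "norm (sol x s *\<^sub>R T (t - s) v) \<le> 2 * (norm x * onorm \<psi>) * e * norm v"
        using contraction[of "t - s" v] s v op unfolding norm_scaleR
        by (intro mult_mono) (auto simp: e_def)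
    qed (use conv_integrable[OF continuous_on_sol[OF x]] in auto)
    also have "\<dots> = 2 * (norm x * onorm \<psi>) * e * norm v * t" using t by simp
    finally have "norm (pert t x) \<le> norm x + 2 * (norm x * onorm \<psi>) * e * norm v * t"
      unfolding pert_def using contraction[OF t x] by (intro order_trans[OF norm_triangle_ineq]) simp
    then show ?thesis by (simp add: C_def algebra_simps)
  qed
  then show ?thesis by blast
qed

lemma pert_zero: "x \<in> X \<Longrightarrow> pert 0 x = x"
  by (simp add: pert_def T_zero)

lemma sol_zero: "x \<in> X \<Longrightarrow> sol x 0 = \<psi> x"
  using \<psi>_pert[of x 0] by (simp add: pert_zero)

lemma pert_cont:
  assumes x: "x \<in> X" shows "((\<lambda>t. pert t x) \<longlongrightarrow> x) (at_right 0)"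
proof -
  have "continuous_on {0..} (\<lambda>t. integral {0..t} (\<lambda>s. sol x s *\<^sub>R T (t - s) v))"
    unfolding conv_eq
    by (rule continuous_on_integral_upper[OF conv_jointly_continuous[OF continuous_on_sol[OF x]]])
  then have "((\<lambda>t. integral {0..t} (\<lambda>s. sol x s *\<^sub>R T (t - s) v)) \<longlongrightarrow> 0) (at 0 within {0..})"
    unfolding continuous_on_def by (drule_tac bspec[where x = 0]) auto
  then have "((\<lambda>t. integral {0..t} (\<lambda>s. sol x s *\<^sub>R T (t - s) v)) \<longlongrightarrow> 0) (at_right 0)"
    by (rule tendsto_within_subset) auto
  from tendsto_add[OF cont0[OF x] this] show ?thesis by (simp add: pert_def)
qed

sublocale pert: semigroup_on X pert
proof
  show "pert (s + t) x = pert s (pert t x)" if "0 \<le> s" "0 \<le> t" "x \<in> X" for s t x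
    using pert_add[OF that(3,2,1)] by (simp add: add.commute)
qed (simp_all add: closed_X subspace_X pert_mem pert_lin pert_bound pert_zero pert_cont)

lemma pert_gen:
  assumes "(x, y) \<in> gen"
  shows "(x, y + \<psi> x *\<^sub>R v) \<in> pert.gen"
proof -
  have xy: "x \<in> X" "y \<in> X" and lim: "((\<lambda>t. (T t x - x) /\<^sub>R t) \<longlongrightarrow> y) (at_right 0)"
    using assms by (auto simp: gen_def)
  have "((\<lambda>t. integral {0..t} (\<lambda>s. sol x s *\<^sub>R T (t - s) v) /\<^sub>R t) \<longlongrightarrow> \<psi> x *\<^sub>R v) (at_right 0)"
    using integral_upper_derivative_zero[OF conv_jointly_continuous[OF continuous_on_sol[OF xy(1)]]]
    unfolding conv_eq by (simp add: sol_zero xy T_zero v)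
  from tendsto_add[OF lim this]
  have "((\<lambda>t. (pert t x - x) /\<^sub>R t) \<longlongrightarrow> y + \<psi> x *\<^sub>R v) (at_right 0)"
    by (simp add: pert_def algebra_simps)
  then show ?thesis using xy v by (auto simp: pert.gen_def intro!: X_add X_scale)
qed

end

context contraction_semigroup_on
begin

text \<open>
  The perturbation \<open>B = A + u \<otimes> \<psi> (lam - A)\<close> is not bounded, but it is similar to a bounded one. With
  \<open>J = 1 - u \<otimes> \<psi>\<close> one has \<open>lam - B = J (lam - A)\<close>, which is conjugate by \<open>J\<close> to
  \<open>(lam - A) J = lam - (A + v \<otimes> \<psi>)\<close> where \<open>v = (lam - A) u\<close>. The operator \<open>J\<close> is invertible exactly
  when \<open>\<psi> u \<noteq> 1\<close>, with inverse \<open>J'\<close>.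
\<close>

lemma graph_perturbation:
  assumes \<psi>: "bounded_linear \<psi>" and u: "(u, u') \<in> gen" and nz: "\<psi> u \<noteq> (1::real)"
  shows "\<exists>S. semigroup_on X S \<and>
    (\<forall>x y. (x, y) \<in> gen \<longrightarrow> (x, y + \<psi> (lam *\<^sub>R x - y) *\<^sub>R u) \<in> semigroup_on.gen X S)"
proof -
  have uX: "u \<in> X" "u' \<in> X" using u by (auto simp: gen_def)
  define v where "v = lam *\<^sub>R u - u'"
  interpret rank_one_perturbation X T v \<psi>
    by (intro rank_one_perturbation.intro rank_one_perturbation_axioms.intro contraction_semigroup_on_axioms \<psi>)
      (use uX in \<open>auto simp: v_def intro!: X_diff X_scale\<close>)
  define c where "c = 1 / (1 - \<psi> u)"
  have c: "c * \<psi> u = c - 1" using nz by (simp add: c_def field_simps)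
  define J where "J x = x - \<psi> x *\<^sub>R u" for x
  define J' where "J' x = x + (c * \<psi> x) *\<^sub>R u" for x
  have JJ': "J (J' x) = x" and J'J: "J' (J x) = x" for x
  proof -
    have "\<psi> (J' x) = \<psi> x + (c * \<psi> u) * \<psi> x"
      by (simp add: J'_def \<psi>.add \<psi>.scaleR)
    then have "\<psi> (J' x) = c * \<psi> x" unfolding c by (simp add: algebra_simps)
    then show "J (J' x) = x" by (simp add: J_def) (simp add: J'_def)
    have "c * \<psi> (J x) = c * \<psi> x - \<psi> x * (c * \<psi> u)"
      by (simp add: J_def \<psi>.diff \<psi>.scaleR algebra_simps)
    then have "c * \<psi> (J x) = \<psi> x" unfolding c by (simp add: algebra_simps)
    then show "J' (J x) = x" by (simp add: J'_def) (simp add: J_def)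
  qed
  have JX: "x \<in> X \<Longrightarrow> J x \<in> X" "x \<in> X \<Longrightarrow> J' x \<in> X" for x
    using uX by (auto simp: J_def J'_def intro!: X_diff X_add X_scale)
  have blJ: "bounded_linear J" unfolding J_def
    by (intro bounded_linear_sub bounded_linear_ident bounded_linear_scaleR_const \<psi>)
  have blJ': "bounded_linear J'" unfolding J'_def
    by (intro bounded_linear_add bounded_linear_ident bounded_linear_scaleR_const bounded_linear_const_mult \<psi>)
  interpret J: bounded_linear J by (rule blJ)
  interpret J': bounded_linear J' by (rule blJ')
  define S where "S t x = J (pert t (J' x))" for t x
  interpret S: semigroup_on X S
  proof
    show "closed X" "subspace X" by (rule closed_X subspace_X)+
    fix s t :: real and x y assume x: "x \<in> X"
    show "S t x \<in> X" if "0 \<le> t" using x that by (simp add: S_def JX pert_mem)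
    show "S t (a *\<^sub>R x + b *\<^sub>R y) = a *\<^sub>R S t x + b *\<^sub>R S t y" if "0 \<le> t" "y \<in> X" for a b
      using that x by (simp add: S_def J'.add J'.scaleR JX pert_lin J.add J.scaleR)
    show "S 0 x = x" using x by (simp add: S_def pert_zero JX JJ')
    show "S (s + t) x = S s (S t x)" if "0 \<le> s" "0 \<le> t"
      using that x by (simp add: S_def J'J JX pert.T_add)
    show "((\<lambda>t. S t x) \<longlongrightarrow> x) (at_right 0)"
      using J.tendsto[OF pert_cont[of "J' x"]] x by (simp add: S_def JX JJ')
  next
    fix t :: real assume t: "0 \<le> t"
    obtain C where C: "\<And>x. x \<in> X \<Longrightarrow> norm (pert t x) \<le> C * norm x" using pert_bound[OF t] by blast
    obtain K where K: "K \<ge> 0" "\<And>x. norm (J x) \<le> norm x * K" using J.nonneg_bounded by blast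
    obtain K' where K': "K' \<ge> 0" "\<And>x. norm (J' x) \<le> norm x * K'" using J'.nonneg_bounded by blast
    have "norm (S t x) \<le> (\<bar>C\<bar> * K' * K) * norm x" if x: "x \<in> X" for x
    proof -
      have "norm (S t x) \<le> norm (pert t (J' x)) * K" unfolding S_def by (rule K)
      also have "norm (pert t (J' x)) \<le> \<bar>C\<bar> * norm (J' x)"
        using C[OF JX(2)[OF x]] by (smt (verit) mult_right_mono norm_ge_zero)
      also have "\<bar>C\<bar> * norm (J' x) \<le> \<bar>C\<bar> * (norm x * K')" by (intro mult_left_mono K') auto
      finally show ?thesis using K by (simp add: mult_ac mult_right_mono)
    qed
    then show "\<exists>C. \<forall>x\<in>X. norm (S t x) \<le> C * norm x" by blast
  qed
  have "(x, y + \<psi> (lam *\<^sub>R x - y) *\<^sub>R u) \<in> S.gen" if xy: "(x, y) \<in> gen" for x y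
  proof -
    have X: "x \<in> X" "y \<in> X" using xy by (auto simp: gen_def)
    have "(J' x, y + (c * \<psi> x) *\<^sub>R u') \<in> gen"
      using gen_comb[OF xy u, of 1 "c * \<psi> x"] by (simp add: J'_def)
    from pert_gen[OF this] obtain z where z: "z = y + (c * \<psi> x) *\<^sub>R u' + \<psi> (J' x) *\<^sub>R v" "(J' x, z) \<in> pert.gen"
      by blast
    have "\<psi> (J' x) = \<psi> x + (c * \<psi> u) * \<psi> x"
      by (simp add: J'_def \<psi>.add \<psi>.scaleR)
    then have "\<psi> (J' x) = c * \<psi> x" unfolding c by (simp add: algebra_simps)
    then have "z = y + (c * lam * \<psi> x) *\<^sub>R u" by (simp add: z v_def algebra_simps)
    moreover have "J u = (1 - \<psi> u) *\<^sub>R u" by (simp add: J_def algebra_simps)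
    moreover have "c * (1 - \<psi> u) = 1" using c by (simp add: algebra_simps)
    ultimately have Jz: "J z = y + \<psi> (lam *\<^sub>R x - y) *\<^sub>R u"
    proof -
      assume a: "z = y + (c * lam * \<psi> x) *\<^sub>R u" "J u = (1 - \<psi> u) *\<^sub>R u" "c * (1 - \<psi> u) = 1"
      have "J z = J y + ((c * (1 - \<psi> u)) * (lam * \<psi> x)) *\<^sub>R u"
        unfolding a(1) J.add J.scaleR a(2) by (simp add: mult_ac)
      then show ?thesis unfolding a(3) by (simp add: J_def \<psi>.diff \<psi>.scaleR algebra_simps)
    qed
    have "((\<lambda>t. J ((pert t (J' x) - J' x) /\<^sub>R t)) \<longlongrightarrow> J z) (at_right 0)"
      by (rule J.tendsto) (use z in \<open>simp add: pert.gen_def\<close>)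
    then have "((\<lambda>t. (S t x - x) /\<^sub>R t) \<longlongrightarrow> J z) (at_right 0)"
      by (simp add: S_def J.scaleR J.diff JJ')
    then show ?thesis using X uX unfolding Jz S.gen_def by (auto intro!: X_add X_scale)
  qed
  then show ?thesis using S.semigroup_on_axioms by blast
qed

text \<open>
  If the range of \<open>lam - A\<close> on \<open>D\<close> were not dense, a nonzero functional \<open>\<psi>\<close> would vanish on it. Then
  \<open>A + u \<otimes> \<psi> (lam - A)\<close> would be another generator that extends \<open>D\<close>, and it differs from \<open>A\<close> because \<open>\<psi>\<close>
  cannot vanish on the whole range of \<open>lam - A\<close>.
\<close>

theorem unique_extension_imp_dense_range:
  assumes lam: "0 < lam" and dense: "X \<subseteq> closure (Domain gen)"
    and D: "subspace D" "D \<subseteq> gen"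
    and uniq: "\<And>S t x. semigroup_on X S \<Longrightarrow> D \<subseteq> semigroup_on.gen X S \<Longrightarrow> 0 \<le> t \<Longrightarrow> x \<in> X \<Longrightarrow> S t x = T t x"
  shows "X \<subseteq> closure ((\<lambda>(x, y). lam *\<^sub>R x - y) ` D)"
proof (rule ccontr)
  let ?W = "(\<lambda>(x, y). lam *\<^sub>R x - y) ` D"
  assume "\<not> ?thesis"
  then obtain x0 where x0: "x0 \<in> X" "x0 \<notin> closure ?W" by blast
  have "linear (\<lambda>(x, y). lam *\<^sub>R x - (y :: 'a))"
    by (rule linearI) (auto simp: scaleR_add_right scaleR_diff_right)
  then have "subspace ?W" by (rule linear_subspace_image[OF _ D(1)])
  then obtain \<psi> where \<psi>: "bounded_linear \<psi>" "\<And>w. w \<in> ?W \<Longrightarrow> \<psi> w = 0" "\<psi> x0 = (1::real)"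
    using hahn_banach_separation[OF _ x0(2)] by blast
  interpret \<psi>: bounded_linear \<psi> by fact
  obtain x y where xy: "(x, y) \<in> gen" "\<psi> (lam *\<^sub>R x - y) \<noteq> 0"
    using functional_vanishing_on_range[OF \<psi>(1) lam dense _ x0(1)] \<psi>(3) by auto
  have "x \<noteq> 0"
  proof
    assume "x = 0"
    moreover have "(0, 0) \<in> gen" using gen_comb[OF xy(1) xy(1), of 0 0] by simp
    ultimately have "y = 0" using xy gen_unique by blast
    then show False using xy \<open>x = 0\<close> \<psi>.zero by simp
  qed
  \<comment> \<open>Rescaling \<open>x\<close> avoids the excluded value \<open>1\<close>.\<close>
  obtain r :: real where r: "r \<noteq> 0" "\<psi> (r *\<^sub>R x) \<noteq> 1"
  proof (cases "\<psi> x = 1")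
    case True then show ?thesis using that[of 2] by (simp add: \<psi>.scaleR)
  next
    case False then show ?thesis using that[of 1] by simp
  qed
  have "(r *\<^sub>R x, r *\<^sub>R y) \<in> gen" using gen_comb[OF xy(1) xy(1), of r 0] by simp
  from graph_perturbation[OF \<psi>(1) this r(2), of lam] obtain S where S: "semigroup_on X S"
    and gS: "\<And>a b. (a, b) \<in> gen \<Longrightarrow> (a, b + \<psi> (lam *\<^sub>R a - b) *\<^sub>R r *\<^sub>R x) \<in> semigroup_on.gen X S"
    by blast
  interpret S: semigroup_on X S by fact
  have "D \<subseteq> S.gen"
  proof
    fix z assume z: "z \<in> D"
    obtain a b where ab: "z = (a, b)" by force
    then have "\<psi> (lam *\<^sub>R a - b) = 0" using z by (intro \<psi>(2)) force
    then show "z \<in> S.gen" using gS[of a b] z D ab by auto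
  qed
  then have eq: "S t z = T t z" if "0 \<le> t" "z \<in> X" for t z using uniq[OF S] that by blast
  have "S.gen \<subseteq> gen"
  proof
    fix z assume "z \<in> S.gen"
    then obtain a b where ab: "z = (a, b)" "a \<in> X" "b \<in> X" "((\<lambda>t. (S t a - a) /\<^sub>R t) \<longlongrightarrow> b) (at_right 0)"
      by (auto simp: S.gen_def)
    have "\<forall>\<^sub>F t in at_right 0. (S t a - a) /\<^sub>R t = (T t a - a) /\<^sub>R t"
      using eventually_at_right_less[of "0::real"] by eventually_elim (simp add: eq ab)
    with ab(4) have "((\<lambda>t. (T t a - a) /\<^sub>R t) \<longlongrightarrow> b) (at_right 0)" by (rule Lim_transform_eventually)
    then show "z \<in> gen" using ab by (simp add: gen_def)
  qed
  then have "(x, y + \<psi> (lam *\<^sub>R x - y) *\<^sub>R r *\<^sub>R x) \<in> gen" using gS[OF xy(1)] by blast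
  from gen_unique[OF xy(1) this] have "\<psi> (lam *\<^sub>R x - y) *\<^sub>R r *\<^sub>R x = 0"
    by (simp only: add_cancel_right_right)
  then show False using xy r \<open>x \<noteq> 0\<close> by simp
qed

end

section \<open>The spaces of p-integrable functions\<close>

lemma Lp_spaceD: "f \<in> Lp_space \<mu> p \<Longrightarrow> f \<in> borel_measurable \<mu>"
  "f \<in> Lp_space \<mu> p \<Longrightarrow> integrable \<mu> (\<lambda>x. \<bar>f x\<bar> powr p)"
  by (auto simp: Lp_space_def)

lemma Lp_norm_nonneg [simp]: "0 \<le> Lp_norm \<mu> p f"
  by (simp add: Lp_norm_def)

lemma Lp_norm_powr: "p > 0 \<Longrightarrow> Lp_norm \<mu> p f powr p = (\<integral>x. \<bar>f x\<bar> powr p \<partial>\<mu>)"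
  by (simp add: Lp_norm_def powr_powr integral_nonneg_AE)

lemma Lp_norm_leI:
  assumes "p > 0" "0 \<le> c" "(\<integral>x. \<bar>f x\<bar> powr p \<partial>\<mu>) \<le> c powr p"
  shows "Lp_norm \<mu> p f \<le> c"
proof -
  have "Lp_norm \<mu> p f \<le> (c powr p) powr (1 / p)"
    unfolding Lp_norm_def using assms by (intro powr_mono2) (auto intro!: integral_nonneg_AE)
  then show ?thesis using assms by (simp add: powr_powr)
qed

lemma Lp_norm_cong_AE:
  assumes "f \<in> borel_measurable \<mu>" "g \<in> borel_measurable \<mu>" "AE x in \<mu>. f x = g x"
  shows "Lp_norm \<mu> p f = Lp_norm \<mu> p g"
proof -
  have "(\<integral>x. \<bar>f x\<bar> powr p \<partial>\<mu>) = (\<integral>x. \<bar>g x\<bar> powr p \<partial>\<mu>)"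
    using assms by (intro integral_cong_AE) auto
  then show ?thesis by (simp add: Lp_norm_def)
qed

lemma Lp_dominated:
  assumes p: "p > 0" and f: "f \<in> borel_measurable \<mu>" and g: "g \<in> Lp_space \<mu> p"
    and le: "AE x in \<mu>. \<bar>f x\<bar> \<le> \<bar>g x\<bar>"
  shows "f \<in> Lp_space \<mu> p" "Lp_norm \<mu> p f \<le> Lp_norm \<mu> p g"
proof -
  note [measurable] = f
  have le': "AE x in \<mu>. \<bar>f x\<bar> powr p \<le> \<bar>g x\<bar> powr p"
    using le by eventually_elim (use p in \<open>auto intro: powr_mono2\<close>)
  have int: "integrable \<mu> (\<lambda>x. \<bar>f x\<bar> powr p)"
    by (rule Bochner_Integration.integrable_bound[OF Lp_spaceD(2)[OF g]]) (use le' in auto)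
  then show "f \<in> Lp_space \<mu> p" using f by (simp add: Lp_space_def)
  have "(\<integral>x. \<bar>f x\<bar> powr p \<partial>\<mu>) \<le> (\<integral>x. \<bar>g x\<bar> powr p \<partial>\<mu>)"
    by (rule integral_mono_AE[OF int Lp_spaceD(2)[OF g] le'])
  then show "Lp_norm \<mu> p f \<le> Lp_norm \<mu> p g"
    unfolding Lp_norm_def using p by (intro powr_mono2) (auto intro!: integral_nonneg_AE)
qed

lemma Lp_space_AE_cong:
  assumes "f \<in> Lp_space \<mu> p" "g \<in> borel_measurable \<mu>" "AE x in \<mu>. f x = g x"
  shows "g \<in> Lp_space \<mu> p"
proof -
  note [measurable] = assms(2) Lp_spaceD(1)[OF assms(1)]
  have "integrable \<mu> (\<lambda>x. \<bar>g x\<bar> powr p)"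
    by (rule integrable_cong_AE_imp[OF Lp_spaceD(2)[OF assms(1)]]) (use assms(3) in auto)
  then show ?thesis using assms(2) by (simp add: Lp_space_def)
qed

lemma Lp_scale:
  assumes p: "p > 0" and f: "f \<in> Lp_space \<mu> p"
  shows "(\<lambda>x. c * f x) \<in> Lp_space \<mu> p" "Lp_norm \<mu> p (\<lambda>x. c * f x) = \<bar>c\<bar> * Lp_norm \<mu> p f"
proof -
  show "(\<lambda>x. c * f x) \<in> Lp_space \<mu> p"
    using Lp_spaceD[OF f] by (auto simp: Lp_space_def abs_mult powr_mult)
  show "Lp_norm \<mu> p (\<lambda>x. c * f x) = \<bar>c\<bar> * Lp_norm \<mu> p f"
    using p by (simp add: Lp_norm_def abs_mult powr_mult powr_powr)
qed

lemma Lp_zero: "p > 0 \<Longrightarrow> (\<lambda>x. 0) \<in> Lp_space \<mu> p" "p > 0 \<Longrightarrow> Lp_norm \<mu> p (\<lambda>x. 0) = 0"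
  by (auto simp: Lp_space_def Lp_norm_def)

lemma powr_convex_combination_le:
  fixes x y t p :: real
  assumes p: "1 \<le> p" and xy: "0 \<le> x" "0 \<le> y" and t: "0 \<le> t" "t \<le> 1"
  shows "((1 - t) * x + t * y) powr p \<le> (1 - t) * x powr p + t * y powr p"
proof -
  have le: "(s * z) powr p \<le> s * z powr p" if "0 \<le> s" "s \<le> 1" for s z :: real
  proof -
    have "s powr p \<le> s"
      using that p powr_mono'[of 1 p s] by (cases "s = 0") auto
    then show ?thesis by (simp add: powr_mult mult_right_mono)
  qed
  consider "x = 0" | "y = 0" | "x > 0" "y > 0" using xy by linarith
  then show ?thesis
  proof cases
    case 3
    then show ?thesis using convex_onD[OF powr_convex[OF p], of t x y] t by simp
  qed (use le[of t y] le[of "1 - t" x] t in auto)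
qed

lemma Lp_add_space:
  assumes p: "1 \<le> p" and f: "f \<in> Lp_space \<mu> p" and g: "g \<in> Lp_space \<mu> p"
  shows "(\<lambda>x. f x + g x) \<in> Lp_space \<mu> p"
proof -
  note [measurable] = Lp_spaceD(1)[OF f] Lp_spaceD(1)[OF g]
  have "\<bar>f x + g x\<bar> powr p \<le> 2 powr p * (1/2 * \<bar>f x\<bar> powr p + 1/2 * \<bar>g x\<bar> powr p)" for x
  proof -
    have "\<bar>f x + g x\<bar> powr p \<le> (2 * ((1 - 1/2) * \<bar>f x\<bar> + 1/2 * \<bar>g x\<bar>)) powr p"
      using p by (intro powr_mono2) auto
    also have "\<dots> = 2 powr p * ((1 - 1/2) * \<bar>f x\<bar> + 1/2 * \<bar>g x\<bar>) powr p" by (rule powr_mult)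
    also have "\<dots> \<le> 2 powr p * ((1 - 1/2) * \<bar>f x\<bar> powr p + 1/2 * \<bar>g x\<bar> powr p)"
      by (intro mult_left_mono powr_convex_combination_le p) auto
    finally show ?thesis by simp
  qed
  then have "integrable \<mu> (\<lambda>x. \<bar>f x + g x\<bar> powr p)"
    by (intro Bochner_Integration.integrable_bound[where g = "\<lambda>x. \<bar>f x + g x\<bar> powr p" and
          f = "\<lambda>x. 2 powr p * (1/2 * \<bar>f x\<bar> powr p + 1/2 * \<bar>g x\<bar> powr p)"])
      (auto intro!: Lp_spaceD(2)[OF f] Lp_spaceD(2)[OF g] integrable_mult_right Bochner_Integration.integrable_add)
  then show ?thesis by (simp add: Lp_space_def)
qed

lemma Lp_norm_eq_0_iff:
  assumes p: "p > 0" and f: "f \<in> Lp_space \<mu> p"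
  shows "Lp_norm \<mu> p f = 0 \<longleftrightarrow> (AE x in \<mu>. f x = 0)"
proof -
  have "Lp_norm \<mu> p f = 0 \<longleftrightarrow> (\<integral>x. \<bar>f x\<bar> powr p \<partial>\<mu>) = 0" by (simp add: Lp_norm_def)
  also have "\<dots> \<longleftrightarrow> (AE x in \<mu>. \<bar>f x\<bar> powr p = 0)"
    by (rule integral_nonneg_eq_0_iff_AE[OF Lp_spaceD(2)[OF f]]) auto
  finally show ?thesis by simp
qed

text \<open>
  Convexity of \<open>t \<mapsto> t powr p\<close>, applied to the normalised functions \<open>\<bar>f\<bar> / a\<close> and \<open>\<bar>g\<bar> / b\<close> with the weights
  \<open>a / (a + b)\<close> and \<open>b / (a + b)\<close>, and integrated.
\<close>

lemma Lp_norm_triangle: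
  assumes p: "1 \<le> p" and f: "f \<in> Lp_space \<mu> p" and g: "g \<in> Lp_space \<mu> p"
  shows "Lp_norm \<mu> p (\<lambda>x. f x + g x) \<le> Lp_norm \<mu> p f + Lp_norm \<mu> p g"
proof -
  have p0: "p > 0" using p by simp
  note [measurable] = Lp_spaceD(1)[OF f] Lp_spaceD(1)[OF g]
  define a b where "a = Lp_norm \<mu> p f" and "b = Lp_norm \<mu> p g"
  have ab: "0 \<le> a" "0 \<le> b" by (auto simp: a_def b_def)
  consider "a = 0" | "b = 0" | "a > 0" "b > 0" using ab by linarith
  then show ?thesis
  proof cases
    case 1
    then have "AE x in \<mu>. f x = 0" using Lp_norm_eq_0_iff[OF p0 f] by (simp add: a_def)
    then have "AE x in \<mu>. f x + g x = g x" by eventually_elim simp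
    then have "Lp_norm \<mu> p (\<lambda>x. f x + g x) = Lp_norm \<mu> p g" by (intro Lp_norm_cong_AE) auto
    then show ?thesis by simp
  next
    case 2
    then have "AE x in \<mu>. g x = 0" using Lp_norm_eq_0_iff[OF p0 g] by (simp add: b_def)
    then have "AE x in \<mu>. f x + g x = f x" by eventually_elim simp
    then have "Lp_norm \<mu> p (\<lambda>x. f x + g x) = Lp_norm \<mu> p f" by (intro Lp_norm_cong_AE) auto
    then show ?thesis by simp
  next
    case 3
    define t where "t = b / (a + b)"
    have t: "0 \<le> t" "t \<le> 1" "1 - t = a / (a + b)" using 3 by (auto simp: t_def field_simps)
    let ?R = "\<lambda>x. (a + b) powr p * ((1 - t) * (\<bar>f x\<bar> powr p / a powr p) + t * (\<bar>g x\<bar> powr p / b powr p))"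
    have pw: "\<bar>f x + g x\<bar> powr p \<le> ?R x" for x
    proof -
      have "\<bar>f x + g x\<bar> \<le> (a + b) * ((1 - t) * (\<bar>f x\<bar> / a) + t * (\<bar>g x\<bar> / b))"
        unfolding t(3) unfolding t_def using 3 by (simp add: distrib_left)
      then have "\<bar>f x + g x\<bar> powr p \<le> ((a + b) * ((1 - t) * (\<bar>f x\<bar> / a) + t * (\<bar>g x\<bar> / b))) powr p"
        using p by (intro powr_mono2) auto
      also have "\<dots> = (a + b) powr p * ((1 - t) * (\<bar>f x\<bar> / a) + t * (\<bar>g x\<bar> / b)) powr p"
        by (rule powr_mult)
      also have "\<dots> \<le> (a + b) powr p * ((1 - t) * (\<bar>f x\<bar> / a) powr p + t * (\<bar>g x\<bar> / b) powr p)"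
        using 3 t by (intro mult_left_mono powr_convex_combination_le p) auto
      finally show ?thesis by (simp add: powr_divide)
    qed
    have intf: "integrable \<mu> (\<lambda>x. \<bar>f x\<bar> powr p)" and intg: "integrable \<mu> (\<lambda>x. \<bar>g x\<bar> powr p)"
      using f g by (auto dest: Lp_spaceD)
    have "(\<integral>x. \<bar>f x + g x\<bar> powr p \<partial>\<mu>) \<le> (\<integral>x. ?R x \<partial>\<mu>)"
      using pw intf intg Lp_spaceD(2)[OF Lp_add_space[OF p f g]] by (intro integral_mono) auto
    also have "\<dots> = (a + b) powr p * ((1 - t) * ((\<integral>x. \<bar>f x\<bar> powr p \<partial>\<mu>) / a powr p) + t * ((\<integral>x. \<bar>g x\<bar> powr p \<partial>\<mu>) / b powr p))"
      using intf intg by simp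
    also have "\<dots> = (a + b) powr p"
      using 3 by (simp add: a_def[symmetric] b_def[symmetric] Lp_norm_powr[OF p0, symmetric])
    finally have "Lp_norm \<mu> p (\<lambda>x. f x + g x) \<le> a + b" using ab p0 by (intro Lp_norm_leI) auto
    then show ?thesis by (simp add: a_def b_def)
  qed
qed

lemma Lp_lin:
  assumes p: "1 \<le> p" and f: "f \<in> Lp_space \<mu> p" and g: "g \<in> Lp_space \<mu> p"
  shows "(\<lambda>x. a * f x + b * g x) \<in> Lp_space \<mu> p"
  using assms by (intro Lp_add_space Lp_scale) auto

lemma Lp_diff_space:
  assumes "1 \<le> p" "f \<in> Lp_space \<mu> p" "g \<in> Lp_space \<mu> p"
  shows "(\<lambda>x. f x - g x) \<in> Lp_space \<mu> p"
  using Lp_lin[OF assms, of 1 "- 1"] by simp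

lemma Lp_norm_minus_commute: "Lp_norm \<mu> p (\<lambda>x. f x - g x) = Lp_norm \<mu> p (\<lambda>x. g x - f x)"
  by (simp add: Lp_norm_def abs_minus_commute)

lemma Lp_norm_triangle_diff:
  assumes "1 \<le> p" "f \<in> Lp_space \<mu> p" "g \<in> Lp_space \<mu> p" "h \<in> Lp_space \<mu> p"
  shows "Lp_norm \<mu> p (\<lambda>x. f x - h x) \<le> Lp_norm \<mu> p (\<lambda>x. f x - g x) + Lp_norm \<mu> p (\<lambda>x. g x - h x)"
  using Lp_norm_triangle[OF assms(1) Lp_diff_space[OF assms(1,2,3)] Lp_diff_space[OF assms(1,3,4)]] by simp

lemma Hoelder:
  assumes p: "1 < p" and pq: "1 / p + 1 / q = 1"
    and f: "f \<in> Lp_space \<mu> p" and g: "g \<in> Lp_space \<mu> q"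
  shows "integrable \<mu> (\<lambda>x. f x * g x)" "\<bar>\<integral>x. f x * g x \<partial>\<mu>\<bar> \<le> Lp_norm \<mu> p f * Lp_norm \<mu> q g"
proof -
  have q: "1 < q"
  proof -
    have "1 / q = 1 - 1 / p" using pq by simp
    then have "0 < 1 / q" "1 / q < 1" using p by auto
    then show ?thesis by (simp add: divide_less_eq split: if_splits)
  qed
  have p0: "p > 0" and q0: "q > 0" using p q by auto
  note [measurable] = Lp_spaceD(1)[OF f] Lp_spaceD(1)[OF g]
  note int = Lp_spaceD(2)[OF f] Lp_spaceD(2)[OF g]
  have young: "\<bar>f x * g x\<bar> \<le> \<bar>f x\<bar> powr p / p + \<bar>g x\<bar> powr q / q" for x
    using Youngs_inequality[OF p q pq, of "\<bar>f x\<bar>" "\<bar>g x\<bar>"] by (simp add: abs_mult)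
  have "0 \<le> \<bar>f x\<bar> powr p / p + \<bar>g x\<bar> powr q / q" for x using p0 q0 by simp
  then show I: "integrable \<mu> (\<lambda>x. f x * g x)"
    by (intro Bochner_Integration.integrable_bound[where f = "\<lambda>x. \<bar>f x\<bar> powr p / p + \<bar>g x\<bar> powr q / q" and g = "\<lambda>x. f x * g x"])
      (use int young in auto)
  define a b where "a = Lp_norm \<mu> p f" and "b = Lp_norm \<mu> q g"
  have ab: "0 \<le> a" "0 \<le> b" by (auto simp: a_def b_def)
  show "\<bar>\<integral>x. f x * g x \<partial>\<mu>\<bar> \<le> Lp_norm \<mu> p f * Lp_norm \<mu> q g"
  proof (cases "a = 0 \<or> b = 0")
    case True
    then have "(AE x in \<mu>. f x = 0) \<or> (AE x in \<mu>. g x = 0)"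
      using Lp_norm_eq_0_iff[OF p0 f] Lp_norm_eq_0_iff[OF q0 g] by (auto simp: a_def b_def)
    then have "AE x in \<mu>. f x * g x = 0" by (auto elim: eventually_mono)
    then have "(\<integral>x. f x * g x \<partial>\<mu>) = (\<integral>x. 0 \<partial>\<mu>)" by (intro integral_cong_AE) auto
    then show ?thesis by simp
  next
    case False
    then have ab: "a > 0" "b > 0" using ab by auto
    have yp: "\<bar>f x * g x\<bar> \<le> (a * b) * ((\<bar>f x\<bar> powr p / a powr p) / p + (\<bar>g x\<bar> powr q / b powr q) / q)" for x
    proof -
      have "(\<bar>f x\<bar> / a) * (\<bar>g x\<bar> / b) \<le> (\<bar>f x\<bar> / a) powr p / p + (\<bar>g x\<bar> / b) powr q / q"
        using Youngs_inequality[OF p q pq, of "\<bar>f x\<bar> / a" "\<bar>g x\<bar> / b"] ab by simp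
      then have "(a * b) * ((\<bar>f x\<bar> / a) * (\<bar>g x\<bar> / b)) \<le> (a * b) * ((\<bar>f x\<bar> / a) powr p / p + (\<bar>g x\<bar> / b) powr q / q)"
        using ab by (intro mult_left_mono) auto
      then show ?thesis using ab by (simp add: powr_divide abs_mult)
    qed
    have "\<bar>\<integral>x. f x * g x \<partial>\<mu>\<bar> \<le> (\<integral>x. \<bar>f x * g x\<bar> \<partial>\<mu>)" by (rule integral_abs_bound)
    also have "\<dots> \<le> (\<integral>x. (a * b) * ((\<bar>f x\<bar> powr p / a powr p) / p + (\<bar>g x\<bar> powr q / b powr q) / q) \<partial>\<mu>)"
      using yp int I by (intro integral_mono) auto
    also have "\<dots> = (a * b) * (((\<integral>x. \<bar>f x\<bar> powr p \<partial>\<mu>) / a powr p) / p + ((\<integral>x. \<bar>g x\<bar> powr q \<partial>\<mu>) / b powr q) / q)"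
      using int by simp
    also have "\<dots> = a * b * (1 / p + 1 / q)"
      using ab by (simp add: a_def[symmetric] b_def[symmetric] Lp_norm_powr[OF p0, symmetric] Lp_norm_powr[OF q0, symmetric])
    finally show ?thesis unfolding pq by (simp add: a_def b_def)
  qed
qed

text \<open>
  The case of equality in Hoelder's inequality. It provides the norming functionals of \<open>L\<^sup>p\<close>.
\<close>

lemma Lp_dual_element:
  assumes p: "1 < p" and pq: "1 / p + 1 / q = 1" and f: "f \<in> Lp_space \<mu> p"
  defines "h \<equiv> \<lambda>x. sgn (f x) * \<bar>f x\<bar> powr (p - 1)"
  shows "h \<in> Lp_space \<mu> q" "(\<integral>x. f x * h x \<partial>\<mu>) = Lp_norm \<mu> p f powr p"
    "Lp_norm \<mu> q h = Lp_norm \<mu> p f powr (p - 1)"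
proof -
  note [measurable] = Lp_spaceD(1)[OF f]
  have qp: "(p - 1) * q = p" "q > 0"
  proof -
    have "1 / q = 1 - 1 / p" using pq by simp
    also have "\<dots> = (p - 1) / p" using p by (simp add: field_simps)
    finally have "q = p / (p - 1)" by (metis divide_divide_eq_right inverse_eq_divide mult_1 inverse_inverse_eq inverse_divide)
    then show "(p - 1) * q = p" "q > 0" using p by auto
  qed
  have hq: "\<bar>h x\<bar> powr q = \<bar>f x\<bar> powr p" for x
    using p qp by (cases "f x = 0") (auto simp: h_def abs_mult powr_mult powr_powr)
  show "h \<in> Lp_space \<mu> q"
    using Lp_spaceD(2)[OF f] by (auto simp: Lp_space_def hq) (simp add: h_def)
  have "f x * h x = \<bar>f x\<bar> powr p" for x
  proof (cases "f x = 0")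
    case False
    have "f x * h x = \<bar>f x\<bar> * \<bar>f x\<bar> powr (p - 1)" by (simp add: h_def abs_sgn mult.assoc)
    also have "\<dots> = \<bar>f x\<bar> powr 1 * \<bar>f x\<bar> powr (p - 1)" using False by simp
    also have "\<dots> = \<bar>f x\<bar> powr p" by (simp only: powr_add[symmetric]) simp
    finally show ?thesis .
  qed (simp add: h_def)
  then show "(\<integral>x. f x * h x \<partial>\<mu>) = Lp_norm \<mu> p f powr p" using p by (simp add: Lp_norm_powr)
  have "Lp_norm \<mu> q h = (Lp_norm \<mu> p f powr p) powr (1 / q)"
    using p by (simp add: Lp_norm_def[of \<mu> q] hq Lp_norm_powr)
  also have "\<dots> = Lp_norm \<mu> p f powr (p / q)" by (simp add: powr_powr)
  also have "p / q = p - 1" using qp by (simp add: divide_eq_eq)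
  finally show "Lp_norm \<mu> q h = Lp_norm \<mu> p f powr (p - 1)" .
qed

lemma Lp_Fatou:
  assumes p: "p > 0" and u: "\<And>n. u n \<in> Lp_space \<mu> p" and f: "f \<in> borel_measurable \<mu>"
    and lim: "AE x in \<mu>. (\<lambda>n. u n x) \<longlonglongrightarrow> f x" and bnd: "\<forall>\<^sub>F n in sequentially. Lp_norm \<mu> p (u n) \<le> C" and C: "0 \<le> C"
  shows "f \<in> Lp_space \<mu> p" "Lp_norm \<mu> p f \<le> C"
proof -
  note [measurable] = f Lp_spaceD(1)[OF u]
  have nn: "(\<integral>\<^sup>+x. ennreal (\<bar>u n x\<bar> powr p) \<partial>\<mu>) = ennreal (Lp_norm \<mu> p (u n) powr p)" for n
    using Lp_spaceD(2)[OF u, of n] p by (simp add: nn_integral_eq_integral Lp_norm_powr)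
  have "(\<integral>\<^sup>+x. ennreal (\<bar>f x\<bar> powr p) \<partial>\<mu>) = (\<integral>\<^sup>+x. liminf (\<lambda>n. ennreal (\<bar>u n x\<bar> powr p)) \<partial>\<mu>)"
  proof (rule nn_integral_cong_AE)
    show "AE x in \<mu>. ennreal (\<bar>f x\<bar> powr p) = liminf (\<lambda>n. ennreal (\<bar>u n x\<bar> powr p))"
      using lim
    proof eventually_elim
      case (elim x)
      have "(\<lambda>n. \<bar>u n x\<bar> powr p) \<longlonglongrightarrow> \<bar>f x\<bar> powr p"
        using p by (intro tendsto_powr' tendsto_rabs elim tendsto_const) auto
      then have "(\<lambda>n. ennreal (\<bar>u n x\<bar> powr p)) \<longlonglongrightarrow> ennreal (\<bar>f x\<bar> powr p)" by simp
      then show ?case using lim_imp_Liminf[OF sequentially_bot] by metis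
    qed
  qed
  also have "\<dots> \<le> liminf (\<lambda>n. \<integral>\<^sup>+x. ennreal (\<bar>u n x\<bar> powr p) \<partial>\<mu>)"
    by (rule nn_integral_liminf) simp
  also have "\<dots> \<le> ennreal (C powr p)"
  proof -
    have "\<forall>\<^sub>F n in sequentially. (\<integral>\<^sup>+x. ennreal (\<bar>u n x\<bar> powr p) \<partial>\<mu>) \<le> ennreal (C powr p)"
      using bnd by eventually_elim (use p in \<open>auto simp: nn intro!: ennreal_leI powr_mono2\<close>)
    from Liminf_mono[OF this] show ?thesis
      by (simp add: Liminf_const[OF sequentially_bot])
  qed
  finally have le: "(\<integral>\<^sup>+x. ennreal (\<bar>f x\<bar> powr p) \<partial>\<mu>) \<le> ennreal (C powr p)" .
  have int: "integrable \<mu> (\<lambda>x. \<bar>f x\<bar> powr p)"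
    by (rule integrableI_bounded) (use le in \<open>auto simp: le_less_trans\<close>)
  then show "f \<in> Lp_space \<mu> p" using f by (simp add: Lp_space_def)
  have "ennreal (\<integral>x. \<bar>f x\<bar> powr p \<partial>\<mu>) \<le> ennreal (C powr p)"
    using le int by (simp add: nn_integral_eq_integral)
  then have "(\<integral>x. \<bar>f x\<bar> powr p \<partial>\<mu>) \<le> C powr p" by simp
  then show "Lp_norm \<mu> p f \<le> C" by (intro Lp_norm_leI p C)
qed

lemma Lp_tendsto_AE_subseq:
  assumes p: "p > 0" and u: "\<And>n. u n \<in> Lp_space \<mu> p" and lim: "(\<lambda>n. Lp_norm \<mu> p (u n)) \<longlonglongrightarrow> 0"
  shows "\<exists>r. strict_mono r \<and> (AE x in \<mu>. (\<lambda>n. u (r n) x) \<longlonglongrightarrow> 0)"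
proof -
  have "(\<lambda>n. Lp_norm \<mu> p (u n) powr p) \<longlonglongrightarrow> 0"
    using tendsto_powr'[OF lim tendsto_const[of p]] p by simp
  then have "(\<lambda>n. \<integral>x. norm (\<bar>u n x\<bar> powr p) \<partial>\<mu>) \<longlonglongrightarrow> 0" using p by (simp add: Lp_norm_powr)
  from tendsto_L1_AE_subseq[OF Lp_spaceD(2)[OF u] this]
  obtain r where r: "strict_mono r" "AE x in \<mu>. (\<lambda>n. \<bar>u (r n) x\<bar> powr p) \<longlonglongrightarrow> 0" by blast
  have "AE x in \<mu>. (\<lambda>n. u (r n) x) \<longlonglongrightarrow> 0"
    using r(2)
  proof eventually_elim
    case (elim x)
    from tendsto_powr'[OF elim tendsto_const[of "1/p"]] p
    have "(\<lambda>n. \<bar>u (r n) x\<bar>) \<longlonglongrightarrow> 0" by (simp add: powr_powr)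
    then show ?case by (rule tendsto_rabs_zero_cancel)
  qed
  then show ?thesis using r(1) by blast
qed

text \<open>
  Along a fast subsequence the increments \<open>d k\<close> have norm at most \<open>(1/4) ^ k\<close>. Then the sum over \<open>k\<close> of
  \<open>(2 ^ k * \<bar>d k\<bar>) powr p\<close> is integrable, hence finite almost everywhere, which forces
  \<open>\<bar>d k\<bar> \<le> (1/2) ^ k\<close> from some \<open>k\<close> on. So the subsequence converges almost everywhere, and Fatou's lemma
  turns this into convergence in norm.
\<close>

lemma Lp_complete:
  assumes p: "1 \<le> p" and u: "\<And>n. u n \<in> Lp_space \<mu> p"
    and Cauchy: "\<And>e. e > 0 \<Longrightarrow> \<exists>N. \<forall>m\<ge>N. \<forall>n\<ge>N. Lp_norm \<mu> p (\<lambda>x. u m x - u n x) < e"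
  shows "\<exists>f\<in>Lp_space \<mu> p. (\<lambda>n. Lp_norm \<mu> p (\<lambda>x. u n x - f x)) \<longlonglongrightarrow> 0"
proof -
  have p0: "p > 0" using p by simp
  note [measurable] = Lp_spaceD(1)[OF u]
  have "\<forall>k. \<exists>N. \<forall>m\<ge>N. \<forall>n\<ge>N. Lp_norm \<mu> p (\<lambda>x. u m x - u n x) < (1/4) ^ k"
    using Cauchy by simp
  then obtain N where N: "\<And>k m n. N k \<le> m \<Longrightarrow> N k \<le> n \<Longrightarrow> Lp_norm \<mu> p (\<lambda>x. u m x - u n x) < (1/4) ^ k"
    by metis
  define r where "r k = (\<Sum>i\<le>k. N i) + k" for k
  have rN: "N k \<le> r k" for k
  proof -
    have "N k \<le> (\<Sum>i\<le>k. N i)" by (rule member_le_sum) auto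
    then show ?thesis by (simp add: r_def)
  qed
  have rS: "r k \<le> r (Suc k)" for k by (simp add: r_def)
  define d where "d k x = u (r (Suc k)) x - u (r k) x" for k x
  have d: "d k \<in> Lp_space \<mu> p" "Lp_norm \<mu> p (d k) \<le> (1/4) ^ k" for k
    unfolding d_def using N[of k "r (Suc k)" "r k"] rN[of k] rS[of k] by (auto intro!: Lp_diff_space p u)
  note [measurable] = Lp_spaceD(1)[OF d(1)]
  have AE_d: "AE x in \<mu>. summable (\<lambda>k. \<bar>d k x\<bar>)"
  proof -
    have "(\<integral>\<^sup>+x. (\<Sum>k. ennreal ((2 ^ k * \<bar>d k x\<bar>) powr p)) \<partial>\<mu>) = (\<Sum>k. \<integral>\<^sup>+x. ennreal ((2 ^ k * \<bar>d k x\<bar>) powr p) \<partial>\<mu>)"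
      by (rule nn_integral_suminf) simp
    also have "\<dots> \<le> (\<Sum>k. ennreal ((1/2) ^ k))"
    proof (rule suminf_le)
      fix k
      have sc: "(\<lambda>x. 2 ^ k * d k x) \<in> Lp_space \<mu> p" "Lp_norm \<mu> p (\<lambda>x. 2 ^ k * d k x) = 2 ^ k * Lp_norm \<mu> p (d k)"
        using Lp_scale[OF p0 d(1), of "2 ^ k" k] by simp_all
      have "Lp_norm \<mu> p (\<lambda>x. 2 ^ k * d k x) \<le> 2 ^ k * (1/4) ^ k" unfolding sc(2) by (intro mult_left_mono d) auto
      also have "\<dots> = (1/2) ^ k" by (simp flip: power_mult_distrib)
      finally have le: "Lp_norm \<mu> p (\<lambda>x. 2 ^ k * d k x) \<le> (1/2) ^ k" .
      have "(\<integral>\<^sup>+x. ennreal ((2 ^ k * \<bar>d k x\<bar>) powr p) \<partial>\<mu>) = ennreal (Lp_norm \<mu> p (\<lambda>x. 2 ^ k * d k x) powr p)"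
        using Lp_spaceD(2)[OF sc(1)] p0 by (simp add: nn_integral_eq_integral Lp_norm_powr abs_mult)
      also have "\<dots> \<le> ennreal ((1/2) ^ k)"
      proof (rule ennreal_leI)
        have "Lp_norm \<mu> p (\<lambda>x. 2 ^ k * d k x) powr p \<le> ((1/2) ^ k) powr p"
          using le p0 by (intro powr_mono2) auto
        also have "\<dots> \<le> ((1/2) ^ k) powr 1"
          using p by (intro powr_mono') (auto intro: power_le_one)
        finally show "Lp_norm \<mu> p (\<lambda>x. 2 ^ k * d k x) powr p \<le> (1/2) ^ k" by simp
      qed
      finally show "(\<integral>\<^sup>+x. ennreal ((2 ^ k * \<bar>d k x\<bar>) powr p) \<partial>\<mu>) \<le> ennreal ((1/2) ^ k)" .
    qed auto
    also have "\<dots> = ennreal (\<Sum>k. (1/2) ^ k)"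
      by (rule suminf_ennreal2) (auto intro: summable_geometric)
    also have "\<dots> < \<infinity>" by simp
    finally have "AE x in \<mu>. (\<Sum>k. ennreal ((2 ^ k * \<bar>d k x\<bar>) powr p)) \<noteq> \<infinity>"
      by (intro nn_integral_PInf_AE) (auto simp: less_top)
    then show ?thesis
    proof eventually_elim
      case (elim x)
      then have "summable (\<lambda>k. (2 ^ k * \<bar>d k x\<bar>) powr p)"
        by (intro summable_suminf_not_top) auto
      from order_tendstoD(2)[OF summable_LIMSEQ_zero[OF this], of 1]
      have "\<forall>\<^sub>F k in sequentially. (2 ^ k * \<bar>d k x\<bar>) powr p < 1" by simp
      then have "\<forall>\<^sub>F k in sequentially. norm \<bar>d k x\<bar> \<le> (1/2) ^ k"
      proof eventually_elim
        case (elim k)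
        then have "2 ^ k * \<bar>d k x\<bar> \<le> 1"
          using p0 ge_one_powr_ge_zero[of "2 ^ k * \<bar>d k x\<bar>" p] by (cases "2 ^ k * \<bar>d k x\<bar> \<le> 1") auto
        then show ?case by (simp add: field_simps power_one_over)
      qed
      then show ?case
        by (rule summable_comparison_test_ev) (auto intro: summable_geometric)
    qed
  qed
  define f where "f x = lim (\<lambda>k. u (r k) x)" for x
  have f[measurable]: "f \<in> borel_measurable \<mu>" unfolding f_def by measurable
  have lim: "AE x in \<mu>. (\<lambda>k. u (r k) x) \<longlonglongrightarrow> f x"
    using AE_d
  proof eventually_elim
    case (elim x)
    then have "summable (\<lambda>k. d k x)" by (rule summable_rabs_cancel)
    then have "convergent (\<lambda>n. \<Sum>k<n. d k x)" by (simp add: summable_iff_convergent)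
    moreover have "(\<Sum>k<n. d k x) = u (r n) x - u (r 0) x" for n
      unfolding d_def by (rule sum_lessThan_telescope)
    ultimately have "convergent (\<lambda>n. u (r n) x - u (r 0) x)" by simp
    then have "convergent (\<lambda>n. u (r n) x)"
      using convergent_add[OF _ convergent_const[of "u (r 0) x"]] by fastforce
    then show ?case unfolding f_def by (simp add: convergent_LIMSEQ_iff)
  qed
  have close: "(\<lambda>x. u m x - f x) \<in> Lp_space \<mu> p \<and> Lp_norm \<mu> p (\<lambda>x. u m x - f x) \<le> (1/4) ^ k" if "N k \<le> m" for m k
  proof -
    have 1: "AE x in \<mu>. (\<lambda>n. u m x - u (r n) x) \<longlonglongrightarrow> u m x - f x"
      using lim by eventually_elim (intro tendsto_intros)
    have 2: "\<forall>\<^sub>F n in sequentially. Lp_norm \<mu> p (\<lambda>x. u m x - u (r n) x) \<le> (1/4) ^ k"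
      using eventually_ge_at_top[of k]
    proof eventually_elim
      case (elim n)
      have "r k \<le> r n" using elim rS by (rule lift_Suc_mono_le[rotated])
      then have "N k \<le> r n" using rN[of k] by simp
      then show ?case using N[OF that, of "r n"] by simp
    qed
    show ?thesis using Lp_Fatou[OF p0 Lp_diff_space[OF p u u] _ 1 2] by auto
  qed
  have "(\<lambda>x. u (N 0) x - (u (N 0) x - f x)) \<in> Lp_space \<mu> p"
    by (rule Lp_diff_space[OF p u]) (use close[of 0 "N 0"] in auto)
  then have "f \<in> Lp_space \<mu> p" by simp
  moreover have "(\<lambda>n. Lp_norm \<mu> p (\<lambda>x. u n x - f x)) \<longlonglongrightarrow> 0"
  proof (rule LIMSEQ_I)
    fix e :: real assume "e > 0"
    then obtain k where k: "(1/4::real) ^ k < e" using real_arch_pow_inv[of e "1/4"] by auto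
    then show "\<exists>no. \<forall>n\<ge>no. norm (Lp_norm \<mu> p (\<lambda>x. u n x - f x) - 0) < e"
      using close[of k] by (intro exI[of _ "N k"]) (force intro: le_less_trans)
  qed
  ultimately show ?thesis by blast
qed

section \<open>Embedding into a Banach space of bounded functions\<close>

instance bcontfun :: (metric_space, banach) banach ..

lemma c0_semigroupD:
  assumes "c0_semigroup \<mu> p S"
  shows "0 \<le> t \<Longrightarrow> f \<in> Lp_space \<mu> p \<Longrightarrow> S t f \<in> Lp_space \<mu> p"
    and "0 \<le> t \<Longrightarrow> f \<in> Lp_space \<mu> p \<Longrightarrow> g \<in> Lp_space \<mu> p \<Longrightarrow>
      AE x in \<mu>. S t (\<lambda>x. a * f x + b * g x) x = a * S t f x + b * S t g x"
    and "0 \<le> t \<Longrightarrow> \<exists>C. \<forall>f\<in>Lp_space \<mu> p. Lp_norm \<mu> p (S t f) \<le> C * Lp_norm \<mu> p f"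
    and "f \<in> Lp_space \<mu> p \<Longrightarrow> AE x in \<mu>. S 0 f x = f x"
    and "0 \<le> s \<Longrightarrow> 0 \<le> t \<Longrightarrow> f \<in> Lp_space \<mu> p \<Longrightarrow> AE x in \<mu>. S (s + t) f x = S s (S t f) x"
    and "f \<in> Lp_space \<mu> p \<Longrightarrow> ((\<lambda>t. Lp_norm \<mu> p (\<lambda>x. S t f x - f x)) \<longlongrightarrow> 0) (at_right 0)"
  using assms by (simp_all add: c0_semigroup_def)

lemma c0_semigroup_AE_cong:
  assumes p: "1 \<le> p" and S: "c0_semigroup \<mu> p S" and t: "0 \<le> t"
    and f: "f \<in> Lp_space \<mu> p" and g: "g \<in> Lp_space \<mu> p" and eq: "AE x in \<mu>. f x = g x"
  shows "AE x in \<mu>. S t f x = S t g x"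
proof -
  have p0: "p > 0" using p by simp
  obtain C where C: "\<And>f. f \<in> Lp_space \<mu> p \<Longrightarrow> Lp_norm \<mu> p (S t f) \<le> C * Lp_norm \<mu> p f"
    using c0_semigroupD(3)[OF S t] by blast
  define d where "d x = 1 * f x + (- 1) * g x" for x
  have d: "d \<in> Lp_space \<mu> p" unfolding d_def by (rule Lp_lin[OF p f g])
  have Sd: "S t d \<in> Lp_space \<mu> p" by (rule c0_semigroupD(1)[OF S t d])
  have "AE x in \<mu>. d x = 0" using eq by eventually_elim (simp add: d_def)
  then have "Lp_norm \<mu> p d = 0" using Lp_norm_eq_0_iff[OF p0 d] by simp
  then have "Lp_norm \<mu> p (S t d) = 0" using C[OF d] Lp_norm_nonneg[of \<mu> p "S t d"] by simp
  then have "AE x in \<mu>. S t d x = 0" using Lp_norm_eq_0_iff[OF p0 Sd] by simp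
  moreover have "AE x in \<mu>. S t d x = 1 * S t f x + (- 1) * S t g x"
    unfolding d_def by (rule c0_semigroupD(2)[OF S t f g])
  ultimately show ?thesis by eventually_elim simp
qed

text \<open>
  Modulo null sets, \<open>L\<^sup>p\<close> is mapped isometrically to bounded functions on the unit ball of \<open>L\<^sup>q\<close> by the
  pairing \<open>f \<mapsto> (h \<mapsto> \<integral>x. f x * h x \<partial>\<mu>)\<close>. Bounded functions are obtained as bounded continuous functions for the
  discrete topology; the index type consists of all functions, and the pairing is set to zero outside
  the unit ball.
\<close>

locale Lp_embedding =
  fixes \<mu> :: "'a measure" and p q :: real
  assumes p: "1 < p" and pq: "1 / p + 1 / q = 1"
begin

lemma p1: "1 \<le> p" and p0: "0 < p" using p by auto

lemma q0: "0 < q"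
proof -
  have "1 / q = 1 - 1 / p" using pq by simp
  then have "0 < 1 / q" using p by simp
  then show ?thesis by simp
qed

definition dual_ball :: "('a \<Rightarrow> real) set" where
  "dual_ball = {h \<in> Lp_space \<mu> q. Lp_norm \<mu> q h \<le> 1}"

definition pairing :: "('a \<Rightarrow> real) \<Rightarrow> ('a \<Rightarrow> real) discrete \<Rightarrow> real" where
  "pairing f d = (if of_discrete d \<in> dual_ball then \<integral>x. f x * of_discrete d x \<partial>\<mu> else 0)"

definition emb :: "('a \<Rightarrow> real) \<Rightarrow> ('a \<Rightarrow> real) discrete \<Rightarrow>\<^sub>C real" where
  "emb f = Bcontfun (pairing f)"

lemma pairing_le: "f \<in> Lp_space \<mu> p \<Longrightarrow> \<bar>pairing f d\<bar> \<le> Lp_norm \<mu> p f"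
proof -
  assume f: "f \<in> Lp_space \<mu> p"
  show ?thesis
  proof (cases "of_discrete d \<in> dual_ball")
    case True
    then have h: "of_discrete d \<in> Lp_space \<mu> q" "Lp_norm \<mu> q (of_discrete d) \<le> 1" by (auto simp: dual_ball_def)
    have "\<bar>pairing f d\<bar> \<le> Lp_norm \<mu> p f * Lp_norm \<mu> q (of_discrete d)"
      using Hoelder(2)[OF p pq f h(1)] True by (simp add: pairing_def)
    also have "\<dots> \<le> Lp_norm \<mu> p f * 1" by (intro mult_left_mono h) auto
    finally show ?thesis by simp
  qed (simp add: pairing_def)
qed

lemma apply_emb: "f \<in> Lp_space \<mu> p \<Longrightarrow> apply_bcontfun (emb f) = pairing f"
  unfolding emb_def
proof (rule Bcontfun_inverse)
  assume f: "f \<in> Lp_space \<mu> p"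
  have "continuous_on UNIV (pairing f)"
    by (simp add: continuous_on_open_vimage open_discrete)
  then show "pairing f \<in> bcontfun" using pairing_le[OF f] by (intro bcontfun_normI) auto
qed

lemma emb_lin:
  assumes "f \<in> Lp_space \<mu> p" "g \<in> Lp_space \<mu> p"
  shows "emb (\<lambda>x. a * f x + b * g x) = a *\<^sub>R emb f + b *\<^sub>R emb g"
proof (rule bcontfun_eqI)
  fix d
  show "apply_bcontfun (emb (\<lambda>x. a * f x + b * g x)) d = apply_bcontfun (a *\<^sub>R emb f + b *\<^sub>R emb g) d"
  proof (cases "of_discrete d \<in> dual_ball")
    case True
    then have "of_discrete d \<in> Lp_space \<mu> q" by (simp add: dual_ball_def)
    from Hoelder(1)[OF p pq assms(1) this] Hoelder(1)[OF p pq assms(2) this] True show ?thesis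
      using assms by (simp add: apply_emb Lp_lin[OF p1] pairing_def distrib_right mult.assoc)
  qed (use assms in \<open>simp add: apply_emb Lp_lin[OF p1] pairing_def\<close>)
qed

lemma emb_diff:
  assumes "f \<in> Lp_space \<mu> p" "g \<in> Lp_space \<mu> p"
  shows "emb (\<lambda>x. f x - g x) = emb f - emb g"
  using emb_lin[OF assms, of 1 "- 1"] by simp

lemma norm_emb:
  assumes f: "f \<in> Lp_space \<mu> p" shows "norm (emb f) = Lp_norm \<mu> p f"
proof (rule antisym)
  show "norm (emb f) \<le> Lp_norm \<mu> p f"
    by (rule norm_bound) (use pairing_le[OF f] apply_emb[OF f] in auto)
  show "Lp_norm \<mu> p f \<le> norm (emb f)"
  proof (cases "Lp_norm \<mu> p f = 0")
    case False
    define c where "c = Lp_norm \<mu> p f"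
    have c: "c > 0" using False Lp_norm_nonneg[of \<mu> p f] unfolding c_def by linarith
    define h where "h x = sgn (f x) * \<bar>f x\<bar> powr (p - 1)" for x
    note h = Lp_dual_element[OF p pq f, folded h_def c_def]
    define k where "k x = (1 / c powr (p - 1)) * h x" for x
    have k: "k \<in> Lp_space \<mu> q" "Lp_norm \<mu> q k = 1"
      unfolding k_def using Lp_scale[OF q0 h(1), of "1 / c powr (p - 1)"] h(3) c by auto
    then have "pairing f (discrete k) = (\<integral>x. f x * k x \<partial>\<mu>)"
      by (simp add: pairing_def dual_ball_def discrete_inverse)
    also have "\<dots> = (\<integral>x. (1 / c powr (p - 1)) * (f x * h x) \<partial>\<mu>)"
      by (rule Bochner_Integration.integral_cong) (auto simp: k_def)
    also have "\<dots> = (1 / c powr (p - 1)) * c powr p" by (simp only: integral_mult_right_zero h(2))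
    also have "\<dots> = c" using c by (simp add: powr_diff)
    finally have "c = apply_bcontfun (emb f) (discrete k)" by (simp add: apply_emb f)
    also have "\<dots> \<le> norm (emb f)" using norm_bounded[of "emb f" "discrete k"] by simp
    finally show ?thesis by (simp add: c_def)
  qed simp
qed

lemma norm_emb_diff:
  assumes "f \<in> Lp_space \<mu> p" "g \<in> Lp_space \<mu> p"
  shows "norm (emb f - emb g) = Lp_norm \<mu> p (\<lambda>x. f x - g x)"
  using norm_emb[OF Lp_diff_space[OF p1 assms]] by (simp add: emb_diff assms)

lemma emb_eq_iff:
  assumes "f \<in> Lp_space \<mu> p" "g \<in> Lp_space \<mu> p"
  shows "emb f = emb g \<longleftrightarrow> (AE x in \<mu>. f x = g x)"
proof -
  have "emb f = emb g \<longleftrightarrow> norm (emb f - emb g) = 0" by simp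
  then show ?thesis unfolding norm_emb_diff[OF assms]
    using Lp_norm_eq_0_iff[OF p0 Lp_diff_space[OF p1 assms]] by simp
qed

definition space_emb where "space_emb = emb ` Lp_space \<mu> p"

text \<open>
  A restatement of the completeness of \<open>L\<^sup>p\<close>, as the embedding is isometric.
\<close>

lemma closed_space_emb: "closed space_emb"
  unfolding closed_sequential_limits
proof (intro allI impI)
  fix z l assume "(\<forall>n. z n \<in> space_emb) \<and> z \<longlonglongrightarrow> l"
  then have z: "\<And>n. z n \<in> space_emb" and lim: "z \<longlonglongrightarrow> l" by auto
  from z have "\<forall>n. \<exists>u. u \<in> Lp_space \<mu> p \<and> z n = emb u" by (auto simp: space_emb_def)
  then obtain u where u: "\<And>n. u n \<in> Lp_space \<mu> p" "\<And>n. z n = emb (u n)" by metis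
  have "\<exists>N. \<forall>m\<ge>N. \<forall>n\<ge>N. Lp_norm \<mu> p (\<lambda>x. u m x - u n x) < e" if "e > 0" for e
    using metric_CauchyD[OF LIMSEQ_imp_Cauchy[OF lim] that] by (simp add: u dist_norm norm_emb_diff)
  from Lp_complete[OF p1 u(1) this] obtain f where f: "f \<in> Lp_space \<mu> p" "(\<lambda>n. Lp_norm \<mu> p (\<lambda>x. u n x - f x)) \<longlonglongrightarrow> 0"
    by blast
  from f(2) have "(\<lambda>n. norm (z n - emb f)) \<longlonglongrightarrow> 0" by (simp add: u norm_emb_diff f)
  then have "z \<longlonglongrightarrow> emb f" using Lim_null tendsto_norm_zero_iff by blast
  with lim have "l = emb f" by (rule LIMSEQ_unique)
  then show "l \<in> space_emb" using f by (simp add: space_emb_def)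
qed

lemma subspace_space_emb: "subspace space_emb"
  unfolding subspace_def
proof (intro conjI ballI allI)
  have "norm (emb (\<lambda>x. 0)) = 0" by (simp only: norm_emb Lp_zero p0)
  then have "emb (\<lambda>x. 0) = 0" by (simp only: norm_eq_zero)
  then show "0 \<in> space_emb" unfolding space_emb_def using Lp_zero(1)[OF p0] by force
next
  fix x y assume "x \<in> space_emb" "y \<in> space_emb"
  then obtain f g where fg: "f \<in> Lp_space \<mu> p" "g \<in> Lp_space \<mu> p" "x = emb f" "y = emb g" by (auto simp: space_emb_def)
  then have "x + y = emb (\<lambda>x. 1 * f x + 1 * g x)" by (simp only: emb_lin) simp
  then show "x + y \<in> space_emb" using Lp_lin[OF p1 fg(1,2), of 1 1] by (simp only: space_emb_def imageI)
next
  fix c x assume "x \<in> space_emb"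
  then obtain f where f: "f \<in> Lp_space \<mu> p" "x = emb f" by (auto simp: space_emb_def)
  then have "c *\<^sub>R x = emb (\<lambda>x. c * f x + 0 * f x)" by (simp only: emb_lin) simp
  then show "c *\<^sub>R x \<in> space_emb" using Lp_lin[OF p1 f(1) f(1), of c 0] by (simp only: space_emb_def imageI)
qed

definition rep where "rep = inv_into (Lp_space \<mu> p) emb"

lemma rep: "x \<in> space_emb \<Longrightarrow> rep x \<in> Lp_space \<mu> p" "x \<in> space_emb \<Longrightarrow> emb (rep x) = x"
  by (auto simp: rep_def space_emb_def inv_into_into f_inv_into_f)

lemma emb_mem: "f \<in> Lp_space \<mu> p \<Longrightarrow> emb f \<in> space_emb"
  by (simp add: space_emb_def)

lemma rep_emb: "f \<in> Lp_space \<mu> p \<Longrightarrow> AE x in \<mu>. rep (emb f) x = f x"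
  using emb_eq_iff[of "rep (emb f)" f] rep[of "emb f"] emb_mem by blast

text \<open>
  \<open>lift\<close> transports a semigroup on functions to the embedded space, and \<open>lower\<close> transports it back;
  representatives of classes modulo null sets are chosen by \<open>rep\<close>.
\<close>

definition lift where "lift S t x = emb (S t (rep x))"

definition lower where "lower R t f = rep (R t (emb f))"

context
  fixes S assumes S: "c0_semigroup \<mu> p S"
begin

lemma S_mem: "0 \<le> t \<Longrightarrow> f \<in> Lp_space \<mu> p \<Longrightarrow> S t f \<in> Lp_space \<mu> p"
  by (rule c0_semigroupD(1)[OF S])

lemma lift_emb:
  assumes "0 \<le> t" "f \<in> Lp_space \<mu> p" shows "lift S t (emb f) = emb (S t f)"
  unfolding lift_def using assms emb_mem rep
  by (subst emb_eq_iff) (auto intro!: S_mem c0_semigroup_AE_cong[OF p1 S] rep_emb)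

lemma semigroup_lift: "semigroup_on space_emb (lift S)"
proof
  show "closed space_emb" "subspace space_emb" by (rule closed_space_emb subspace_space_emb)+
  fix s t :: real and x y assume "x \<in> space_emb"
  then obtain f where f: "f \<in> Lp_space \<mu> p" "x = emb f" by (auto simp: space_emb_def)
  show "lift S t x \<in> space_emb" if "0 \<le> t" using that f by (simp add: lift_emb emb_mem S_mem)
  show "lift S 0 x = x"
    using f by (simp add: lift_emb emb_eq_iff S_mem c0_semigroupD(4)[OF S])
  show "lift S (s + t) x = lift S s (lift S t x)" if "0 \<le> s" "0 \<le> t"
    using f that by (simp add: lift_emb emb_eq_iff S_mem c0_semigroupD(5)[OF S])
  show "lift S t (a *\<^sub>R x + b *\<^sub>R y) = a *\<^sub>R lift S t x + b *\<^sub>R lift S t y"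
    if t: "0 \<le> t" and y: "y \<in> space_emb" for a b
  proof -
    obtain g where g: "g \<in> Lp_space \<mu> p" "y = emb g" using y by (auto simp: space_emb_def)
    have "lift S t (a *\<^sub>R x + b *\<^sub>R y) = emb (S t (\<lambda>x. a * f x + b * g x))"
      using f g t by (simp add: emb_lin[symmetric] lift_emb Lp_lin[OF p1])
    also have "\<dots> = emb (\<lambda>x. a * S t f x + b * S t g x)"
      using f g t by (subst emb_eq_iff) (auto intro!: S_mem Lp_lin[OF p1] c0_semigroupD(2)[OF S])
    also have "\<dots> = a *\<^sub>R lift S t x + b *\<^sub>R lift S t y"
      using f g t by (simp add: lift_emb emb_lin S_mem)
    finally show ?thesis .
  qed
  have "((\<lambda>t. Lp_norm \<mu> p (\<lambda>x. S t f x - f x)) \<longlongrightarrow> 0) (at_right 0)"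
    by (rule c0_semigroupD(6)[OF S f(1)])
  moreover have "\<forall>\<^sub>F t in at_right 0. Lp_norm \<mu> p (\<lambda>x. S t f x - f x) = norm (lift S t x - x)"
    using eventually_at_right_less[of "0::real"]
    by eventually_elim (use f in \<open>simp add: lift_emb norm_emb_diff S_mem\<close>)
  ultimately have "((\<lambda>t. norm (lift S t x - x)) \<longlongrightarrow> 0) (at_right 0)" by (rule Lim_transform_eventually)
  then show "((\<lambda>t. lift S t x) \<longlongrightarrow> x) (at_right 0)" using Lim_null tendsto_norm_zero_iff by blast
next
  fix t :: real assume t: "0 \<le> t"
  then obtain C where C: "\<And>f. f \<in> Lp_space \<mu> p \<Longrightarrow> Lp_norm \<mu> p (S t f) \<le> C * Lp_norm \<mu> p f"
    using c0_semigroupD(3)[OF S t] by blast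
  show "\<exists>C. \<forall>x\<in>space_emb. norm (lift S t x) \<le> C * norm x"
    using C t by (intro exI[of _ C]) (auto simp: space_emb_def lift_emb norm_emb S_mem)
qed

lemma gen_lift_iff:
  assumes f: "f \<in> Lp_space \<mu> p" and g: "g \<in> Lp_space \<mu> p"
  shows "(emb f, emb g) \<in> semigroup_on.gen space_emb (lift S) \<longleftrightarrow> (f, g) \<in> sg_generator \<mu> p S"
proof -
  interpret L: semigroup_on space_emb "lift S" by (rule semigroup_lift)
  have quot: "\<forall>\<^sub>F t in at_right 0. norm ((lift S t (emb f) - emb f) /\<^sub>R t - emb g) = Lp_norm \<mu> p (\<lambda>x. (S t f x - f x) / t - g x)"
    using eventually_at_right_less[of "0::real"]
  proof eventually_elim
    case (elim t)
    have d: "(\<lambda>x. S t f x - f x) \<in> Lp_space \<mu> p" using elim f by (intro Lp_diff_space p1 S_mem) auto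
    have "(lift S t (emb f) - emb f) /\<^sub>R t - emb g = emb (\<lambda>x. (1 / t) * (S t f x - f x) + (- 1) * g x)"
      using elim f by (subst emb_lin[OF d g]) (simp add: lift_emb emb_diff S_mem divide_inverse)
    then show ?case using norm_emb[OF Lp_lin[OF p1 d g, of "1/t" "- 1"]] by simp
  qed
  have "((\<lambda>t. (lift S t (emb f) - emb f) /\<^sub>R t) \<longlongrightarrow> emb g) (at_right 0) \<longleftrightarrow>
      ((\<lambda>t. norm ((lift S t (emb f) - emb f) /\<^sub>R t - emb g)) \<longlongrightarrow> 0) (at_right 0)"
    by (subst Lim_null) (rule tendsto_norm_zero_iff[symmetric])
  also have "\<dots> \<longleftrightarrow> ((\<lambda>t. Lp_norm \<mu> p (\<lambda>x. (S t f x - f x) / t - g x)) \<longlongrightarrow> 0) (at_right 0)"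
    by (rule tendsto_cong[OF quot])
  finally show ?thesis using f g by (simp add: L.gen_def sg_generator_def emb_mem)
qed

lemma gen_lift_eq: "semigroup_on.gen space_emb (lift S) = map_prod emb emb ` sg_generator \<mu> p S"
proof -
  interpret L: semigroup_on space_emb "lift S" by (rule semigroup_lift)
  show ?thesis
  proof (intro equalityI subsetI)
    fix z assume z: "z \<in> L.gen"
    then obtain x y where xy: "z = (x, y)" "x \<in> space_emb" "y \<in> space_emb" by (auto simp: L.gen_def)
    then obtain f g where "f \<in> Lp_space \<mu> p" "g \<in> Lp_space \<mu> p" "x = emb f" "y = emb g" by (auto simp: space_emb_def)
    then show "z \<in> map_prod emb emb ` sg_generator \<mu> p S" using z xy gen_lift_iff[of f g] by force
  next
    fix z assume "z \<in> map_prod emb emb ` sg_generator \<mu> p S"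
    then obtain f g where "(f, g) \<in> sg_generator \<mu> p S" "z = (emb f, emb g)" by auto
    then show "z \<in> L.gen" using gen_lift_iff[of f g] by (auto simp: sg_generator_def)
  qed
qed

lemma contraction_lift:
  assumes "contractive \<mu> p S"
  shows "contraction_semigroup_on space_emb (lift S)"
proof (intro contraction_semigroup_on.intro contraction_semigroup_on_axioms.intro semigroup_lift)
  fix t :: real and x assume t: "0 \<le> t" and "x \<in> space_emb"
  then obtain f where f: "f \<in> Lp_space \<mu> p" "x = emb f" by (auto simp: space_emb_def)
  then show "norm (lift S t x) \<le> norm x"
    using assms t by (simp add: lift_emb norm_emb S_mem contractive_def)
qed

lemma dense_Domain_gen_lift:
  assumes G: "G \<subseteq> sg_generator \<mu> p S" and dense: "Lp_dense \<mu> p (Domain G)"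
  shows "space_emb \<subseteq> closure (Domain (semigroup_on.gen space_emb (lift S)))"
proof
  fix x assume "x \<in> space_emb"
  then obtain f where f: "f \<in> Lp_space \<mu> p" "x = emb f" by (auto simp: space_emb_def)
  show "x \<in> closure (Domain (semigroup_on.gen space_emb (lift S)))"
    unfolding closure_approachable
  proof (intro allI impI)
    fix e :: real assume "e > 0"
    then obtain g where g: "g \<in> Domain G" "Lp_norm \<mu> p (\<lambda>x. f x - g x) < e"
      using dense f unfolding Lp_dense_def by meson
    then obtain g' where "(g, g') \<in> sg_generator \<mu> p S" using G by auto
    then have "emb g \<in> Domain (semigroup_on.gen space_emb (lift S))" "g \<in> Lp_space \<mu> p"
      unfolding gen_lift_eq by (force simp: sg_generator_def)+
    then show "\<exists>y\<in>Domain (semigroup_on.gen space_emb (lift S)). dist y x < e"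
      using f g by (intro bexI[of _ "emb g"])
        (auto simp: dist_norm norm_emb_diff Lp_norm_minus_commute[of \<mu> p g f])
  qed
qed

end

lemma dist_resolvent_emb:
  assumes "f \<in> Lp_space \<mu> p" "g \<in> Lp_space \<mu> p" "f' \<in> Lp_space \<mu> p" "g' \<in> Lp_space \<mu> p"
  shows "dist (lam *\<^sub>R emb f' - emb g') (lam *\<^sub>R emb f - emb g) =
    Lp_norm \<mu> p (\<lambda>x. lam * (f x - f' x) - (g x - g' x))"
proof -
  have d: "(\<lambda>x. f x - f' x) \<in> Lp_space \<mu> p" "(\<lambda>x. g x - g' x) \<in> Lp_space \<mu> p"
    using assms by (auto intro!: Lp_diff_space[OF p1])
  have "emb (\<lambda>x. lam * (f x - f' x) + (- 1) * (g x - g' x)) = lam *\<^sub>R (emb f - emb f') - (emb g - emb g')"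
    using emb_lin[OF d, of lam "- 1"] assms by (simp add: emb_diff)
  moreover have "dist (lam *\<^sub>R emb f' - emb g') (lam *\<^sub>R emb f - emb g) = norm (lam *\<^sub>R (emb f - emb f') - (emb g - emb g'))"
    unfolding dist_norm by (subst norm_minus_commute) (simp add: algebra_simps)
  ultimately have "dist (lam *\<^sub>R emb f' - emb g') (lam *\<^sub>R emb f - emb g) =
      Lp_norm \<mu> p (\<lambda>x. lam * (f x - f' x) + (- 1) * (g x - g' x))"
    using norm_emb[OF Lp_lin[OF p1 d, of lam "- 1"]] by metis
  then show ?thesis by (simp only: mult_minus1 add_uminus_conv_diff)
qed

lemma c0_semigroup_lower:
  assumes R: "semigroup_on space_emb R"
  shows "c0_semigroup \<mu> p (lower R)" and "0 \<le> t \<Longrightarrow> x \<in> space_emb \<Longrightarrow> lift (lower R) t x = R t x"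
proof -
  interpret R: semigroup_on space_emb R by fact
  have mem: "lower R t f \<in> Lp_space \<mu> p" "emb (lower R t f) = R t (emb f)" if "0 \<le> t" "f \<in> Lp_space \<mu> p" for t f
    using that rep[OF R.maps[OF that(1) emb_mem[OF that(2)]]] by (auto simp: lower_def)
  have AEI: "AE x in \<mu>. u x = w x" if "u \<in> Lp_space \<mu> p" "w \<in> Lp_space \<mu> p" "emb u = emb w" for u w
    using that emb_eq_iff by blast
  show c0: "c0_semigroup \<mu> p (lower R)"
    unfolding c0_semigroup_def
  proof (intro conjI allI impI ballI)
    fix t :: real and f assume t: "0 \<le> t" and f: "f \<in> Lp_space \<mu> p"
    show "lower R t f \<in> Lp_space \<mu> p" using mem t f by blast
    fix g a b assume g: "g \<in> Lp_space \<mu> p"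
    show "AE x in \<mu>. lower R t (\<lambda>x. a * f x + b * g x) x = a * lower R t f x + b * lower R t g x"
      using t f g by (intro AEI) (auto intro!: mem Lp_lin[OF p1] simp: mem Lp_lin[OF p1] emb_lin R.lin emb_mem)
  next
    fix t :: real assume t: "0 \<le> t"
    then obtain C where C: "\<And>x. x \<in> space_emb \<Longrightarrow> norm (R t x) \<le> C * norm x" using R.bnd by blast
    show "\<exists>C. \<forall>f\<in>Lp_space \<mu> p. Lp_norm \<mu> p (lower R t f) \<le> C * Lp_norm \<mu> p f"
    proof (intro exI[of _ C] ballI)
      fix f assume f: "f \<in> Lp_space \<mu> p"
      show "Lp_norm \<mu> p (lower R t f) \<le> C * Lp_norm \<mu> p f"
        using C[OF emb_mem[OF f]] norm_emb[OF f] norm_emb[OF mem(1)[OF t f]] mem(2)[OF t f] by simp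
    qed
  next
    fix f assume f: "f \<in> Lp_space \<mu> p"
    show "AE x in \<mu>. lower R 0 f x = f x"
      using f by (intro AEI) (auto simp: mem R.T_zero emb_mem)
    show "AE x in \<mu>. lower R (s + t) f x = lower R s (lower R t f) x" if "0 \<le> s" "0 \<le> t" for s t
      using f that by (intro AEI) (auto simp: mem R.T_add emb_mem)
    have "((\<lambda>t. norm (R t (emb f) - emb f)) \<longlongrightarrow> 0) (at_right 0)"
      by (intro tendsto_norm_zero) (rule Lim_null[THEN iffD1, OF R.cont0[OF emb_mem[OF f]]])
    moreover have "\<forall>\<^sub>F t in at_right 0. norm (R t (emb f) - emb f) = Lp_norm \<mu> p (\<lambda>x. lower R t f x - f x)"
      using eventually_at_right_less[of "0::real"]
      by eventually_elim (use f mem in \<open>simp flip: norm_emb_diff\<close>)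
    ultimately show "((\<lambda>t. Lp_norm \<mu> p (\<lambda>x. lower R t f x - f x)) \<longlongrightarrow> 0) (at_right 0)"
      by (rule Lim_transform_eventually)
  qed
  show "lift (lower R) t x = R t x" if "0 \<le> t" "x \<in> space_emb"
  proof -
    have "lift (lower R) t (emb (rep x)) = emb (lower R t (rep x))"
      by (rule lift_emb[OF c0 that(1) rep(1)[OF that(2)]])
    then show ?thesis using mem(2)[OF that(1) rep(1)[OF that(2)]] rep(2)[OF that(2)] by simp
  qed
qed

end

section \<open>Uniqueness and cores in spaces of p-integrable functions\<close>

text \<open>
  Basic properties of generators, read off from the embedded semigroup.
\<close>

lemma
  assumes p: "1 < p" and S: "c0_semigroup \<mu> p S"
  shows sg_generator_lin: "(f, g) \<in> sg_generator \<mu> p S \<Longrightarrow> (f', g') \<in> sg_generator \<mu> p S \<Longrightarrow>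
      (\<lambda>x. a * f x + b * f' x, \<lambda>x. a * g x + b * g' x) \<in> sg_generator \<mu> p S"
    and sg_generator_unique_AE: "(f, g) \<in> sg_generator \<mu> p S \<Longrightarrow> (f, h) \<in> sg_generator \<mu> p S \<Longrightarrow>
      AE x in \<mu>. g x = h x"
    and sg_generator_dissipative: "contractive \<mu> p S \<Longrightarrow> (f, g) \<in> sg_generator \<mu> p S \<Longrightarrow> 0 < lam \<Longrightarrow>
      lam * Lp_norm \<mu> p f \<le> Lp_norm \<mu> p (\<lambda>x. lam * f x - g x)"
proof -
  define q where "q = p / (p - 1)"
  interpret Lp_embedding \<mu> p q
    using p by unfold_locales (auto simp: q_def field_simps)
  interpret L: semigroup_on space_emb "lift S" by (rule semigroup_lift[OF S])
  have Lp: "f \<in> Lp_space \<mu> p" "g \<in> Lp_space \<mu> p" if "(f, g) \<in> sg_generator \<mu> p S" for f g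
    using that by (auto simp: sg_generator_def)
  have emb_gen: "(emb f, emb g) \<in> L.gen" if "(f, g) \<in> sg_generator \<mu> p S" for f g
    using that Lp gen_lift_iff[OF S] by blast
  show "(\<lambda>x. a * f x + b * f' x, \<lambda>x. a * g x + b * g' x) \<in> sg_generator \<mu> p S"
    if fg: "(f, g) \<in> sg_generator \<mu> p S" "(f', g') \<in> sg_generator \<mu> p S"
  proof -
    have "(emb (\<lambda>x. a * f x + b * f' x), emb (\<lambda>x. a * g x + b * g' x)) \<in> L.gen"
      using L.gen_comb[OF emb_gen[OF fg(1)] emb_gen[OF fg(2)], of a b] Lp[OF fg(1)] Lp[OF fg(2)] by (simp add: emb_lin)
    then show ?thesis using gen_lift_iff[OF S] Lp[OF fg(1)] Lp[OF fg(2)] Lp_lin[OF p1] by blast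
  qed
  show "AE x in \<mu>. g x = h x" if fg: "(f, g) \<in> sg_generator \<mu> p S" "(f, h) \<in> sg_generator \<mu> p S"
    using L.gen_unique[OF emb_gen[OF fg(1)] emb_gen[OF fg(2)]] emb_eq_iff Lp[OF fg(1)] Lp[OF fg(2)] by blast
  show "lam * Lp_norm \<mu> p f \<le> Lp_norm \<mu> p (\<lambda>x. lam * f x - g x)"
    if "contractive \<mu> p S" and fg: "(f, g) \<in> sg_generator \<mu> p S" and lam: "0 < lam"
  proof -
    interpret L: contraction_semigroup_on space_emb "lift S" by (rule contraction_lift[OF S that(1)])
    have "norm (lam *\<^sub>R emb f - emb g) = Lp_norm \<mu> p (\<lambda>x. lam * f x - g x)"
      using emb_lin[OF Lp[OF fg], of lam "- 1"] norm_emb[OF Lp_lin[OF p1 Lp[OF fg], of lam "- 1"]] by simp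
    then show ?thesis using L.gen_dissipative[OF emb_gen[OF fg] lam] norm_emb[OF Lp(1)[OF fg]] by simp
  qed
qed

text \<open>
  If \<open>L\<^sup>p\<close>-uniqueness holds on \<open>V\<close>, then \<open>V\<close> is a core: a competing semigroup on the embedded space is
  lowered to a competing semigroup on functions, so \<open>unique_extension_imp_dense_range\<close> applies. The
  conclusion expresses the approximation in the norm of \<open>(lam - A) f\<close>.
\<close>

lemma Lp_unique_imp_core:
  assumes p: "1 < p" and lam: "0 < lam"
    and Q: "c0_semigroup \<mu> p Q" "contractive \<mu> p Q"
    and V: "fun_subspace V"
    and uniq: "Lp_unique \<mu> p (op_restrict (sg_generator \<mu> p Q) V)"
    and fg: "(f, g) \<in> sg_generator \<mu> p Q" and e: "0 < e"
  shows "\<exists>(f', g')\<in>op_restrict (sg_generator \<mu> p Q) V.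
    Lp_norm \<mu> p (\<lambda>x. lam * (f x - f' x) - (g x - g' x)) < e"
proof -
  define q where "q = p / (p - 1)"
  interpret Lp_embedding \<mu> p q
    using p by unfold_locales (auto simp: q_def field_simps)
  let ?G = "op_restrict (sg_generator \<mu> p Q) V"
  interpret L: contraction_semigroup_on space_emb "lift Q" by (rule contraction_lift[OF Q])
  note gen_eq = gen_lift_eq[OF Q(1)]
  define D where "D = map_prod emb emb ` ?G"
  have G_Lp: "f \<in> Lp_space \<mu> p \<and> g \<in> Lp_space \<mu> p" if "(f, g) \<in> sg_generator \<mu> p Q" for f g
    using that by (simp add: sg_generator_def)
  have D_gen: "D \<subseteq> L.gen" unfolding D_def gen_eq by (auto simp: op_restrict_def)
  have G_lin: "(\<lambda>x. a * f x + b * f' x, \<lambda>x. a * g x + b * g' x) \<in> ?G" if "(f, g) \<in> ?G" "(f', g') \<in> ?G" for a b f g f' g'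
  proof -
    have in_gen: "(f, g) \<in> sg_generator \<mu> p Q" "(f', g') \<in> sg_generator \<mu> p Q" and V': "f \<in> V" "f' \<in> V"
      using that by (auto simp: op_restrict_def)
    have "(\<lambda>x. a * f x + b * f' x, \<lambda>x. a * g x + b * g' x) \<in> sg_generator \<mu> p Q"
      by (rule sg_generator_lin[OF p Q(1) in_gen])
    moreover have "(\<lambda>x. a * f x + b * f' x) \<in> V" using V V' by (simp add: fun_subspace_def)
    ultimately show ?thesis by (simp add: op_restrict_def)
  qed
  have densG: "Lp_dense \<mu> p (Domain ?G)" using uniq by (simp add: Lp_unique_def)
  have ne: "?G \<noteq> {}"
  proof -
    have "\<exists>g\<in>Domain ?G. Lp_norm \<mu> p (\<lambda>x. 0 - g x) < 1"
    proof -
      have "\<forall>f\<in>Lp_space \<mu> p. \<forall>\<epsilon>>0. \<exists>g\<in>Domain ?G. Lp_norm \<mu> p (\<lambda>x. f x - g x) < \<epsilon>"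
        using densG[unfolded Lp_dense_def] by (rule conjunct2)
      from this[rule_format, OF Lp_zero(1)[OF p0] zero_less_one] show ?thesis .
    qed
    then show ?thesis by auto
  qed
  have subD: "subspace D"
    unfolding subspace_def
  proof (intro conjI ballI allI)
    obtain f g where fg: "(f, g) \<in> ?G" using ne by auto
    then have Lp: "f \<in> Lp_space \<mu> p" "g \<in> Lp_space \<mu> p" using G_Lp by (auto simp: op_restrict_def)
    have "(emb (\<lambda>x. 0 * f x + 0 * f x), emb (\<lambda>x. 0 * g x + 0 * g x)) \<in> D"
      unfolding D_def using G_lin[OF fg fg, of 0 0] by force
    then show "0 \<in> D" unfolding emb_lin[OF Lp(1) Lp(1)] emb_lin[OF Lp(2) Lp(2)] by (simp add: zero_prod_def)
  next
    fix x y assume "x \<in> D" "y \<in> D"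
    then obtain f g f' g' where *: "(f, g) \<in> ?G" "(f', g') \<in> ?G" "x = (emb f, emb g)" "y = (emb f', emb g')"
      by (auto simp: D_def)
    then have Lp: "f \<in> Lp_space \<mu> p" "g \<in> Lp_space \<mu> p" "f' \<in> Lp_space \<mu> p" "g' \<in> Lp_space \<mu> p"
      using G_Lp by (auto simp: op_restrict_def)
    have "(emb (\<lambda>x. 1 * f x + 1 * f' x), emb (\<lambda>x. 1 * g x + 1 * g' x)) \<in> D"
      unfolding D_def using G_lin[OF *(1,2), of 1 1] by force
    then show "x + y \<in> D" unfolding emb_lin[OF Lp(1,3)] emb_lin[OF Lp(2,4)] using * by simp
  next
    fix c x assume "x \<in> D"
    then obtain f g where *: "(f, g) \<in> ?G" "x = (emb f, emb g)" by (auto simp: D_def)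
    then have Lp: "f \<in> Lp_space \<mu> p" "g \<in> Lp_space \<mu> p" using G_Lp by (auto simp: op_restrict_def)
    have "(emb (\<lambda>x. c * f x + 0 * f x), emb (\<lambda>x. c * g x + 0 * g x)) \<in> D"
      unfolding D_def using G_lin[OF *(1) *(1), of c 0] by force
    then show "c *\<^sub>R x \<in> D" unfolding emb_lin[OF Lp(1) Lp(1)] emb_lin[OF Lp(2) Lp(2)] using * by simp
  qed
  have dens: "space_emb \<subseteq> closure (Domain L.gen)"
    by (rule dense_Domain_gen_lift[OF Q(1) _ densG]) (auto simp: op_restrict_def)
  have uniq': "R t x = lift Q t x"
    if R: "semigroup_on space_emb R" "D \<subseteq> semigroup_on.gen space_emb R" and t: "0 \<le> t" and x: "x \<in> space_emb" for R t x
  proof -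
    interpret R: semigroup_on space_emb R by fact
    note c0 = c0_semigroup_lower(1)[OF R(1)] and lw = c0_semigroup_lower(2)[OF R(1)]
    interpret R': semigroup_on space_emb "lift (lower R)" by (rule semigroup_lift[OF c0])
    have R'gen: "R.gen \<subseteq> R'.gen"
    proof
      fix z assume "z \<in> R.gen"
      then obtain a b where ab: "z = (a, b)" "a \<in> space_emb" "b \<in> space_emb" "((\<lambda>t. (R t a - a) /\<^sub>R t) \<longlongrightarrow> b) (at_right 0)"
        by (auto simp: R.gen_def)
      have "\<forall>\<^sub>F t in at_right 0. (R t a - a) /\<^sub>R t = (lift (lower R) t a - a) /\<^sub>R t"
        using eventually_at_right_less[of "0::real"] by eventually_elim (simp add: lw ab)
      with ab(4) have "((\<lambda>t. (lift (lower R) t a - a) /\<^sub>R t) \<longlongrightarrow> b) (at_right 0)" by (rule Lim_transform_eventually)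
      then show "z \<in> R'.gen" using ab by (simp add: R'.gen_def)
    qed
    have "?G \<subseteq> sg_generator \<mu> p (lower R)"
    proof
      fix z assume z: "z \<in> ?G"
      obtain f g where fg: "z = (f, g)" by force
      then have Lp: "f \<in> Lp_space \<mu> p" "g \<in> Lp_space \<mu> p" using z G_Lp by (auto simp: op_restrict_def)
      have "(emb f, emb g) \<in> D" using z fg by (force simp: D_def)
      then have "(emb f, emb g) \<in> R'.gen" using R(2) R'gen by blast
      then show "z \<in> sg_generator \<mu> p (lower R)" using gen_lift_iff[OF c0 Lp] fg by blast
    qed
    moreover have "?G \<subseteq> sg_generator \<mu> p Q" by (auto simp: op_restrict_def)
    ultimately have *: "AE x in \<mu>. lower R t f x = Q t f x" if "f \<in> Lp_space \<mu> p" for f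
      using uniq c0 Q(1) t that unfolding Lp_unique_def by blast
    obtain f where f: "f \<in> Lp_space \<mu> p" "x = emb f" using x by (auto simp: space_emb_def)
    have "R t x = emb (lower R t f)" using lw[OF t x] lift_emb[OF c0 t f(1)] f by simp
    also have "\<dots> = emb (Q t f)"
      using * f t by (subst emb_eq_iff) (auto intro!: S_mem[OF c0] S_mem[OF Q(1)])
    also have "\<dots> = lift Q t x" using lift_emb[OF Q(1) t f(1)] f by simp
    finally show ?thesis .
  qed
  have fgLp: "f \<in> Lp_space \<mu> p" "g \<in> Lp_space \<mu> p" using G_Lp[OF fg] by auto
  have "space_emb \<subseteq> closure ((\<lambda>(x, y). lam *\<^sub>R x - y) ` D)"
    by (rule L.unique_extension_imp_dense_range[OF lam dens subD D_gen]) (rule uniq')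
  moreover have "lam *\<^sub>R emb f - emb g \<in> space_emb"
    using fgLp by (intro L.X_diff L.X_scale emb_mem)
  ultimately have "lam *\<^sub>R emb f - emb g \<in> closure ((\<lambda>(x, y). lam *\<^sub>R x - y) ` D)" by blast
  then obtain w where "w \<in> (\<lambda>(x, y). lam *\<^sub>R x - y) ` D" "dist w (lam *\<^sub>R emb f - emb g) < e"
    using e unfolding closure_approachable by blast
  then obtain f' g' where f': "(f', g') \<in> ?G" "dist (lam *\<^sub>R emb f' - emb g') (lam *\<^sub>R emb f - emb g) < e"
    by (auto simp: D_def)
  have Lp': "f' \<in> Lp_space \<mu> p" "g' \<in> Lp_space \<mu> p" using f'(1) G_Lp by (auto simp: op_restrict_def)
  show ?thesis using f' dist_resolvent_emb[OF fgLp Lp', of lam] by (intro bexI[of _ "(f', g')"]) auto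
qed

text \<open>
  Conversely, every generator that extends \<open>G\<close> is closed and hence extends the closure of \<open>G\<close>, which is
  the whole generator of \<open>Q\<close>; so \<open>semigroup_unique\<close> applies.
\<close>

lemma core_imp_Lp_unique:
  assumes p: "1 < p" and lam: "0 < lam"
    and Q: "c0_semigroup \<mu> p Q" "contractive \<mu> p Q"
    and G: "G \<subseteq> sg_generator \<mu> p Q" "Lp_dense \<mu> p (Domain G)"
    and core: "\<And>f g e. (f, g) \<in> sg_generator \<mu> p Q \<Longrightarrow> 0 < e \<Longrightarrow>
      \<exists>(f', g')\<in>G. Lp_norm \<mu> p (\<lambda>x. lam * (f x - f' x) - (g x - g' x)) < e"
  shows "Lp_unique \<mu> p G" "op_closure \<mu> p G = sg_generator \<mu> p Q"
proof -
  define q where "q = p / (p - 1)"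
  interpret Lp_embedding \<mu> p q
    using p by unfold_locales (auto simp: q_def field_simps)
  interpret L: contraction_semigroup_on space_emb "lift Q" by (rule contraction_lift[OF Q])
  note gen_eq = gen_lift_eq[OF Q(1)]
  define D where "D = map_prod emb emb ` G"
  have G_Lp: "f \<in> Lp_space \<mu> p \<and> g \<in> Lp_space \<mu> p" if "(f, g) \<in> sg_generator \<mu> p Q" for f g
    using that by (simp add: sg_generator_def)
  have D_gen: "D \<subseteq> L.gen" unfolding D_def gen_eq using G(1) by auto
  have gen_closure: "L.gen \<subseteq> closure D"
  proof (rule L.dense_range_imp_core[OF lam D_gen])
    fix x y assume "(x, y) \<in> L.gen"
    then obtain f g where fg: "(f, g) \<in> sg_generator \<mu> p Q" "x = emb f" "y = emb g" unfolding gen_eq by auto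
    have Lp: "f \<in> Lp_space \<mu> p" "g \<in> Lp_space \<mu> p" using G_Lp fg by auto
    show "lam *\<^sub>R x - y \<in> closure ((\<lambda>(x, y). lam *\<^sub>R x - y) ` D)"
      unfolding closure_approachable
    proof (intro allI impI)
      fix e :: real assume e: "e > 0"
      then obtain f' g' where f': "(f', g') \<in> G" "Lp_norm \<mu> p (\<lambda>x. lam * (f x - f' x) - (g x - g' x)) < e"
        using core[OF fg(1) e] by auto
      have Lp': "f' \<in> Lp_space \<mu> p" "g' \<in> Lp_space \<mu> p" using f'(1) G G_Lp by auto
      have "dist (lam *\<^sub>R emb f' - emb g') (lam *\<^sub>R x - y) < e"
        using f'(2) dist_resolvent_emb[OF Lp Lp', of lam] fg by simp
      then show "\<exists>z\<in>(\<lambda>(x, y). lam *\<^sub>R x - y) ` D. dist z (lam *\<^sub>R x - y) < e"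
        unfolding D_def using f'(1) by force
    qed
  qed
  have densL: "space_emb \<subseteq> closure (Domain L.gen)"
    by (rule dense_Domain_gen_lift[OF Q(1) G])
  have lift_unique: "lift S t x = lift Q t x"
    if S: "c0_semigroup \<mu> p S" "G \<subseteq> sg_generator \<mu> p S" and "0 \<le> t" "x \<in> space_emb" for S t x
  proof -
    interpret S: semigroup_on space_emb "lift S" by (rule semigroup_lift[OF S(1)])
    have "D \<subseteq> S.gen" unfolding D_def gen_lift_eq[OF S(1)] using S(2) by auto
    then have "closure D \<subseteq> S.gen" using S.closed_gen by (rule closure_minimal)
    then have "L.gen \<subseteq> S.gen" using gen_closure by blast
    from semigroup_unique[OF S.semigroup_on_axioms L.semigroup_on_axioms this densL that(3,4)] show ?thesis .
  qed
  show "Lp_unique \<mu> p G"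
    unfolding Lp_unique_def
  proof (intro conjI G(2) allI impI ballI, elim conjE)
    fix S T f and t :: real assume S: "c0_semigroup \<mu> p S" "G \<subseteq> sg_generator \<mu> p S" and T: "c0_semigroup \<mu> p T" "G \<subseteq> sg_generator \<mu> p T"
      and t: "0 \<le> t" and f: "f \<in> Lp_space \<mu> p"
    have "emb (S t f) = emb (T t f)"
      using lift_unique[OF S t emb_mem[OF f]] lift_unique[OF T t emb_mem[OF f]]
        lift_emb[OF S(1) t f] lift_emb[OF T(1) t f] by simp
    then show "AE x in \<mu>. S t f x = T t f x"
      using emb_eq_iff[OF S_mem[OF S(1) t f] S_mem[OF T(1) t f]] by blast
  qed
  show "op_closure \<mu> p G = sg_generator \<mu> p Q"
  proof (intro equalityI subsetI)
    fix z assume "z \<in> op_closure \<mu> p G"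
    then obtain f g where z: "z = (f, g)" and Lp: "f \<in> Lp_space \<mu> p" "g \<in> Lp_space \<mu> p"
      and app: "\<And>e. e > 0 \<Longrightarrow> \<exists>(f', g')\<in>G. Lp_norm \<mu> p (\<lambda>x. f x - f' x) < e \<and> Lp_norm \<mu> p (\<lambda>x. g x - g' x) < e"
      by (auto simp: op_closure_def)
    have "(emb f, emb g) \<in> closure L.gen"
      unfolding closure_approachable
    proof (intro allI impI)
      fix e :: real assume "e > 0"
      then have "e / 2 > 0" by simp
      from app[OF this] obtain f' g' where f': "(f', g') \<in> G" "Lp_norm \<mu> p (\<lambda>x. f x - f' x) < e / 2" "Lp_norm \<mu> p (\<lambda>x. g x - g' x) < e / 2"
        by auto
      have Lp': "f' \<in> Lp_space \<mu> p" "g' \<in> Lp_space \<mu> p" using f'(1) G G_Lp by auto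
      have "dist (emb f', emb g') (emb f, emb g) \<le> dist (emb f') (emb f) + dist (emb g') (emb g)"
        unfolding dist_prod_def by (simp add: sqrt_sum_squares_le_sum)
      also have "\<dots> < e"
        using f' Lp Lp' by (simp add: dist_norm norm_emb_diff Lp_norm_minus_commute[of \<mu> p f' f] Lp_norm_minus_commute[of \<mu> p g' g])
      finally show "\<exists>y\<in>L.gen. dist y (emb f, emb g) < e"
        using D_gen f'(1) by (intro bexI[of _ "(emb f', emb g')"]) (auto simp: D_def)
    qed
    then have "(emb f, emb g) \<in> L.gen" using L.closed_gen by simp
    then show "z \<in> sg_generator \<mu> p Q" using gen_lift_iff[OF Q(1) Lp] z by blast
  next
    fix z assume z: "z \<in> sg_generator \<mu> p Q"
    obtain f g where fg: "z = (f, g)" by force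
    then have Lp: "f \<in> Lp_space \<mu> p" "g \<in> Lp_space \<mu> p" using z G_Lp by auto
    have cl: "(emb f, emb g) \<in> closure D" using gen_closure z fg unfolding gen_eq by force
    have "\<exists>(f', g')\<in>G. Lp_norm \<mu> p (\<lambda>x. f x - f' x) < e \<and> Lp_norm \<mu> p (\<lambda>x. g x - g' x) < e" if e: "e > 0" for e
    proof -
      obtain w where "w \<in> D" "dist w (emb f, emb g) < e" using cl e unfolding closure_approachable by blast
      then obtain f' g' where f': "(f', g') \<in> G" "dist (emb f', emb g') (emb f, emb g) < e" by (auto simp: D_def)
      have Lp': "f' \<in> Lp_space \<mu> p" "g' \<in> Lp_space \<mu> p" using f'(1) G G_Lp by auto
      have "dist (emb f') (emb f) < e" "dist (emb g') (emb g) < e"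
        using dist_fst_le[of "(emb f', emb g')" "(emb f, emb g)"] dist_snd_le[of "(emb f', emb g')" "(emb f, emb g)"] f'(2) by auto
      then show ?thesis using f'(1) Lp Lp'
        by (intro bexI[of _ "(f', g')"])
          (auto simp: dist_norm norm_emb_diff Lp_norm_minus_commute[of \<mu> p f' f] Lp_norm_minus_commute[of \<mu> p g' g])
    qed
    then show "z \<in> op_closure \<mu> p G" using fg Lp by (simp add: op_closure_def)
  qed
qed

section \<open>Consistency of generators for different exponents\<close>

lemma Lp_of_L1_Linf:
  assumes r: "1 \<le> r" and f: "f \<in> Lp_space \<mu> 1" "f \<in> Linf_space \<mu>"
  shows "f \<in> Lp_space \<mu> r"
proof -
  obtain C where C: "AE x in \<mu>. \<bar>f x\<bar> \<le> C" using f(2) by (auto simp: Linf_space_def)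
  note [measurable] = Lp_spaceD(1)[OF f(1)]
  have "AE x in \<mu>. norm (\<bar>f x\<bar> powr r) \<le> norm (C powr (r - 1) * \<bar>f x\<bar> powr 1)"
    using C
  proof eventually_elim
    case (elim x)
    have "\<bar>f x\<bar> powr r = \<bar>f x\<bar> powr (r - 1) * \<bar>f x\<bar> powr 1" by (simp only: powr_add[symmetric]) simp
    also have "\<dots> \<le> C powr (r - 1) * \<bar>f x\<bar> powr 1"
      using elim r by (intro mult_right_mono powr_mono2) auto
    finally show ?case by simp
  qed
  then have "integrable \<mu> (\<lambda>x. \<bar>f x\<bar> powr r)"
    using Lp_spaceD(2)[OF f(1)]
    by (intro Bochner_Integration.integrable_bound[where f = "\<lambda>x. C powr (r - 1) * \<bar>f x\<bar> powr 1" and g = "\<lambda>x. \<bar>f x\<bar> powr r"]) auto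
  then show ?thesis using f by (auto simp: Lp_space_def)
qed

text \<open>
  Approximate the element of \<open>L\<^sup>p\<close> that norms \<open>F\<close> by elements of \<open>D\<close>.
\<close>

lemma Lp_annihilator_of_dense_eq_0:
  assumes p: "1 < p" and pq: "1 / p + 1 / q = 1" and D: "Lp_dense \<mu> p D"
    and F: "F \<in> Lp_space \<mu> q" and ann: "\<And>a. a \<in> D \<Longrightarrow> (\<integral>x. F x * a x \<partial>\<mu>) = 0"
  shows "AE x in \<mu>. F x = 0"
proof -
  have q: "1 < q"
  proof -
    have "1 / q = 1 - 1 / p" using pq by simp
    then have "0 < 1 / q" "1 / q < 1" using p by auto
    then show ?thesis by (simp add: divide_less_eq split: if_splits)
  qed
  have qp: "1 / q + 1 / p = 1" using pq by simp
  define h where "h x = sgn (F x) * \<bar>F x\<bar> powr (q - 1)" for x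
  note h = Lp_dual_element[OF q qp F, folded h_def]
  have "Lp_norm \<mu> q F powr q \<le> 0 + e" if e: "e > 0" for e
  proof -
    define d where "d = e / (Lp_norm \<mu> q F + 1)"
    have F1: "Lp_norm \<mu> q F + 1 > 0" using Lp_norm_nonneg[of \<mu> q F] by linarith
    then have d: "d > 0" using e unfolding d_def by (intro divide_pos_pos)
    obtain a where a: "a \<in> D" "Lp_norm \<mu> p (\<lambda>x. h x - a x) < d"
      using D h(1) d unfolding Lp_dense_def by blast
    have aLp: "a \<in> Lp_space \<mu> p" using a D by (auto simp: Lp_dense_def)
    have ha: "(\<lambda>x. h x - a x) \<in> Lp_space \<mu> p" using p by (intro Lp_diff_space h aLp) auto
    have "Lp_norm \<mu> q F powr q = (\<integral>x. F x * h x \<partial>\<mu>) - (\<integral>x. F x * a x \<partial>\<mu>)" using h(2) ann[OF a(1)] by simp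
    also have "\<dots> = (\<integral>x. F x * h x - F x * a x \<partial>\<mu>)"
      by (rule Bochner_Integration.integral_diff[symmetric]; rule Hoelder(1)[OF q qp F]; fact)
    also have "\<dots> = (\<integral>x. F x * (h x - a x) \<partial>\<mu>)" by (simp add: right_diff_distrib)
    also have "\<dots> \<le> Lp_norm \<mu> q F * Lp_norm \<mu> p (\<lambda>x. h x - a x)"
      using Hoelder(2)[OF q qp F ha] by linarith
    also have "\<dots> \<le> (Lp_norm \<mu> q F + 1) * d" using a F1 by (intro mult_mono) auto
    also have "\<dots> = e" using F1 unfolding d_def by simp
    finally show ?thesis by simp
  qed
  then have "Lp_norm \<mu> q F powr q \<le> 0" by (rule field_le_epsilon)
  then have "Lp_norm \<mu> q F = 0" by simp
  then show ?thesis using Lp_norm_eq_0_iff[of q F \<mu>] q F by simp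
qed

lemma Lp_limits_agree:
  assumes p: "p > 0" and r: "r > 0"
    and u: "\<And>n. (\<lambda>x. u n x - f x) \<in> Lp_space \<mu> p" "(\<lambda>n. Lp_norm \<mu> p (\<lambda>x. u n x - f x)) \<longlonglongrightarrow> 0"
    and w: "\<And>n. (\<lambda>x. w n x - g x) \<in> Lp_space \<mu> r" "(\<lambda>n. Lp_norm \<mu> r (\<lambda>x. w n x - g x)) \<longlonglongrightarrow> 0"
    and eq: "\<And>n::nat. AE x in \<mu>. u n x = w n x"
  shows "AE x in \<mu>. f x = g x"
proof -
  obtain s where s: "strict_mono s" "AE x in \<mu>. (\<lambda>n. u (s n) x - f x) \<longlonglongrightarrow> 0"
    using Lp_tendsto_AE_subseq[OF p u] by blast
  have "(\<lambda>n. Lp_norm \<mu> r (\<lambda>x. w (s n) x - g x)) \<longlonglongrightarrow> 0"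
    using LIMSEQ_subseq_LIMSEQ[OF w(2) s(1)] by (simp add: o_def)
  from Lp_tendsto_AE_subseq[OF r w(1) this]
  obtain s' where s': "strict_mono s'" "AE x in \<mu>. (\<lambda>n. w (s (s' n)) x - g x) \<longlonglongrightarrow> 0" by blast
  have "AE x in \<mu>. \<forall>n. u n x = w n x" using eq by (simp add: AE_all_countable)
  with s(2) s'(2) show ?thesis
  proof eventually_elim
    case (elim x)
    from LIMSEQ_subseq_LIMSEQ[OF elim(1) s'(1)] have "(\<lambda>n. w (s (s' n)) x - f x) \<longlonglongrightarrow> 0"
      using elim(3) by (simp add: o_def)
    then have "(\<lambda>n. w (s (s' n)) x) \<longlonglongrightarrow> f x" by (simp add: Lim_null[symmetric])
    moreover have "(\<lambda>n. w (s (s' n)) x) \<longlonglongrightarrow> g x" using elim(2) by (simp add: Lim_null[symmetric])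
    ultimately show ?case by (rule LIMSEQ_unique)
  qed
qed

text \<open>
  With \<open>h = t / n\<close>, the telescoping sum of \<open>S (k * h)\<close> applied to \<open>S h f - f\<close> writes \<open>S t f - f - t * g\<close> as the
  sum of \<open>S (k * h) (S h f - f - h * g)\<close> plus the sum of \<open>h * (S (k * h) g - g)\<close>, over \<open>k < n\<close>. The first
  part tends to zero in \<open>L\<^sup>q\<close> as \<open>n\<close> grows, by the contraction property and the definition of the
  generator. The second part is bounded in \<open>L\<^sup>r\<close> by \<open>t\<close> times the oscillation of \<open>T s g\<close> for \<open>s \<le> t\<close>. By
  Fatou's lemma the bound passes to the left-hand side, and the oscillation vanishes as \<open>t\<close> tends to
  zero.
\<close>

lemma generator_consistent:
  assumes q: "1 \<le> q" and r: "1 \<le> r"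
    and S: "c0_semigroup \<mu> q S" "contractive \<mu> q S" and T: "c0_semigroup \<mu> r T"
    and agree: "\<And>t f. 0 \<le> t \<Longrightarrow> f \<in> Lp_space \<mu> 1 \<Longrightarrow> f \<in> Linf_space \<mu> \<Longrightarrow> AE x in \<mu>. S t f x = T t f x"
    and f: "f \<in> Lp_space \<mu> 1" "f \<in> Linf_space \<mu>" and g: "g \<in> Lp_space \<mu> 1" "g \<in> Linf_space \<mu>"
    and fg: "(f, g) \<in> sg_generator \<mu> q S"
  shows "(f, g) \<in> sg_generator \<mu> r T"
proof -
  have q0: "q > 0" and r0: "r > 0" using q r by auto
  have fq: "f \<in> Lp_space \<mu> q" and gq: "g \<in> Lp_space \<mu> q" and fr: "f \<in> Lp_space \<mu> r" and gr: "g \<in> Lp_space \<mu> r"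
    using Lp_of_L1_Linf f g q r by blast+
  note Smem = c0_semigroupD(1)[OF S(1)] and Tmem = c0_semigroupD(1)[OF T]
  have key: "Lp_norm \<mu> r (\<lambda>x. T t f x - f x - t * g x) \<le> t * \<delta>"
    if t: "0 < t" and \<delta>: "\<And>s. 0 \<le> s \<Longrightarrow> s \<le> t \<Longrightarrow> Lp_norm \<mu> r (\<lambda>x. T s g x - g x) \<le> \<delta>" for t \<delta>
  proof -
    have \<delta>0: "\<delta> \<ge> 0" using \<delta>[of 0] t Lp_norm_nonneg[of \<mu> r "\<lambda>x. T 0 g x - g x"] by linarith
    define \<eta> where "\<eta> h = Lp_norm \<mu> q (\<lambda>x. S h f x - f x - h * g x)" for h
    \<comment> \<open>The function \<open>b\<close> is the second part of the sum after \<open>k\<close> steps.\<close>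
    have step: "\<exists>b. b \<in> Lp_space \<mu> q \<and> b \<in> Lp_space \<mu> r \<and> Lp_norm \<mu> r b \<le> real k * h * \<delta> \<and>
        Lp_norm \<mu> q (\<lambda>x. S (real k * h) f x - f x - (real k * h) * g x - b x) \<le> real k * \<eta> h"
      if h: "0 \<le> h" "real k * h \<le> t" for h k
      using h(2)
    proof (induction k)
      case 0
      have "AE x in \<mu>. S 0 f x - f x - 0 * g x - 0 = 0"
        using c0_semigroupD(4)[OF S(1) fq] by eventually_elim simp
      then have "Lp_norm \<mu> q (\<lambda>x. S 0 f x - f x - 0 * g x - 0) = Lp_norm \<mu> q (\<lambda>x. 0)"
        using Lp_spaceD(1)[OF Smem[OF order_refl fq]] Lp_spaceD(1)[OF fq] Lp_spaceD(1)[OF gq]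
        by (intro Lp_norm_cong_AE) auto
      then show ?case using Lp_zero[of q \<mu>] Lp_zero[of r \<mu>] q0 r0 by (intro exI[of _ "\<lambda>x. 0"]) auto
    next
      case (Suc k)
      have kh: "0 \<le> real k * h" "real k * h \<le> t" using Suc.prems h(1) by (auto simp: algebra_simps)
      define s where "s = real k * h"
      have s: "0 \<le> s" "s \<le> t" using kh by (auto simp: s_def)
      obtain b where b: "b \<in> Lp_space \<mu> q" "b \<in> Lp_space \<mu> r" "Lp_norm \<mu> r b \<le> s * \<delta>"
        "Lp_norm \<mu> q (\<lambda>x. S s f x - f x - s * g x - b x) \<le> real k * \<eta> h"
        using Suc.IH[OF kh(2)] by (auto simp: s_def)
      define c where "c x = S s g x - g x" for x
      have cq: "c \<in> Lp_space \<mu> q" unfolding c_def using s by (intro Lp_diff_space q Smem gq)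
      have Tc: "(\<lambda>x. T s g x - g x) \<in> Lp_space \<mu> r" using s by (intro Lp_diff_space r Tmem gr)
      have AEc: "AE x in \<mu>. T s g x - g x = c x"
        using agree[OF s(1) g] by eventually_elim (simp add: c_def)
      have cr: "c \<in> Lp_space \<mu> r" by (rule Lp_space_AE_cong[OF Tc Lp_spaceD(1)[OF cq] AEc])
      have "Lp_norm \<mu> r c = Lp_norm \<mu> r (\<lambda>x. T s g x - g x)"
        using Lp_norm_cong_AE[OF Lp_spaceD(1)[OF Tc] Lp_spaceD(1)[OF cq] AEc] by simp
      then have cn: "Lp_norm \<mu> r c \<le> \<delta>" using \<delta>[OF s] by simp
      define b' where "b' x = b x + h * c x" for x
      have b'q: "b' \<in> Lp_space \<mu> q" and b'r: "b' \<in> Lp_space \<mu> r"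
        unfolding b'_def using q0 r0 by (auto intro!: Lp_add_space[OF q] Lp_add_space[OF r] Lp_scale b cq cr)
      have "Lp_norm \<mu> r b' \<le> Lp_norm \<mu> r b + Lp_norm \<mu> r (\<lambda>x. h * c x)"
        unfolding b'_def using r0 by (intro Lp_norm_triangle r b Lp_scale cr)
      also have "\<dots> \<le> s * \<delta> + h * \<delta>"
        using b(3) cn h(1) by (simp add: Lp_scale(2)[OF r0 cr] add_mono mult_left_mono)
      finally have b'n: "Lp_norm \<mu> r b' \<le> real (Suc k) * h * \<delta>" by (simp add: s_def algebra_simps)
      define d where "d x = S h f x - f x - h * g x" for x
      have Shf: "S h f \<in> Lp_space \<mu> q" by (rule Smem[OF h(1) fq])
      have fhg: "(\<lambda>x. 1 * f x + h * g x) \<in> Lp_space \<mu> q" by (rule Lp_lin[OF q fq gq])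
      have d: "d \<in> Lp_space \<mu> q"
      proof -
        have "d = (\<lambda>x. S h f x - (1 * f x + h * g x))" by (auto simp: d_def)
        then show ?thesis using Lp_diff_space[OF q Shf fhg] by simp
      qed
      define m where "m x = S s f x - f x - s * g x - b x" for x
      have m: "m \<in> Lp_space \<mu> q"
      proof -
        have "m = (\<lambda>x. (S s f x - (1 * f x + s * g x)) - b x)" by (auto simp: m_def)
        then show ?thesis
          by (simp only:) (intro Lp_diff_space[OF q] Lp_lin[OF q] Smem fq gq b(1) s(1))
      qed
      have AE1: "AE x in \<mu>. S (s + h) f x = S s (S h f) x" by (rule c0_semigroupD(5)[OF S(1) s(1) h(1) fq])
      have eqS: "(\<lambda>x. 1 * d x + 1 * (1 * f x + h * g x)) = S h f" by (auto simp: d_def)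
      have AE2: "AE x in \<mu>. S s (S h f) x = 1 * S s d x + 1 * S s (\<lambda>x. 1 * f x + h * g x) x"
        using c0_semigroupD(2)[OF S(1) s(1) d fhg, of 1 1] unfolding eqS .
      have AE3: "AE x in \<mu>. S s (\<lambda>x. 1 * f x + h * g x) x = 1 * S s f x + h * S s g x"
        by (rule c0_semigroupD(2)[OF S(1) s(1) fq gq])
      have "AE x in \<mu>. S (s + h) f x - f x - (s + h) * g x - b' x = m x + S s d x"
        using AE1 AE2 AE3 by eventually_elim (simp add: m_def b'_def c_def algebra_simps)
      then have "Lp_norm \<mu> q (\<lambda>x. S (s + h) f x - f x - (s + h) * g x - b' x) = Lp_norm \<mu> q (\<lambda>x. m x + S s d x)"
        using Lp_spaceD(1)[OF Smem[of "s + h", OF _ fq]] Lp_spaceD(1)[OF fq] Lp_spaceD(1)[OF gq] Lp_spaceD(1)[OF b'q]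
          Lp_spaceD(1)[OF m] Lp_spaceD(1)[OF Smem[OF s(1) d]] s h(1)
        by (intro Lp_norm_cong_AE) auto
      also have "\<dots> \<le> Lp_norm \<mu> q m + Lp_norm \<mu> q (S s d)"
        by (intro Lp_norm_triangle q m Smem s d)
      also have "\<dots> \<le> real k * \<eta> h + \<eta> h"
        using b(4) S(2) s(1) d unfolding contractive_def \<eta>_def m_def d_def by (intro add_mono) blast+
      finally have "Lp_norm \<mu> q (\<lambda>x. S (real (Suc k) * h) f x - f x - (real (Suc k) * h) * g x - b' x) \<le> real (Suc k) * \<eta> h"
        by (simp add: s_def algebra_simps)
      then show ?case using b'q b'r b'n by blast
    qed
    define G where "G x = S t f x - f x - t * g x" for x
    have G: "G \<in> Lp_space \<mu> q"
    proof -
      have "G = (\<lambda>x. S t f x - (1 * f x + t * g x))" by (auto simp: G_def)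
      then show ?thesis
        by (simp only:) (intro Lp_diff_space[OF q] Lp_lin[OF q] Smem fq gq less_imp_le[OF t])
    qed
    define good where "good n b \<longleftrightarrow> b \<in> Lp_space \<mu> q \<and> b \<in> Lp_space \<mu> r \<and> Lp_norm \<mu> r b \<le> t * \<delta> \<and>
        Lp_norm \<mu> q (\<lambda>x. G x - b x) \<le> real (Suc n) * \<eta> (t / real (Suc n))" for n b
    have "\<exists>b. good n b" for n
    proof -
      have "real (Suc n) * (t / real (Suc n)) = t" by simp
      then show ?thesis
        using step[of "t / real (Suc n)" "Suc n"] t unfolding G_def good_def by (simp del: of_nat_Suc)
    qed
    then obtain b where "\<And>n. good n (b n)" by metis
    then have b: "\<And>n. b n \<in> Lp_space \<mu> q" "\<And>n. b n \<in> Lp_space \<mu> r" "\<And>n. Lp_norm \<mu> r (b n) \<le> t * \<delta>"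
      "\<And>n. Lp_norm \<mu> q (\<lambda>x. G x - b n x) \<le> real (Suc n) * \<eta> (t / real (Suc n))"
      unfolding good_def by blast+
    have "(\<lambda>n. real (Suc n) * \<eta> (t / real (Suc n))) \<longlonglongrightarrow> 0"
    proof -
      have "filterlim (\<lambda>n. t / real (Suc n)) (at_right 0) sequentially"
        unfolding filterlim_at
      proof (intro conjI)
        show "(\<lambda>n. t / real (Suc n)) \<longlonglongrightarrow> 0"
          by (rule LIMSEQ_Suc[OF lim_const_over_n])
      qed (use t in auto)
      moreover have "((\<lambda>h. Lp_norm \<mu> q (\<lambda>x. (S h f x - f x) / h - g x)) \<longlongrightarrow> 0) (at_right 0)"
        using fg by (simp add: sg_generator_def)
      ultimately have "(\<lambda>n. Lp_norm \<mu> q (\<lambda>x. (S (t / real (Suc n)) f x - f x) / (t / real (Suc n)) - g x)) \<longlonglongrightarrow> 0"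
        by (rule filterlim_compose[rotated])
      then have "(\<lambda>n. t * Lp_norm \<mu> q (\<lambda>x. (S (t / real (Suc n)) f x - f x) / (t / real (Suc n)) - g x)) \<longlonglongrightarrow> 0"
        by (rule tendsto_mult_right_zero)
      moreover have "t * Lp_norm \<mu> q (\<lambda>x. (S (t / real (Suc n)) f x - f x) / (t / real (Suc n)) - g x) =
          real (Suc n) * \<eta> (t / real (Suc n))" for n
      proof -
        define h where "h = t / real (Suc n)"
        have h: "h > 0" "real (Suc n) * h = t" using t by (auto simp: h_def)
        have feq: "(\<lambda>x. S h f x - f x - h * g x) = (\<lambda>x. h * ((S h f x - f x) / h - g x))"
          using h by (intro ext) (simp add: field_simps)
        have "(\<lambda>x. (S h f x - f x) / h - g x) = (\<lambda>x. (1/h) * (S h f x - f x) + (- 1) * g x)" by auto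
        also have "\<dots> \<in> Lp_space \<mu> q" using h by (intro Lp_lin q Lp_diff_space Smem fq gq) auto
        finally have "\<eta> h = h * Lp_norm \<mu> q (\<lambda>x. (S h f x - f x) / h - g x)"
          unfolding \<eta>_def feq using h by (simp add: Lp_scale(2)[OF q0])
        then show ?thesis unfolding h_def[symmetric] using h by (simp add: mult.assoc[symmetric] del: of_nat_Suc)
      qed
      ultimately show ?thesis by simp
    qed
    then have "(\<lambda>n. Lp_norm \<mu> q (\<lambda>x. G x - b n x)) \<longlonglongrightarrow> 0"
      by (rule Lim_null_comparison[rotated]) (use b(4) in simp)
    from Lp_tendsto_AE_subseq[OF q0 Lp_diff_space[OF q G b(1)] this]
    obtain s where s: "AE x in \<mu>. (\<lambda>n. G x - b (s n) x) \<longlonglongrightarrow> 0" by blast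
    then have "AE x in \<mu>. (\<lambda>n. b (s n) x) \<longlonglongrightarrow> G x"
    proof eventually_elim
      case (elim x)
      from tendsto_diff[OF tendsto_const[of "G x"] elim] show ?case by simp
    qed
    from Lp_Fatou[OF r0 b(2) Lp_spaceD(1)[OF G] this, of "t * \<delta>"] have Gr: "G \<in> Lp_space \<mu> r" "Lp_norm \<mu> r G \<le> t * \<delta>"
      using b(3) t \<delta>0 by auto
    have "AE x in \<mu>. T t f x - f x - t * g x = G x"
      using agree[OF less_imp_le[OF t] f] by eventually_elim (simp add: G_def)
    then have "Lp_norm \<mu> r (\<lambda>x. T t f x - f x - t * g x) = Lp_norm \<mu> r G"
      using Lp_spaceD(1)[OF Tmem[OF less_imp_le[OF t] fr]] Lp_spaceD(1)[OF fr] Lp_spaceD(1)[OF gr] Lp_spaceD(1)[OF Gr(1)]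
      by (intro Lp_norm_cong_AE) auto
    then show ?thesis using Gr(2) by simp
  qed
  have "((\<lambda>t. Lp_norm \<mu> r (\<lambda>x. (T t f x - f x) / t - g x)) \<longlongrightarrow> 0) (at_right 0)"
  proof (rule tendstoI)
    fix e :: real assume "e > 0"
    then have e2: "e / 2 > 0" by simp
    from tendstoD[OF c0_semigroupD(6)[OF T gr] e2]
    obtain d where d: "d > 0" "\<And>s. 0 < s \<Longrightarrow> s < d \<Longrightarrow> Lp_norm \<mu> r (\<lambda>x. T s g x - g x) < e / 2"
      by (auto simp: eventually_at_right_field)
    have T0: "Lp_norm \<mu> r (\<lambda>x. T 0 g x - g x) = 0"
    proof -
      have "AE x in \<mu>. T 0 g x - g x = 0" using c0_semigroupD(4)[OF T gr] by eventually_elim simp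
      then show ?thesis using Lp_norm_eq_0_iff[OF r0 Lp_diff_space[OF r Tmem[OF order_refl gr] gr]] by simp
    qed
    have "Lp_norm \<mu> r (\<lambda>x. (T t f x - f x) / t - g x) < e" if t: "0 < t" "t < d" for t
    proof -
      have le: "Lp_norm \<mu> r (\<lambda>x. T t f x - f x - t * g x) \<le> t * (e / 2)"
      proof (rule key[OF t(1)])
        fix s assume "0 \<le> s" "s \<le> t"
        then show "Lp_norm \<mu> r (\<lambda>x. T s g x - g x) \<le> e / 2"
          using d(2)[of s] t T0 e2 by (cases "s = 0") auto
      qed
      have "(\<lambda>x. T t f x - f x - t * g x) = (\<lambda>x. T t f x - (1 * f x + t * g x))" by auto
      also have "\<dots> \<in> Lp_space \<mu> r"
        by (intro Lp_diff_space[OF r] Lp_lin[OF r] Tmem fr gr less_imp_le[OF t(1)])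
      finally have mem: "(\<lambda>x. T t f x - f x - t * g x) \<in> Lp_space \<mu> r" .
      have "(\<lambda>x. (T t f x - f x) / t - g x) = (\<lambda>x. (1 / t) * (T t f x - f x - t * g x))"
        using t by (simp add: field_simps)
      then have "Lp_norm \<mu> r (\<lambda>x. (T t f x - f x) / t - g x) = (1 / t) * Lp_norm \<mu> r (\<lambda>x. T t f x - f x - t * g x)"
        using Lp_scale(2)[OF r0 mem, of "1 / t"] t by simp
      also have "\<dots> \<le> (1 / t) * (t * (e / 2))" using le t by (intro mult_left_mono) auto
      also have "\<dots> < e" using t \<open>e > 0\<close> by simp
      finally show ?thesis .
    qed
    then show "\<forall>\<^sub>F t in at_right 0. dist (Lp_norm \<mu> r (\<lambda>x. (T t f x - f x) / t - g x)) 0 < e"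
      unfolding eventually_at_right_field using d(1) by (intro exI[of _ d]) auto
  qed
  then show ?thesis using fr gr by (simp add: sg_generator_def)
qed

text \<open>
  Restricting to rational \<open>c\<close> allows a family of almost everywhere inequalities to be combined into
  one.
\<close>

lemma discriminant_of_rational_nonneg:
  fixes a b d :: real
  assumes a: "0 \<le> a" and d: "0 \<le> d" and nn: "\<And>c. c \<in> \<rat> \<Longrightarrow> 0 \<le> a + 2 * c * b + c\<^sup>2 * d"
  shows "\<bar>b\<bar> \<le> sqrt a * sqrt d"
proof -
  have "closed {c. 0 \<le> a + 2 * c * b + c\<^sup>2 * d}" by (intro closed_Collect_le continuous_intros)
  moreover have "\<rat> \<subseteq> {c. 0 \<le> a + 2 * c * b + c\<^sup>2 * d}" using nn by auto
  ultimately have "closure \<rat> \<subseteq> {c. 0 \<le> a + 2 * c * b + c\<^sup>2 * d}" by (intro closure_minimal)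
  then have nn: "0 \<le> a + 2 * c * b + c\<^sup>2 * d" for c using Rats_closure_real by auto
  have "b\<^sup>2 \<le> a * d"
  proof (cases "d = 0")
    case True
    have "b = 0"
    proof (rule ccontr)
      assume "b \<noteq> 0"
      then show False using nn[of "- (a + 1) / (2 * b)"] True by (simp add: field_simps)
    qed
    then show ?thesis using True by simp
  next
    case False
    then have "d > 0" using d by simp
    then show ?thesis using nn[of "- b / d"] by (simp add: field_simps power2_eq_square)
  qed
  then have "\<bar>b\<bar> \<le> sqrt (a * d)" using real_le_rsqrt[of "\<bar>b\<bar>"] by simp
  then show ?thesis by (simp add: real_sqrt_mult)
qed

section \<open>Uniqueness off a closed set and null sets of the capacity\<close>

lemma fun_support_add: "fun_support (\<lambda>x. f x + g x) \<subseteq> fun_support f \<union> fun_support g"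
proof -
  have "{x. f x + g x \<noteq> 0} \<subseteq> {x. f x \<noteq> 0} \<union> {x. g x \<noteq> 0}" by auto
  from closure_mono[OF this] show ?thesis by (simp add: fun_support_def)
qed

lemma fun_subspace_supported_in:
  assumes "fun_subspace A" shows "fun_subspace (supported_in A U)"
  unfolding fun_subspace_def
proof (intro conjI ballI allI)
  show "(\<lambda>x. 0) \<in> supported_in A U" using assms by (simp add: fun_subspace_def supported_in_def fun_support_def)
next
  fix f g assume "f \<in> supported_in A U" "g \<in> supported_in A U"
  then show "(\<lambda>x. f x + g x) \<in> supported_in A U"
    using assms fun_support_add[of f g] by (auto simp: fun_subspace_def supported_in_def)
next
  fix c f assume f: "f \<in> supported_in A U"
  have "fun_support (\<lambda>x. c * f x) \<subseteq> fun_support f"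
    unfolding fun_support_def by (intro closure_mono) auto
  then show "(\<lambda>x. c * f x) \<in> supported_in A U" using assms f by (auto simp: fun_subspace_def supported_in_def)
qed

locale core_setting = local_dirichlet_setting \<mu> L DE E \<Gamma> P Q
  for \<mu> :: "'a::metric_space measure" and L DE E \<Gamma> P Q +
  fixes lam p :: real and A :: "('a \<Rightarrow> real) set"
  assumes lam: "0 < lam" and p: "1 < p"
    and A_borel: "A \<subseteq> borel_measurable borel"
    and A_subspace: "fun_subspace A"
    and A_domain: "A \<subseteq> Domain (sg_generator \<mu> p (Q p))"
    and A_unique: "Lp_unique \<mu> p (op_restrict (sg_generator \<mu> p (Q p)) A)"
begin

abbreviation "Gen \<equiv> sg_generator \<mu> p (Q p)"
abbreviation "Lop f \<equiv> op_app Gen f"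
abbreviation "gnorm f \<equiv> domain_norm \<mu> p Gen lam f"

lemma p1: "1 \<le> p" and p0: "0 < p" using p by auto

lemma Qp: "c0_semigroup \<mu> p (Q p)" "contractive \<mu> p (Q p)"
  using semigroup_Lp(1,2)[OF p1] .

lemma sets_\<mu>: "sets \<mu> = sets borel" using radon by (simp add: radon_measure_def)

lemma measurable_\<mu>: "borel_measurable \<mu> = borel_measurable borel"
  by (rule measurable_cong_sets[OF sets_\<mu> refl])

lemma G_Lp: "(f, g) \<in> Gen \<Longrightarrow> f \<in> Lp_space \<mu> p" "(f, g) \<in> Gen \<Longrightarrow> g \<in> Lp_space \<mu> p"
  by (simp_all add: sg_generator_def)

lemma Lop: "f \<in> Domain Gen \<Longrightarrow> (f, Lop f) \<in> Gen"
  unfolding op_app_def by (auto intro: someI[of "\<lambda>g. (f, g) \<in> Gen"])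

lemma resolvent_Lp: "(f, g) \<in> Gen \<Longrightarrow> (\<lambda>x. lam * f x - g x) \<in> Lp_space \<mu> p"
  using Lp_lin[OF p1 G_Lp, of f g f g lam "- 1"] by simp

lemma gnorm_eq:
  assumes "(f, g) \<in> Gen" shows "gnorm f = Lp_norm \<mu> p (\<lambda>x. lam * f x - g x)"
proof -
  have L: "(f, Lop f) \<in> Gen" using assms by (intro Lop) auto
  have "AE x in \<mu>. lam * f x - Lop f x = lam * f x - g x"
    using sg_generator_unique_AE[OF p Qp(1) L assms] by eventually_elim simp
  then show ?thesis unfolding domain_norm_def
    using Lp_spaceD(1)[OF resolvent_Lp[OF L]] Lp_spaceD(1)[OF resolvent_Lp[OF assms]] by (intro Lp_norm_cong_AE)
qed

lemma norm_le_gnorm: "f \<in> Domain Gen \<Longrightarrow> lam * Lp_norm \<mu> p f \<le> gnorm f"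
  unfolding domain_norm_def
  by (rule sg_generator_dissipative[OF p Qp(1) Qp(2) Lop lam])

lemma gnorm_nonneg: "0 \<le> gnorm f" by (simp add: domain_norm_def)

lemma gnorm_triangle:
  assumes "f \<in> Domain Gen" "g \<in> Domain Gen"
  shows "gnorm (\<lambda>x. f x + g x) \<le> gnorm f + gnorm g"
proof -
  have "(\<lambda>x. 1 * f x + 1 * g x, \<lambda>x. 1 * Lop f x + 1 * Lop g x) \<in> Gen"
    by (rule sg_generator_lin[OF p Qp(1)]) (intro Lop assms)+
  from gnorm_eq[OF this] have "gnorm (\<lambda>x. f x + g x) = Lp_norm \<mu> p (\<lambda>x. (lam * f x - Lop f x) + (lam * g x - Lop g x))"
    by (simp add: algebra_simps)
  also have "\<dots> \<le> gnorm f + gnorm g"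
    unfolding domain_norm_def by (intro Lp_norm_triangle p1 resolvent_Lp Lop assms)
  finally show ?thesis .
qed

lemma A_lin: "f \<in> A \<Longrightarrow> g \<in> A \<Longrightarrow> (\<lambda>x. a * f x + b * g x) \<in> A"
  using A_subspace by (simp add: fun_subspace_def)

lemma A_diff: "f \<in> A \<Longrightarrow> g \<in> A \<Longrightarrow> (\<lambda>x. f x - g x) \<in> A"
  using A_lin[of f g 1 "- 1"] by simp

lemma A_dom: "f \<in> A \<Longrightarrow> f \<in> Domain Gen" using A_domain by auto

lemma Lop_A: "f \<in> A \<Longrightarrow> (f, Lop f) \<in> Gen" by (intro Lop A_dom)

lemma Domain_restrict: "V \<subseteq> A \<Longrightarrow> Domain (op_restrict Gen V) = V"
  using A_domain by (auto simp: op_restrict_def)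

lemma A_dense: "Lp_dense \<mu> p A"
  using A_unique Domain_restrict[of A] by (simp add: Lp_unique_def)

lemma core_approx:
  assumes V: "fun_subspace V" "Lp_unique \<mu> p (op_restrict Gen V)" and fg: "(f, g) \<in> Gen" and e: "0 < e"
  obtains f' g' where "(f', g') \<in> Gen" "f' \<in> V" "Lp_norm \<mu> p (\<lambda>x. lam * (f x - f' x) - (g x - g' x)) < e"
  using Lp_unique_imp_core[OF p lam Qp V fg e] by (auto simp: op_restrict_def)

text \<open>
  Take a function \<open>u\<close> equal to \<open>1\<close> near the compact set \<open>K\<close>. Functions supported off \<open>S\<close> form a core, so some
  \<open>f'\<close> of them approximates \<open>u\<close> in the graph norm. The difference \<open>u - f'\<close> has small norm and is still
  equal to \<open>1\<close> near \<open>K\<close>, since \<open>f'\<close> vanishes near \<open>S\<close>.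
\<close>

lemma cap_null_of_unique:
  assumes nonempty: "\<And>K. compact K \<Longrightarrow> cap_admissible A K \<noteq> {}"
    and uniq: "Lp_unique \<mu> p (op_restrict Gen (supported_in A (- S)))"
  shows "cap \<mu> p Gen lam A S = 0"
proof -
  have "cap_compact \<mu> p Gen lam A K \<le> 0" if K: "compact K" "K \<subseteq> S" for K
  proof (rule ennreal_le_epsilon)
    fix d :: real assume d: "0 < d"
    define e where "e = d powr (1 / p)"
    have e: "e > 0" "e powr p = d" using d p0 by (auto simp: e_def powr_powr)
    obtain u U where u: "u \<in> A" "open U" "K \<subseteq> U" "\<And>x. x \<in> U \<Longrightarrow> u x = 1"
      using nonempty[OF K(1)] by (auto simp: cap_admissible_def)
    obtain f' g' where f': "(f', g') \<in> Gen" "f' \<in> supported_in A (- S)"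
      "Lp_norm \<mu> p (\<lambda>x. lam * (u x - f' x) - (Lop u x - g' x)) < e"
      using core_approx[OF fun_subspace_supported_in[OF A_subspace] uniq Lop_A[OF u(1)] e(1)] by blast
    define w where "w x = u x - f' x" for x
    have "w \<in> cap_admissible A K"
      unfolding cap_admissible_def
    proof (intro CollectI conjI exI[of _ "U \<inter> - fun_support f'"] ballI)
      show "w \<in> A" unfolding w_def using u f' by (intro A_diff) (auto simp: supported_in_def)
      show "open (U \<inter> - fun_support f')" using u by (auto simp: fun_support_def)
      show "K \<subseteq> U \<inter> - fun_support f'" using K u f' by (auto simp: supported_in_def)
      fix x assume x: "x \<in> U \<inter> - fun_support f'"
      then have "f' x = 0" using closure_subset[of "{x. f' x \<noteq> 0}"] by (auto simp: fun_support_def)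
      then show "w x = 1" using x u by (simp add: w_def)
    qed
    then have "cap_compact \<mu> p Gen lam A K \<le> ennreal (gnorm w powr p)"
      unfolding cap_compact_def by (rule INF_lower)
    also have "\<dots> \<le> ennreal (e powr p)"
    proof (intro ennreal_leI powr_mono2)
      have "(\<lambda>x. 1 * u x + (- 1) * f' x, \<lambda>x. 1 * Lop u x + (- 1) * g' x) \<in> Gen"
        by (rule sg_generator_lin[OF p Qp(1) Lop_A[OF u(1)] f'(1)])
      then have "(w, \<lambda>x. Lop u x - g' x) \<in> Gen" by (simp add: w_def[abs_def])
      from gnorm_eq[OF this] show "gnorm w \<le> e" using f'(3) by (simp add: w_def)
    qed (use p0 gnorm_nonneg in auto)
    finally show "cap_compact \<mu> p Gen lam A K \<le> 0 + ennreal d" by (simp add: e)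
  qed
  then have "cap \<mu> p Gen lam A S \<le> 0" unfolding cap_def by (intro SUP_least) auto
  then show ?thesis by simp
qed

lemma small_admissible:
  assumes cap: "cap \<mu> p Gen lam A S = 0" and K: "compact K" "K \<subseteq> S" and e: "0 < e"
  obtains u where "u \<in> cap_admissible A K" "gnorm u < e"
proof -
  have "cap_compact \<mu> p Gen lam A K \<le> cap \<mu> p Gen lam A S"
    unfolding cap_def using K by (intro SUP_upper) auto
  then have "cap_compact \<mu> p Gen lam A K < ennreal (e powr p)" using cap e by simp
  then obtain u where u: "u \<in> cap_admissible A K" "ennreal (gnorm u powr p) < ennreal (e powr p)"
    unfolding cap_compact_def INF_less_iff by auto
  then have lt: "gnorm u powr p < e powr p" using ennreal_less_iff by simp
  have "gnorm u < e"
  proof (rule ccontr)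
    assume "\<not> gnorm u < e"
    then have "e powr p \<le> gnorm u powr p" using e p0 by (intro powr_mono2) auto
    then show False using lt by simp
  qed
  then show thesis using u that by blast
qed

text \<open>
  By dissipativity the graph norm controls the \<open>L\<^sup>p\<close> norm, whose p-th power is, for an
  admissible function, at least the measure of \<open>K\<close>. Inner regularity then passes from compact sets to \<open>S\<close>.
\<close>

lemma null_of_cap_null:
  assumes cap: "cap \<mu> p Gen lam A S = 0" and S: "closed S"
  shows "emeasure \<mu> S = 0"
proof -
  have "emeasure \<mu> K \<le> 0" if K: "compact K" "K \<subseteq> S" for K
  proof (rule ennreal_le_epsilon)
    fix d :: real assume d: "0 < d"
    define e where "e = d powr (1 / p)"
    have e: "e > 0" "e powr p = d" using d p0 by (auto simp: e_def powr_powr)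
    obtain u where u: "u \<in> cap_admissible A K" "gnorm u < lam * e"
      using small_admissible[OF cap K, of "lam * e"] lam e by auto
    then have uA: "u \<in> A" and u1: "\<And>x. x \<in> K \<Longrightarrow> u x = 1" by (auto simp: cap_admissible_def)
    have uLp: "u \<in> Lp_space \<mu> p" using Lop_A[OF uA] G_Lp by blast
    have "lam * Lp_norm \<mu> p u < lam * e" using norm_le_gnorm[OF A_dom[OF uA]] u(2) by linarith
    then have "Lp_norm \<mu> p u \<le> e" using lam by simp
    have [measurable]: "K \<in> sets \<mu>" using K sets_\<mu> by (simp add: borel_compact)
    have "emeasure \<mu> K = (\<integral>\<^sup>+x. indicator K x \<partial>\<mu>)" by simp
    also have "\<dots> \<le> (\<integral>\<^sup>+x. ennreal (\<bar>u x\<bar> powr p) \<partial>\<mu>)"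
      by (intro nn_integral_mono) (auto simp: indicator_def u1)
    also have "\<dots> = ennreal (Lp_norm \<mu> p u powr p)"
      using Lp_spaceD(2)[OF uLp] p0 by (simp add: nn_integral_eq_integral Lp_norm_powr)
    also have "\<dots> \<le> ennreal (e powr p)"
      using \<open>Lp_norm \<mu> p u \<le> e\<close> p0 by (intro ennreal_leI powr_mono2) auto
    finally show "emeasure \<mu> K \<le> 0 + ennreal d" by (simp add: e)
  qed
  moreover have "emeasure \<mu> S = (SUP K\<in>{K. compact K \<and> K \<subseteq> S}. emeasure \<mu> K)"
    by (rule radon[unfolded radon_measure_def, THEN conjunct2, THEN conjunct2, THEN bspec]) (use S in simp)
  ultimately have "emeasure \<mu> S \<le> 0" by (simp only:) (intro SUP_least; auto)
  then show ?thesis by simp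
qed

text \<open>
  As \<open>A\<close> is a core, density of \<open>V\<close> in \<open>A\<close> for the graph norm suffices.
\<close>

lemma unique_of_gnorm_dense:
  assumes V: "V \<subseteq> A" and dense: "\<And>f e. f \<in> A \<Longrightarrow> 0 < e \<Longrightarrow> \<exists>f'\<in>V. gnorm (\<lambda>x. f x - f' x) < e"
  shows "Lp_unique \<mu> p (op_restrict Gen V)" "op_closure \<mu> p (op_restrict Gen V) = Gen"
proof -
  have A_Lp: "f \<in> Lp_space \<mu> p" if "f \<in> A" for f using Lop_A[OF that] G_Lp by blast
  have 1: "op_restrict Gen V \<subseteq> Gen" by (auto simp: op_restrict_def)
  have 2: "Lp_dense \<mu> p (Domain (op_restrict Gen V))"
    unfolding Domain_restrict[OF V] Lp_dense_def
  proof (intro conjI ballI allI impI)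
    show "V \<subseteq> Lp_space \<mu> p" using V A_Lp by auto
    fix f and e :: real assume f: "f \<in> Lp_space \<mu> p" and e: "0 < e"
    then have e2: "e / 2 > 0" by simp
    obtain a where a: "a \<in> A" "Lp_norm \<mu> p (\<lambda>x. f x - a x) < e / 2"
      using A_dense f e2 unfolding Lp_dense_def by blast
    obtain b where b: "b \<in> V" "gnorm (\<lambda>x. a x - b x) < lam * (e / 2)"
      using dense[OF a(1), of "lam * (e / 2)"] lam e2 by auto
    have bA: "b \<in> A" using b V by auto
    have "lam * Lp_norm \<mu> p (\<lambda>x. a x - b x) < lam * (e / 2)"
      using norm_le_gnorm[OF A_dom[OF A_diff[OF a(1) bA]]] b(2) by linarith
    then have "Lp_norm \<mu> p (\<lambda>x. a x - b x) < e / 2" using lam by simp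
    then have "Lp_norm \<mu> p (\<lambda>x. f x - b x) < e"
      using Lp_norm_triangle_diff[OF p1 f A_Lp[OF a(1)] A_Lp[OF bA]] a(2) by linarith
    then show "\<exists>g\<in>V. Lp_norm \<mu> p (\<lambda>x. f x - g x) < e" using b by blast
  qed
  have 3: "\<exists>(f', g')\<in>op_restrict Gen V. Lp_norm \<mu> p (\<lambda>x. lam * (f x - f' x) - (g x - g' x)) < e"
    if fg: "(f, g) \<in> Gen" and e: "0 < e" for f g e
  proof -
    have e2: "e / 2 > 0" using e by simp
    obtain a b where a: "(a, b) \<in> Gen" "a \<in> A" "Lp_norm \<mu> p (\<lambda>x. lam * (f x - a x) - (g x - b x)) < e / 2"
      by (rule core_approx[OF A_subspace A_unique fg e2])
    obtain a' where a': "a' \<in> V" "gnorm (\<lambda>x. a x - a' x) < e / 2" using dense[OF a(2) e2] by blast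
    have a'Gen: "(a', Lop a') \<in> Gen" using a' V Lop_A by auto
    have d1: "(\<lambda>x. 1 * f x + (- 1) * a x, \<lambda>x. 1 * g x + (- 1) * b x) \<in> Gen"
      and d2: "(\<lambda>x. 1 * a x + (- 1) * a' x, \<lambda>x. 1 * b x + (- 1) * Lop a' x) \<in> Gen"
      by (rule sg_generator_lin[OF p Qp(1)]; fact)+
    have "Lp_norm \<mu> p (\<lambda>x. lam * (f x - a' x) - (g x - Lop a' x)) =
        Lp_norm \<mu> p (\<lambda>x. (lam * (1 * f x + (- 1) * a x) - (1 * g x + (- 1) * b x)) +
          (lam * (1 * a x + (- 1) * a' x) - (1 * b x + (- 1) * Lop a' x)))"
      by (simp add: algebra_simps)
    also have "\<dots> \<le> Lp_norm \<mu> p (\<lambda>x. lam * (1 * f x + (- 1) * a x) - (1 * g x + (- 1) * b x)) +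
        Lp_norm \<mu> p (\<lambda>x. lam * (1 * a x + (- 1) * a' x) - (1 * b x + (- 1) * Lop a' x))"
      by (intro Lp_norm_triangle p1 resolvent_Lp d1 d2)
    also have "\<dots> < e"
      using a(3) a'(2) gnorm_eq[OF d2] by simp
    finally show ?thesis using a'Gen a' by (intro bexI[of _ "(a', Lop a')"]) (auto simp: op_restrict_def)
  qed
  show "Lp_unique \<mu> p (op_restrict Gen V)" "op_closure \<mu> p (op_restrict Gen V) = Gen"
    by (rule core_imp_Lp_unique[OF p lam Qp 1 2]; rule 3; assumption)+
qed

end

section \<open>Algebras of functions and the product estimate\<close>

locale algebra_core_setting = core_setting +
  assumes A_mult: "f \<in> A \<Longrightarrow> g \<in> A \<Longrightarrow> (\<lambda>x. f x * g x) \<in> A"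
    and A_bounded: "A \<subseteq> bounded_borel" and A_L1: "A \<subseteq> Lp_space \<mu> 1"
    and A_domain1: "A \<subseteq> Domain (sg_generator \<mu> 1 (Q 1))"
    and \<Gamma>_bounded: "f \<in> A \<Longrightarrow> \<Gamma> f f \<in> Linf_space \<mu>"
    and Lop_bounded: "f \<in> A \<Longrightarrow> op_app (sg_generator \<mu> p (Q p)) f \<in> Linf_space \<mu>"
begin

lemma A_Linf: "f \<in> A \<Longrightarrow> f \<in> Linf_space \<mu>"
  using A_bounded by (force simp: bounded_borel_def Linf_space_def measurable_\<mu> bounded_iff)

lemma A_Lr: "f \<in> A \<Longrightarrow> 1 \<le> r \<Longrightarrow> f \<in> Lp_space \<mu> r"
  using Lp_of_L1_Linf A_L1 A_Linf by blast

text \<open>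
  The value of the generator at \<open>f\<close> is bounded, and it coincides with the value of the generator on
  \<open>L\<^sup>1\<close> because both are limits of the same difference quotients. Hence it lies in \<open>L\<^sup>1 \<inter> L\<^sup>\<infinity>\<close>, and
  consistency brings \<open>f\<close> into the domain of the self-adjoint operator, where the form is available.
\<close>

lemma A_mem_L: 
  assumes f: "f \<in> A" shows "(f, Lop f) \<in> L" "Lop f \<in> Lp_space \<mu> 1"
proof -
  obtain g where g: "(f, g) \<in> sg_generator \<mu> 1 (Q 1)" using f A_domain1 by auto
  have Q1: "c0_semigroup \<mu> 1 (Q 1)" "contractive \<mu> 1 (Q 1)" using semigroup_Lp(1,2)[of 1] by auto
  note fL1 = A_Lr[OF f order_refl] and fLp = A_Lr[OF f p1]
  have gL1: "g \<in> Lp_space \<mu> 1" using g by (simp add: sg_generator_def)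
  define t where "t n = inverse (real (Suc n))" for n
  have t: "t n > 0" for n by (simp add: t_def)
  have tlim: "filterlim t (at_right 0) sequentially"
    unfolding filterlim_at t_def using LIMSEQ_inverse_real_of_nat by auto
  have "AE x in \<mu>. Lop f x = g x"
  proof (rule Lp_limits_agree[OF p0 zero_less_one])
    show "(\<lambda>n. Lp_norm \<mu> p (\<lambda>x. (Q p (t n) f x - f x) / t n - Lop f x)) \<longlonglongrightarrow> 0"
      by (rule filterlim_compose[OF _ tlim, of "\<lambda>s. Lp_norm \<mu> p (\<lambda>x. (Q p s f x - f x) / s - Lop f x)"])
        (use Lop_A[OF f] in \<open>simp add: sg_generator_def\<close>)
    show "(\<lambda>n. Lp_norm \<mu> 1 (\<lambda>x. (Q 1 (t n) f x - f x) / t n - g x)) \<longlonglongrightarrow> 0"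
      by (rule filterlim_compose[OF _ tlim, of "\<lambda>s. Lp_norm \<mu> 1 (\<lambda>x. (Q 1 s f x - f x) / s - g x)"])
        (use g in \<open>simp add: sg_generator_def\<close>)
    fix n
    have quot: "(\<lambda>x. (u x - f x) / t n - w x) = (\<lambda>x. (1 / t n) * (u x - f x) + (- 1) * w x)" for u w by auto
    show "(\<lambda>x. (Q p (t n) f x - f x) / t n - Lop f x) \<in> Lp_space \<mu> p"
      unfolding quot
      by (intro Lp_lin Lp_diff_space p1 c0_semigroupD(1)[OF Qp(1)] less_imp_le[OF t] fLp G_Lp(2)[OF Lop_A[OF f]])
    show "(\<lambda>x. (Q 1 (t n) f x - f x) / t n - g x) \<in> Lp_space \<mu> 1"
      unfolding quot
      by (intro Lp_lin Lp_diff_space order_refl c0_semigroupD(1)[OF Q1(1)] less_imp_le[OF t] fL1 gL1)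
    have "AE x in \<mu>. Q p (t n) f x = P (t n) f x" "AE x in \<mu>. Q 1 (t n) f x = P (t n) f x"
      using semigroup_Lp(3)[OF p1 less_imp_le[OF t] fL1 A_Linf[OF f]]
        semigroup_Lp(3)[OF order_refl less_imp_le[OF t] fL1 A_Linf[OF f]] by blast+
    then show "AE x in \<mu>. (Q p (t n) f x - f x) / t n = (Q 1 (t n) f x - f x) / t n"
      by eventually_elim simp
  qed
  then have eq: "AE x in \<mu>. g x = Lop f x" by eventually_elim simp
  have Lm: "Lop f \<in> borel_measurable \<mu>" using Lop_bounded[OF f] by (simp add: Linf_space_def)
  show L1: "Lop f \<in> Lp_space \<mu> 1" by (rule Lp_space_AE_cong[OF gL1 Lm eq])
  have "(f, Lop f) \<in> sg_generator \<mu> 2 P"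
    by (rule generator_consistent[OF p1 _ Qp semigroup(1) _ fL1 A_Linf[OF f] L1 Lop_bounded[OF f] Lop_A[OF f]])
      (auto intro: semigroup_Lp(3)[OF p1])
  then show "(f, Lop f) \<in> L" using semigroup(2) by simp
qed

lemma bounded_mult_L1:
  assumes "f \<in> Linf_space \<mu>" "g \<in> Lp_space \<mu> 1"
  shows "integrable \<mu> (\<lambda>x. f x * g x)" "(\<lambda>x. f x * g x) \<in> Lp_space \<mu> 1"
proof -
  obtain C where C: "AE x in \<mu>. \<bar>f x\<bar> \<le> C" using assms by (auto simp: Linf_space_def)
  have [measurable]: "f \<in> borel_measurable \<mu>" "g \<in> borel_measurable \<mu>"
    using assms by (auto simp: Linf_space_def Lp_space_def)
  have "integrable \<mu> (\<lambda>x. \<bar>g x\<bar>)" using Lp_spaceD(2)[OF assms(2)] by simp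
  then have int: "integrable \<mu> (\<lambda>x. C * \<bar>g x\<bar>)" by simp
  have le: "AE x in \<mu>. norm (f x * g x) \<le> norm (C * \<bar>g x\<bar>)"
    using C
  proof eventually_elim
    case (elim x)
    then have "0 \<le> C" by (meson abs_ge_zero order_trans)
    then show ?case using elim by (simp add: abs_mult mult_right_mono)
  qed
  show I: "integrable \<mu> (\<lambda>x. f x * g x)"
    by (rule Bochner_Integration.integrable_bound[OF int _ le]) measurable
  then show "(\<lambda>x. f x * g x) \<in> Lp_space \<mu> 1" by (simp add: Lp_space_def)
qed

lemma Linf_comb:
  assumes "f \<in> Linf_space \<mu>" "g \<in> Linf_space \<mu>"
  shows "(\<lambda>x. f x * g x) \<in> Linf_space \<mu>" "(\<lambda>x. a * f x + b * g x) \<in> Linf_space \<mu>"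
proof -
  obtain C D where CD: "AE x in \<mu>. \<bar>f x\<bar> \<le> C" "AE x in \<mu>. \<bar>g x\<bar> \<le> D" using assms by (auto simp: Linf_space_def)
  have [measurable]: "f \<in> borel_measurable \<mu>" "g \<in> borel_measurable \<mu>" using assms by (auto simp: Linf_space_def)
  have "AE x in \<mu>. \<bar>f x * g x\<bar> \<le> C * D"
    using CD by eventually_elim (auto simp: abs_mult intro: mult_mono')
  then show "(\<lambda>x. f x * g x) \<in> Linf_space \<mu>" by (auto simp: Linf_space_def)
  have "AE x in \<mu>. \<bar>a * f x + b * g x\<bar> \<le> \<bar>a\<bar> * C + \<bar>b\<bar> * D"
    using CD
  proof eventually_elim
    case (elim x)
    have "\<bar>a * f x + b * g x\<bar> \<le> \<bar>a\<bar> * \<bar>f x\<bar> + \<bar>b\<bar> * \<bar>g x\<bar>" by (metis abs_mult abs_triangle_ineq)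
    also have "\<dots> \<le> \<bar>a\<bar> * C + \<bar>b\<bar> * D" using elim by (intro add_mono mult_left_mono) auto
    finally show ?case .
  qed
  then show "(\<lambda>x. a * f x + b * g x) \<in> Linf_space \<mu>" by (auto simp: Linf_space_def)
qed

lemma A_form: "f \<in> A \<Longrightarrow> f \<in> DE \<inter> Linf_space \<mu>"
  using A_mem_L(1)[of f] form_of_operator(1) A_Linf by blast

lemma \<Gamma>_L1: "f \<in> DE \<Longrightarrow> g \<in> DE \<Longrightarrow> \<Gamma> f g \<in> Lp_space \<mu> 1"
  using carre_du_champ[unfolded carre_du_champ_def Let_def, THEN conjunct1] by simp

lemma \<Gamma>_form_nonneg: "f \<in> DE \<inter> Linf_space \<mu> \<Longrightarrow> AE x in \<mu>. 0 \<le> \<Gamma> f f x"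
  using carre_du_champ[unfolded carre_du_champ_def Let_def, THEN conjunct2, THEN conjunct2, THEN conjunct1] by simp

lemma \<Gamma>_identity:
  "f \<in> DE \<inter> Linf_space \<mu> \<Longrightarrow> g \<in> DE \<inter> Linf_space \<mu> \<Longrightarrow> h \<in> DE \<inter> Linf_space \<mu> \<Longrightarrow>
    1 / 2 * (E (\<lambda>x. f x * h x) g + E f (\<lambda>x. g x * h x) - E (\<lambda>x. f x * g x) h) = (\<integral>x. h x * \<Gamma> f g x \<partial>\<mu>)"
  using carre_du_champ[unfolded carre_du_champ_def Let_def, THEN conjunct2, THEN conjunct2, THEN conjunct2, THEN conjunct1]
  by blast

lemma E_eq: "f \<in> A \<Longrightarrow> h \<in> A \<Longrightarrow> E f h = - (\<integral>x. Lop f x * h x \<partial>\<mu>)"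
  using form_of_operator(2)[OF A_mem_L(1), of f h] A_form[of h] by (simp add: L2_inner_def)

lemma E_sym: "f \<in> A \<Longrightarrow> h \<in> A \<Longrightarrow> E f h = E h f"
  using dirichlet A_form[of f] A_form[of h] by (simp add: dirichlet_form_def closed_form_def)

text \<open>
  Test functions in the defining identity of \<open>\<Gamma>\<close> are taken from \<open>A\<close> only: \<open>A\<close> is an algebra contained in
  the domain of the operator, so every term of the identity is an integral against the operator, and
  \<open>A\<close> is dense in \<open>L\<^sup>p\<close>, while the function tested lies in \<open>L\<^sup>1 \<inter> L\<^sup>\<infinity>\<close> and thus in the dual space.
\<close>

lemma square_rule:
  assumes f: "f \<in> A"
  shows "AE x in \<mu>. \<Gamma> f f x = 1/2 * Lop (\<lambda>x. f x * f x) x - f x * Lop f x"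
proof -
  define g where "g = Lop f"
  define g2 where "g2 = Lop (\<lambda>x. f x * f x)"
  have ff: "(\<lambda>x. f x * f x) \<in> A" by (rule A_mult[OF f f])
  have g: "g \<in> Lp_space \<mu> 1" "g \<in> Linf_space \<mu>" and g2: "g2 \<in> Lp_space \<mu> 1" "g2 \<in> Linf_space \<mu>"
    using A_mem_L(2)[OF f] A_mem_L(2)[OF ff] Lop_bounded[OF f] Lop_bounded[OF ff] by (auto simp: g_def g2_def)
  have \<Gamma>1: "\<Gamma> f f \<in> Lp_space \<mu> 1" using A_form[OF f] by (intro \<Gamma>_L1) auto
  note \<Gamma>i = \<Gamma>_bounded[OF f]
  have fg: "(\<lambda>x. f x * g x) \<in> Lp_space \<mu> 1" "(\<lambda>x. f x * g x) \<in> Linf_space \<mu>"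
    using bounded_mult_L1(2)[OF A_Linf[OF f] g(1)] Linf_comb(1)[OF A_Linf[OF f] g(2)] by auto
  define R where "R x = 1/2 * g2 x + (- 1) * (f x * g x)" for x
  have R: "R \<in> Lp_space \<mu> 1" "R \<in> Linf_space \<mu>"
    unfolding R_def by (intro Lp_lin order_refl g2 fg Linf_comb(2))+
  define F where "F x = 1 * R x + (- 1) * \<Gamma> f f x" for x
  have F: "F \<in> Lp_space \<mu> 1" "F \<in> Linf_space \<mu>"
    unfolding F_def by (intro Lp_lin order_refl R \<Gamma>1 Linf_comb(2) \<Gamma>i)+
  define q where "q = p / (p - 1)"
  have q: "1 / p + 1 / q = 1" "1 \<le> q" using p by (auto simp: q_def field_simps)
  have ann: "(\<integral>x. F x * h x \<partial>\<mu>) = 0" if h: "h \<in> A" for h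
  proof -
    have fh: "(\<lambda>x. f x * h x) \<in> A" by (rule A_mult[OF f h])
    have "1 / 2 * (E (\<lambda>x. f x * h x) f + E f (\<lambda>x. f x * h x) - E (\<lambda>x. f x * f x) h) = (\<integral>x. h x * \<Gamma> f f x \<partial>\<mu>)"
      by (rule \<Gamma>_identity[OF A_form[OF f] A_form[OF f] A_form[OF h]])
    then have \<Gamma>: "(\<integral>x. h x * \<Gamma> f f x \<partial>\<mu>) = 1/2 * (\<integral>x. g2 x * h x \<partial>\<mu>) - (\<integral>x. g x * (f x * h x) \<partial>\<mu>)"
      using E_sym[OF f fh] E_eq[OF f fh] E_eq[OF ff h] by (simp add: g_def g2_def)
    have int: "integrable \<mu> (\<lambda>x. g2 x * h x)" "integrable \<mu> (\<lambda>x. g x * (f x * h x))" "integrable \<mu> (\<lambda>x. \<Gamma> f f x * h x)"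
      by (intro bounded_mult_L1(1) g2 g \<Gamma>i A_Lr h fh order_refl)+
    have "(\<integral>x. F x * h x \<partial>\<mu>) = (\<integral>x. 1/2 * (g2 x * h x) - g x * (f x * h x) - \<Gamma> f f x * h x \<partial>\<mu>)"
      by (rule Bochner_Integration.integral_cong) (auto simp: F_def R_def algebra_simps)
    also have "\<dots> = 1/2 * (\<integral>x. g2 x * h x \<partial>\<mu>) - (\<integral>x. g x * (f x * h x) \<partial>\<mu>) - (\<integral>x. \<Gamma> f f x * h x \<partial>\<mu>)"
      using int by simp
    also have "\<dots> = 0" using \<Gamma> by (simp add: mult.commute)
    finally show ?thesis .
  qed
  have "AE x in \<mu>. F x = 0"
    by (rule Lp_annihilator_of_dense_eq_0[OF p q(1) A_dense Lp_of_L1_Linf[OF q(2) F] ann])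
  then show ?thesis by eventually_elim (simp add: F_def R_def g_def g2_def)
qed

lemma Lop_lin:
  assumes "f \<in> A" "g \<in> A"
  shows "AE x in \<mu>. Lop (\<lambda>x. a * f x + b * g x) x = a * Lop f x + b * Lop g x"
  by (rule sg_generator_unique_AE[OF p Qp(1) Lop_A[OF A_lin[OF assms]] sg_generator_lin[OF p Qp(1) Lop_A Lop_A]]) fact+

lemma \<Gamma>_nonneg: "f \<in> A \<Longrightarrow> AE x in \<mu>. 0 \<le> \<Gamma> f f x"
  by (rule \<Gamma>_form_nonneg[OF A_form])

text \<open>
  The polarisation of \<open>square_rule\<close>, that is, \<open>\<Gamma> f u\<close> up to symmetrisation. Defined by the operator, it makes
  the product rule an identity and inherits bilinearity from the operator.
\<close>

definition cross where
  "cross f u x = 1/2 * (Lop (\<lambda>x. f x * u x) x - f x * Lop u x - u x * Lop f x)"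

text \<open>
  The Cauchy-Schwarz inequality for the form that \<open>square_rule\<close> identifies on the diagonal with \<open>\<Gamma>\<close>:
  nonnegativity of \<open>\<Gamma>\<close> at \<open>f + c * u\<close>, for rational \<open>c\<close>.
\<close>

lemma cross_le:
  assumes f: "f \<in> A" and u: "u \<in> A"
  shows "AE x in \<mu>. \<bar>cross f u x\<bar> \<le> sqrt (\<Gamma> f f x) * sqrt (\<Gamma> u u x)"
proof -
  have "AE x in \<mu>. 0 \<le> \<Gamma> f f x + 2 * c * cross f u x + c\<^sup>2 * \<Gamma> u u x" for c
  proof -
    define w where "w x = 1 * f x + c * u x" for x
    have w: "w \<in> A" unfolding w_def by (rule A_lin[OF f u])
    note ff = A_mult[OF f f] and fu = A_mult[OF f u] and uu = A_mult[OF u u]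
    define m where "m x = 2 * c * (f x * u x) + c\<^sup>2 * (u x * u x)" for x
    have m: "m \<in> A" unfolding m_def by (rule A_lin[OF fu uu])
    have ww: "(\<lambda>x. w x * w x) = (\<lambda>x. 1 * (f x * f x) + 1 * m x)"
      by (auto simp: w_def m_def algebra_simps power2_eq_square)
    have "AE x in \<mu>. Lop (\<lambda>x. w x * w x) x = 1 * Lop (\<lambda>x. f x * f x) x + 1 * Lop m x"
      unfolding ww by (rule Lop_lin[OF ff m])
    moreover have "AE x in \<mu>. Lop m x = 2 * c * Lop (\<lambda>x. f x * u x) x + c\<^sup>2 * Lop (\<lambda>x. u x * u x) x"
      unfolding m_def by (rule Lop_lin[OF fu uu])
    moreover have "AE x in \<mu>. Lop w x = 1 * Lop f x + c * Lop u x"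
      unfolding w_def by (rule Lop_lin[OF f u])
    ultimately show ?thesis using \<Gamma>_nonneg[OF w] square_rule[OF w] square_rule[OF f] square_rule[OF u]
    proof eventually_elim
      case (elim x)
      have "\<Gamma> w w x = \<Gamma> f f x + 2 * c * cross f u x + c\<^sup>2 * \<Gamma> u u x"
        unfolding elim(5-7) elim(1-3) by (simp add: w_def cross_def algebra_simps power2_eq_square)
      then show ?case using elim(4) by simp
    qed
  qed
  then have "AE x in \<mu>. \<forall>c\<in>\<rat>. 0 \<le> \<Gamma> f f x + 2 * c * cross f u x + c\<^sup>2 * \<Gamma> u u x"
    by (subst AE_ball_countable) (auto simp: countable_rat)
  with \<Gamma>_nonneg[OF f] \<Gamma>_nonneg[OF u] show ?thesis
    by eventually_elim (rule discriminant_of_rational_nonneg; blast)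
qed

text \<open>
  Multiplication by \<open>f\<close> is bounded for the graph norm. In
  \<open>(lam - L) (f u) = f (lam - L) u - u L f - 2 cross f u\<close> the functions \<open>f\<close>, \<open>L f\<close> and \<open>\<Gamma> f f\<close> are bounded,
  and the last term is estimated by \<open>cross_le\<close> and the gradient bound for \<open>u\<close>.
\<close>

lemma gnorm_mult_le:
  assumes c: "0 < c" and grad: "\<And>f. f \<in> A \<Longrightarrow> (\<lambda>x. sqrt (\<Gamma> f f x)) \<in> Lp_space \<mu> p"
      "\<And>f. f \<in> A \<Longrightarrow> Lp_norm \<mu> p (\<lambda>x. sqrt (\<Gamma> f f x)) \<le> c * gnorm f"
    and f: "f \<in> A"
  shows "\<exists>K\<ge>0. \<forall>u\<in>A. gnorm (\<lambda>x. f x * u x) \<le> K * gnorm u"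
proof -
  have bound: "\<exists>C\<ge>0. AE x in \<mu>. \<bar>g x\<bar> \<le> C" if g: "g \<in> Linf_space \<mu>" for g
  proof -
    obtain C where "AE x in \<mu>. \<bar>g x\<bar> \<le> C" using g by (auto simp: Linf_space_def)
    then have "AE x in \<mu>. \<bar>g x\<bar> \<le> max C 0" by eventually_elim simp
    then show ?thesis by (intro exI[of _ "max C 0"]) auto
  qed
  obtain C1 where C1: "0 \<le> C1" "AE x in \<mu>. \<bar>f x\<bar> \<le> C1" using bound[OF A_Linf[OF f]] by blast
  obtain C2 where C2: "0 \<le> C2" "AE x in \<mu>. \<bar>Lop f x\<bar> \<le> C2" using bound[OF Lop_bounded[OF f]] by blast
  obtain C3 where C3: "0 \<le> C3" "AE x in \<mu>. \<bar>\<Gamma> f f x\<bar> \<le> C3" using bound[OF \<Gamma>_bounded[OF f]] by blast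
  have mult: "(\<lambda>x. g x * h x) \<in> Lp_space \<mu> p \<and> Lp_norm \<mu> p (\<lambda>x. g x * h x) \<le> C * Lp_norm \<mu> p h"
    if C: "0 \<le> C" "AE x in \<mu>. \<bar>g x\<bar> \<le> C" and g: "g \<in> borel_measurable \<mu>" and h: "h \<in> Lp_space \<mu> p" for g h C
  proof -
    note [measurable] = g Lp_spaceD(1)[OF h]
    have le: "AE x in \<mu>. \<bar>g x * h x\<bar> \<le> \<bar>C * h x\<bar>"
      using C(2) by eventually_elim (use C(1) in \<open>auto simp: abs_mult intro: mult_right_mono\<close>)
    have "(\<lambda>x. g x * h x) \<in> borel_measurable \<mu>" by measurable
    from Lp_dominated[OF p0 this Lp_scale(1)[OF p0 h] le] Lp_scale(2)[OF p0 h, of C] C show ?thesis by simp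
  qed
  define K where "K = C1 + C2 / lam + 2 * sqrt C3 * c"
  have "gnorm (\<lambda>x. f x * u x) \<le> K * gnorm u" if u: "u \<in> A" for u
  proof -
    have fu: "(\<lambda>x. f x * u x) \<in> A" by (rule A_mult[OF f u])
    have meas: "f \<in> borel_measurable \<mu>" "Lop f \<in> borel_measurable \<mu>" "u \<in> Lp_space \<mu> p"
      using A_Linf[OF f] Lop_bounded[OF f] A_Lr[OF u p1] by (auto simp: Linf_space_def)
    have uR: "(\<lambda>x. lam * u x - Lop u x) \<in> Lp_space \<mu> p" by (rule resolvent_Lp[OF Lop_A[OF u]])
    define a where "a x = f x * (lam * u x - Lop u x)" for x
    define b where "b x = Lop f x * u x" for x
    define d where "d x = cross f u x" for x
    have a: "a \<in> Lp_space \<mu> p" "Lp_norm \<mu> p a \<le> C1 * gnorm u"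
      using mult[OF C1 meas(1) uR] by (simp_all add: a_def[abs_def] domain_norm_def)
    have b: "b \<in> Lp_space \<mu> p" "Lp_norm \<mu> p b \<le> C2 * Lp_norm \<mu> p u"
      using mult[OF C2 meas(2,3)] by (simp_all add: b_def[abs_def])
    have "Lp_norm \<mu> p u \<le> gnorm u / lam" using norm_le_gnorm[OF A_dom[OF u]] lam by (simp add: field_simps)
    then have "C2 * Lp_norm \<mu> p u \<le> C2 * (gnorm u / lam)" using C2(1) by (rule mult_left_mono)
    with b(2) have b': "Lp_norm \<mu> p b \<le> C2 / lam * gnorm u" by simp
    have dm: "d \<in> borel_measurable \<mu>"
    proof -
      have [measurable]: "Lop (\<lambda>x. f x * u x) \<in> borel_measurable \<mu>" "Lop u \<in> borel_measurable \<mu>"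
          "u \<in> borel_measurable \<mu>" "f \<in> borel_measurable \<mu>" "Lop f \<in> borel_measurable \<mu>"
        using Lop_bounded[OF fu] Lop_bounded[OF u] meas Lp_spaceD(1)[OF meas(3)] by (auto simp: Linf_space_def)
      show ?thesis unfolding d_def cross_def by measurable
    qed
    have gs: "(\<lambda>x. sqrt C3 * sqrt (\<Gamma> u u x)) \<in> Lp_space \<mu> p"
      "Lp_norm \<mu> p (\<lambda>x. sqrt C3 * sqrt (\<Gamma> u u x)) = sqrt C3 * Lp_norm \<mu> p (\<lambda>x. sqrt (\<Gamma> u u x))"
      using Lp_scale[OF p0 grad(1)[OF u], of "sqrt C3"] C3(1) by auto
    have "AE x in \<mu>. \<bar>d x\<bar> \<le> \<bar>sqrt C3 * sqrt (\<Gamma> u u x)\<bar>"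
      using cross_le[OF f u] C3(2) \<Gamma>_nonneg[OF u]
    proof eventually_elim
      case (elim x)
      have "sqrt (\<Gamma> f f x) * sqrt (\<Gamma> u u x) \<le> sqrt C3 * sqrt (\<Gamma> u u x)"
        using elim by (intro mult_right_mono) auto
      then show ?case using elim(1) by (simp add: d_def)
    qed
    from Lp_dominated[OF p0 dm gs(1) this] have d: "d \<in> Lp_space \<mu> p"
      "Lp_norm \<mu> p d \<le> sqrt C3 * Lp_norm \<mu> p (\<lambda>x. sqrt (\<Gamma> u u x))" by (auto simp: gs(2))
    have "sqrt C3 * Lp_norm \<mu> p (\<lambda>x. sqrt (\<Gamma> u u x)) \<le> sqrt C3 * (c * gnorm u)"
      using C3(1) by (intro mult_left_mono grad u) auto
    with d(2) have d': "Lp_norm \<mu> p d \<le> sqrt C3 * c * gnorm u" by simp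
    have "(\<lambda>x. lam * (f x * u x) - Lop (\<lambda>x. f x * u x) x) = (\<lambda>x. a x + ((- 1) * b x + (- 2) * d x))"
      by (auto simp: a_def b_def d_def cross_def field_simps)
    then have "gnorm (\<lambda>x. f x * u x) = Lp_norm \<mu> p (\<lambda>x. a x + ((- 1) * b x + (- 2) * d x))"
      by (simp add: domain_norm_def)
    also have "\<dots> \<le> Lp_norm \<mu> p a + Lp_norm \<mu> p (\<lambda>x. (- 1) * b x + (- 2) * d x)"
      by (intro Lp_norm_triangle p1 a Lp_lin b d)
    also have "Lp_norm \<mu> p (\<lambda>x. (- 1) * b x + (- 2) * d x) \<le> Lp_norm \<mu> p (\<lambda>x. (- 1) * b x) + Lp_norm \<mu> p (\<lambda>x. (- 2) * d x)"
      by (intro Lp_norm_triangle p1 Lp_scale p0 b d)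
    also have "Lp_norm \<mu> p (\<lambda>x. (- 1) * b x) = Lp_norm \<mu> p b" using Lp_scale(2)[OF p0 b(1), of "- 1"] by simp
    also have "Lp_norm \<mu> p (\<lambda>x. (- 2) * d x) = 2 * Lp_norm \<mu> p d" using Lp_scale(2)[OF p0 d(1), of "- 2"] by simp
    finally have "gnorm (\<lambda>x. f x * u x) \<le> C1 * gnorm u + (C2 / lam * gnorm u + 2 * (sqrt C3 * c * gnorm u))"
      using a(2) b' d' by linarith
    then show ?thesis by (simp add: K_def algebra_simps)
  qed
  moreover have "0 \<le> K" unfolding K_def using C1 C2 C3 c lam by auto
  ultimately show ?thesis by blast
qed

text \<open>
  The function \<open>f\<close> is multiplied by \<open>1 - u\<close>, where \<open>u\<close> is admissible for the part of \<open>S\<close> that meets the support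
  of \<open>f\<close> and has small graph norm. The product vanishes near that part, and the error \<open>f u\<close> is small
  by \<open>gnorm_mult_le\<close>.
\<close>

lemma cutoff:
  assumes c: "0 < c" and grad: "\<And>f. f \<in> A \<Longrightarrow> (\<lambda>x. sqrt (\<Gamma> f f x)) \<in> Lp_space \<mu> p"
      "\<And>f. f \<in> A \<Longrightarrow> Lp_norm \<mu> p (\<lambda>x. sqrt (\<Gamma> f f x)) \<le> c * gnorm f"
    and cap: "cap \<mu> p Gen lam A S = 0" and S: "compact (fun_support f \<inter> S)"
    and f: "f \<in> A" and e: "0 < e"
  shows "\<exists>f'\<in>supported_in A (- S). fun_support f' \<subseteq> fun_support f \<and> gnorm (\<lambda>x. f x - f' x) < e"
proof -
  obtain K where K: "0 \<le> K" "\<And>u. u \<in> A \<Longrightarrow> gnorm (\<lambda>x. f x * u x) \<le> K * gnorm u"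
    using gnorm_mult_le[OF c grad f] by blast
  obtain u where u: "u \<in> cap_admissible A (fun_support f \<inter> S)" "gnorm u < e / (K + 1)"
    using small_admissible[OF cap S, of "e / (K + 1)"] e K(1) by auto
  then obtain U where U: "open U" "fun_support f \<inter> S \<subseteq> U" "\<And>x. x \<in> U \<Longrightarrow> u x = 1" and uA: "u \<in> A"
    by (auto simp: cap_admissible_def)
  define f' where "f' x = f x - f x * u x" for x
  have f'A: "f' \<in> A" unfolding f'_def by (intro A_diff f A_mult uA)
  have sub: "{x. f' x \<noteq> 0} \<subseteq> fun_support f \<inter> - U"
    using U(3) closure_subset[of "{x. f x \<noteq> 0}"] by (auto simp: f'_def fun_support_def)
  have "closed (fun_support f \<inter> - U)" using U(1) by (auto simp: fun_support_def)
  with sub have supp: "fun_support f' \<subseteq> fun_support f \<inter> - U"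
    unfolding fun_support_def[of f'] by (rule closure_minimal)
  have "gnorm (\<lambda>x. f x - f' x) = gnorm (\<lambda>x. f x * u x)" by (simp add: f'_def)
  also have "\<dots> \<le> K * gnorm u" by (rule K(2)[OF uA])
  also have "\<dots> \<le> (K + 1) * gnorm u" using gnorm_nonneg[of u] by (simp add: mult_right_mono)
  also have "\<dots> < e" using u(2) K(1) by (simp add: field_simps)
  finally show ?thesis using f'A supp U(2) by (intro bexI[of _ f']) (auto simp: supported_in_def)
qed

end

theorem theorem1:
  fixes \<mu> :: "'a::metric_space measure"
    and L :: "'a operator_graph"
    and DE :: "('a \<Rightarrow> real) set"
    and E :: "('a \<Rightarrow> real) \<Rightarrow> ('a \<Rightarrow> real) \<Rightarrow> real"
    and \<Gamma> :: "('a \<Rightarrow> real) \<Rightarrow> ('a \<Rightarrow> real) \<Rightarrow> 'a \<Rightarrow> real"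
    and P :: "real \<Rightarrow> ('a \<Rightarrow> real) \<Rightarrow> 'a \<Rightarrow> real"
    and Q :: "real \<Rightarrow> real \<Rightarrow> ('a \<Rightarrow> real) \<Rightarrow> 'a \<Rightarrow> real"
    and lam p :: real
    and A :: "('a \<Rightarrow> real) set"
  defines "Lgen \<equiv> \<lambda>q. sg_generator \<mu> q (Q q)"
  assumes setting: "local_dirichlet_setting \<mu> L DE E \<Gamma> P Q"
    and lam: "0 < lam"
    and p: "1 < p"
    and A_borel: "A \<subseteq> borel_measurable borel"
    and A_subspace: "fun_subspace A"
    and A_domain: "A \<subseteq> Domain (Lgen p)"
    and A_unique: "Lp_unique \<mu> p (op_restrict (Lgen p) A)"
  shows
    "((\<forall>K. compact K \<longrightarrow> cap_admissible A K \<noteq> {}) \<longrightarrow>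
        (\<forall>S. closed S \<and> emeasure \<mu> S = 0 \<and>
           Lp_unique \<mu> p (op_restrict (Lgen p) (supported_in A (- S))) \<longrightarrow>
           cap \<mu> p (Lgen p) lam A S = 0))
     \<and>
     ((\<forall>f\<in>A. \<forall>g\<in>A. (\<lambda>x. f x * g x) \<in> A) \<and>
      A \<subseteq> bounded_borel \<inter> Lp_space \<mu> 1 \<and>
      A \<subseteq> Domain (Lgen 1) \<and>
      (\<forall>f\<in>A. \<Gamma> f f \<in> Linf_space \<mu> \<and> op_app (Lgen p) f \<in> Linf_space \<mu>) \<and>
      (\<exists>c>0. \<forall>f\<in>A. (\<lambda>x. sqrt (\<Gamma> f f x)) \<in> Lp_space \<mu> p \<and>
         Lp_norm \<mu> p (\<lambda>x. sqrt (\<Gamma> f f x)) \<le> c * domain_norm \<mu> p (Lgen p) lam f) \<longrightarrow>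
        (\<forall>S. compact S \<and> cap \<mu> p (Lgen p) lam A S = 0 \<longrightarrow>
           emeasure \<mu> S = 0 \<and>
           Lp_unique \<mu> p (op_restrict (Lgen p) (supported_in A (- S))) \<and>
           op_closure \<mu> p (op_restrict (Lgen p) (supported_in A (- S))) = Lgen p)
        \<and>
        ((\<forall>f\<in>A. \<forall>\<epsilon>>0. \<exists>g\<in>compactly_supported A.
            domain_norm \<mu> p (Lgen p) lam (\<lambda>x. f x - g x) < \<epsilon>) \<longrightarrow>
         (\<forall>S. closed S \<and> cap \<mu> p (Lgen p) lam A S = 0 \<longrightarrow>
           emeasure \<mu> S = 0 \<and>
           Lp_unique \<mu> p (op_restrict (Lgen p) (supported_in A (- S))) \<and>
           op_closure \<mu> p (op_restrict (Lgen p) (supported_in A (- S))) = Lgen p \<and>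
           Lp_unique \<mu> p (op_restrict (Lgen p) (compactly_supported (supported_in A (- S)))) \<and>
           op_closure \<mu> p (op_restrict (Lgen p) (compactly_supported (supported_in A (- S)))) = Lgen p)))"
proof -
  interpret local_dirichlet_setting \<mu> L DE E \<Gamma> P Q by (rule setting)
  interpret core_setting \<mu> L DE E \<Gamma> P Q lam p A
    by (intro core_setting.intro core_setting_axioms.intro setting lam p A_borel A_subspace)
      (use A_domain A_unique in \<open>simp_all add: Lgen_def\<close>)
  show ?thesis
    unfolding Lgen_def
  proof (rule conjI; rule impI)
    assume "\<forall>K. compact K \<longrightarrow> cap_admissible A K \<noteq> {}"
    then show "\<forall>S. closed S \<and> emeasure \<mu> S = 0 \<and> Lp_unique \<mu> p (op_restrict Gen (supported_in A (- S))) \<longrightarrow>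
        cap \<mu> p Gen lam A S = 0"
      by (intro allI impI cap_null_of_unique) auto
  next
    assume ii: "(\<forall>f\<in>A. \<forall>g\<in>A. (\<lambda>x. f x * g x) \<in> A) \<and> A \<subseteq> bounded_borel \<inter> Lp_space \<mu> 1 \<and>
      A \<subseteq> Domain (sg_generator \<mu> 1 (Q 1)) \<and>
      (\<forall>f\<in>A. \<Gamma> f f \<in> Linf_space \<mu> \<and> op_app Gen f \<in> Linf_space \<mu>) \<and>
      (\<exists>c>0. \<forall>f\<in>A. (\<lambda>x. sqrt (\<Gamma> f f x)) \<in> Lp_space \<mu> p \<and>
        Lp_norm \<mu> p (\<lambda>x. sqrt (\<Gamma> f f x)) \<le> c * gnorm f)"
    interpret algebra_core_setting \<mu> L DE E \<Gamma> P Q lam p A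
      by (intro algebra_core_setting.intro algebra_core_setting_axioms.intro core_setting_axioms) (use ii in auto)
    obtain c where c: "0 < c" and grad: "\<And>f. f \<in> A \<Longrightarrow> (\<lambda>x. sqrt (\<Gamma> f f x)) \<in> Lp_space \<mu> p"
      "\<And>f. f \<in> A \<Longrightarrow> Lp_norm \<mu> p (\<lambda>x. sqrt (\<Gamma> f f x)) \<le> c * gnorm f"
      using ii by blast
    note cut = cutoff[OF c grad]
    have sub: "supported_in A (- S) \<subseteq> A" "compactly_supported (supported_in A (- S)) \<subseteq> A" for S
      by (auto simp: supported_in_def compactly_supported_def)
    show "(\<forall>S. compact S \<and> cap \<mu> p Gen lam A S = 0 \<longrightarrow>
           emeasure \<mu> S = 0 \<and>
           Lp_unique \<mu> p (op_restrict Gen (supported_in A (- S))) \<and>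
           op_closure \<mu> p (op_restrict Gen (supported_in A (- S))) = Gen)
        \<and>
        ((\<forall>f\<in>A. \<forall>\<epsilon>>0. \<exists>g\<in>compactly_supported A. gnorm (\<lambda>x. f x - g x) < \<epsilon>) \<longrightarrow>
         (\<forall>S. closed S \<and> cap \<mu> p Gen lam A S = 0 \<longrightarrow>
           emeasure \<mu> S = 0 \<and>
           Lp_unique \<mu> p (op_restrict Gen (supported_in A (- S))) \<and>
           op_closure \<mu> p (op_restrict Gen (supported_in A (- S))) = Gen \<and>
           Lp_unique \<mu> p (op_restrict Gen (compactly_supported (supported_in A (- S)))) \<and>
           op_closure \<mu> p (op_restrict Gen (compactly_supported (supported_in A (- S)))) = Gen))"
    proof (intro conjI[of "\<forall>S. _ S"] allI impI)
      fix S assume S: "compact S \<and> cap \<mu> p Gen lam A S = 0"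
      then have cap: "cap \<mu> p Gen lam A S = 0" and cl: "closed S" by (auto intro: compact_imp_closed)
      have "\<exists>f'\<in>supported_in A (- S). gnorm (\<lambda>x. f x - f' x) < e" if f: "f \<in> A" and e: "0 < e" for f e
      proof -
        have "compact (fun_support f \<inter> S)" using S by (intro closed_Int_compact) (auto simp: fun_support_def)
        from cut[OF _ _ cap this f e] show ?thesis by blast
      qed
      note dense = unique_of_gnorm_dense[OF sub(1) this]
      show "emeasure \<mu> S = 0 \<and> Lp_unique \<mu> p (op_restrict Gen (supported_in A (- S))) \<and>
           op_closure \<mu> p (op_restrict Gen (supported_in A (- S))) = Gen"
        using null_of_cap_null[OF cap cl] dense by blast
    next
      fix S assume Ac: "\<forall>f\<in>A. \<forall>\<epsilon>>0. \<exists>g\<in>compactly_supported A. gnorm (\<lambda>x. f x - g x) < \<epsilon>"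
        and S: "closed S \<and> cap \<mu> p Gen lam A S = 0"
      then have cap: "cap \<mu> p Gen lam A S = 0" and cl: "closed S" by auto
      have app: "\<exists>f'\<in>compactly_supported (supported_in A (- S)). gnorm (\<lambda>x. f x - f' x) < e"
        if f: "f \<in> A" and e: "0 < e" for f e
      proof -
        have e2: "e / 2 > 0" using e by simp
        obtain g where g: "g \<in> A" "compact (fun_support g)" "gnorm (\<lambda>x. f x - g x) < e / 2"
          using Ac f e2 unfolding compactly_supported_def by blast
        have "compact (fun_support g \<inter> S)" using g(2) cl by (rule compact_Int_closed)
        from cut[OF _ _ cap this g(1) e2] obtain f' where f': "f' \<in> supported_in A (- S)"
          "fun_support f' \<subseteq> fun_support g" "gnorm (\<lambda>x. g x - f' x) < e / 2" by blast
        have f'A: "f' \<in> A" using f' by (simp add: supported_in_def)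
        have "gnorm (\<lambda>x. (f x - g x) + (g x - f' x)) \<le> gnorm (\<lambda>x. f x - g x) + gnorm (\<lambda>x. g x - f' x)"
          by (intro gnorm_triangle A_dom A_diff f g f'A)
        then have "gnorm (\<lambda>x. f x - f' x) < e" using g(3) f'(3) by simp
        moreover have "compact (fun_support f')"
          using compact_Int_closed[OF g(2), of "fun_support f'"] f'(2) by (simp add: fun_support_def Int_absorb1)
        ultimately show ?thesis using f'(1) by (auto simp: compactly_supported_def)
      qed
      then have "\<exists>f'\<in>supported_in A (- S). gnorm (\<lambda>x. f x - f' x) < e" if "f \<in> A" "0 < e" for f e
        using that unfolding compactly_supported_def by blast
      note dense = unique_of_gnorm_dense[OF sub(1) this] unique_of_gnorm_dense[OF sub(2) app]
      show "emeasure \<mu> S = 0 \<and> Lp_unique \<mu> p (op_restrict Gen (supported_in A (- S))) \<and>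
           op_closure \<mu> p (op_restrict Gen (supported_in A (- S))) = Gen \<and>
           Lp_unique \<mu> p (op_restrict Gen (compactly_supported (supported_in A (- S)))) \<and>
           op_closure \<mu> p (op_restrict Gen (compactly_supported (supported_in A (- S)))) = Gen"
        using null_of_cap_null[OF cap cl] dense by blast
    qed
  qed
qed

end
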